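(* Let $A_0,\dots,A_{\bm r}$ be real matrices, $A_i$ of size $N_i\times d$, and for $h\ge0$ set $\mathcal A_h=\sum_{i=0}^{\bm r}h^{2i}\,{}^t\!A_iA_i$. Assume $\bigcap_{i=0}^{\bm r}\ker A_i=\{0\}$ (equivalently, the block matrix ${}^t(A_0,hA_1,\dots,h^{\bm r}A_{\bm r})$ has rank $d$ for $h>0$). Define $\mathcal V_0=\mathrm{Im}({}^t\!A_0A_0)$ and, for $1\le j\le\bm r$, $\hat A_j=P_{j-1}\,{}^t\!A_jA_j|_{\mathcal V_{j-1}^\perp}$ (a symmetric operator on $\mathcal V_{j-1}^\perp$, where $P_{j-1}$ is the orthogonal projection of $\mathbb R^d$ onto $\mathcal V_{j-1}^\perp$ and $\perp$ refers to the standard inner product), $\mathcal V_j=\mathcal V_{j-1}+\mathrm{Im}(\hat A_j)$; set $\hat A_0={}^t\!A_0A_0$, $n_j=\dim\mathcal V_j$, $n_{-1}=0$. Then $n_{\bm r}=d$, and the $d$ eigenvalues of $\mathcal A_h$ (counted with multiplicity) are given by real-analytic eigenbranches which can be grouped so that, for each $0\le j\le\bm r$, there are exactly $n_j-n_{j-1}$ branches of the form $\lambda^j_i(h)=h^{2j}\eta^j_i(h)$, $1\le i\le n_j-n_{j-1}$, where the analytic functions $\eta^j_i(h)$ converge as $h\to0$ to the $n_j-n_{j-1}$ nonzero eigenvalues (with multiplicity) of $\hat A_j$.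
   Context: ${}^t\!A$ denotes the transpose of $A$. Since $\mathcal A_h$ is a real-analytic family of symmetric matrices, its eigenvalues can be organized into real-analytic branches in $h$. *)

theory Defs
  imports "HOL-Analysis.Analysis"
begin

text \<open>A real N x d matrix A is represented by its rows: A k :: real^'d for k < N
  (so that (A x)_k = A k \<bullet> x). Different matrices may have different numbers of rows.\<close>

definition mat_ker :: "nat \<Rightarrow> (nat \<Rightarrow> real^'d) \<Rightarrow> (real^'d) set" where
  "mat_ker N A = {x. \<forall>k<N. A k \<bullet> x = 0}"

definition gram :: "nat \<Rightarrow> (nat \<Rightarrow> real^'d) \<Rightarrow> real^'d^'d" where
  "gram N A = (\<chi> a b. \<Sum>k<N. A k $ a * A k $ b)"

definition orth_proj :: "(real^'d) set \<Rightarrow> real^'d \<Rightarrow> real^'d" where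
  "orth_proj W x = (THE y. y \<in> W \<and> x - y \<in> orthogonal_comp W)"

definition alg_mult :: "(real^'d \<Rightarrow> real^'d) \<Rightarrow> (real^'d) set \<Rightarrow> real \<Rightarrow> nat" where
  "alg_mult T W \<mu> = dim {v \<in> W. \<exists>k. ((\<lambda>x. T x - \<mu> *\<^sub>R x) ^^ k) v = 0}"

definition real_analytic_on :: "(real \<Rightarrow> real) \<Rightarrow> real set \<Rightarrow> bool" where
  "real_analytic_on f S \<longleftrightarrow> (\<forall>x\<in>S. \<exists>r>0. \<exists>c::nat \<Rightarrow> real.
      \<forall>y. \<bar>y - x\<bar> < r \<longrightarrow> (\<lambda>n. c n * (y - x) ^ n) sums f y)"

definition calA :: "nat \<Rightarrow> (nat \<Rightarrow> nat) \<Rightarrow> (nat \<Rightarrow> nat \<Rightarrow> real^'d) \<Rightarrow> real \<Rightarrow> real^'d^'d" where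
  "calA r N A h = (\<Sum>i\<le>r. (h ^ (2 * i)) *\<^sub>R gram (N i) (A i))"

fun Vsp :: "(nat \<Rightarrow> nat) \<Rightarrow> (nat \<Rightarrow> nat \<Rightarrow> real^'d) \<Rightarrow> nat \<Rightarrow> (real^'d) set" where
  "Vsp N A 0 = range (\<lambda>x. gram (N 0) (A 0) *v x)"
| "Vsp N A (Suc j) = Vsp N A j +
     (\<lambda>x. orth_proj (orthogonal_comp (Vsp N A j)) (gram (N (Suc j)) (A (Suc j)) *v x))
       ` orthogonal_comp (Vsp N A j)"

definition Wdom :: "(nat \<Rightarrow> nat) \<Rightarrow> (nat \<Rightarrow> nat \<Rightarrow> real^'d) \<Rightarrow> nat \<Rightarrow> (real^'d) set" where
  "Wdom N A j = (if j = 0 then UNIV else orthogonal_comp (Vsp N A (j - 1)))"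

text \<open>hat A_0 = tA_0 A_0, hat A_j = P_{j-1} tA_j A_j (to be considered on Wdom j).\<close>
definition Ahat :: "(nat \<Rightarrow> nat) \<Rightarrow> (nat \<Rightarrow> nat \<Rightarrow> real^'d) \<Rightarrow> nat \<Rightarrow> real^'d \<Rightarrow> real^'d" where
  "Ahat N A j x = (if j = 0 then gram (N 0) (A 0) *v x
     else orth_proj (orthogonal_comp (Vsp N A (j - 1))) (gram (N j) (A j) *v x))"

definition ndim :: "(nat \<Rightarrow> nat) \<Rightarrow> (nat \<Rightarrow> nat \<Rightarrow> real^'d) \<Rightarrow> nat \<Rightarrow> nat" where
  "ndim N A j = dim (Vsp N A j)"

definition nincr :: "(nat \<Rightarrow> nat) \<Rightarrow> (nat \<Rightarrow> nat \<Rightarrow> real^'d) \<Rightarrow> nat \<Rightarrow> nat" where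
  "nincr N A j = ndim N A j - (if j = 0 then 0 else ndim N A (j - 1))"

end

theory Submission
  imports Defs "HOL-Complex_Analysis.Complex_Analysis" "HOL-Combinatorics.Permutations"
    "HOL-Real_Asymp.Real_Asymp"
begin

text \<open>
  \<^emph>\<open>Existence of analytic branches.\<close> The power sums of the eigenvalues of a polynomial family
  of symmetric matrices are traces of powers, hence analytic in the parameter \<open>h\<close>; only this
  is used, so no characteristic polynomial is needed. Near a point, subtract the mean of the
  eigenvalues. If the second power sum now vanishes identically, all eigenvalues coincide;
  otherwise it has even order \<open>2q\<close> because it is nonnegative, every eigenvalue is \<open>O(h^q)\<close>, and
  division by \<open>h^q\<close> gives a family with analytic power sums whose eigenvalues at the point are
  not all equal. Cauchy's integral formula shows that the power sums of a cluster of eigenvalues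
  are again analytic, so the family splits and one concludes by induction on its size. The local
  branches are glued along the half-line by the identity theorem.

  \<^emph>\<open>Orders and limits.\<close> The orthogonal complement of \<open>V_j\<close> is the intersection of the kernels of
  \<open>A_0, \<dots>, A_j\<close>. Let \<open>\<mu> > 0\<close> not be an eigenvalue of \<open>hat A_k\<close> and let \<open>U\<close> be the span of the
  eigenvectors of \<open>hat A_k\<close> with eigenvalue below \<open>\<mu>\<close>. For small \<open>h > 0\<close> the form of
  \<open>A(h) - \<mu> h^(2k)\<close> is negative definite on \<open>U\<close> and positive definite on its complement, so exactly
  \<open>dim U\<close> branches lie below \<open>\<mu> h^(2k)\<close>. Comparing these counts for all \<open>k\<close> and \<open>\<mu>\<close> with the leading
  terms \<open>c h^m\<close> of the branches determines the multiset of the pairs \<open>(m, c)\<close>.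
\<close>

text \<open>Roots of a polynomial with analytic coefficients are in general only Puiseux series.
  Here the roots are real on both sides of every point, and this is what rules out fractional
  exponents. After division by the integer power the family is undefined at the point itself;
  compactness supplies its value there, a multiset \<open>L\<close> of reals whose power sums are
  the limits. Cauchy's formula needs the coefficients of the polynomial whose roots are counted, and
  Newton's identities produce them analytically from the power sums. Spectra are multisets, and an
  eigenbasis is chosen afresh at each \<open>h\<close>, so the dependence of eigenvectors on
  \<open>h\<close> never has to be discussed. Thresholds are only placed at
  \<open>\<mu> h^(2k)\<close>, so odd orders are not excluded directly. They disappear because, for
  \<open>k < r\<close>, the branches of order above \<open>2k\<close> and those of order at least
  \<open>2k+2\<close> are both counted by the dimension of the common kernel of
  \<open>A_0, ..., A_k\<close>. Gluing starts from an interval around 0, so the branches are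
  analytic on a neighbourhood of the closed half-line.\<close>

section \<open>Real-analytic germs\<close>

text \<open>Encoded by a holomorphic germ that agrees with \<open>f\<close> on the real line, so
  that Cauchy theory applies directly. The filter \<open>nhds x\<close> contains \<open>x\<close>
  itself, so the value \<open>f x\<close> is fixed too. \<open>real_analytic_on_if_at\<close> leads
  back to power series.\<close>

definition real_analytic_at :: "(real \<Rightarrow> real) \<Rightarrow> real \<Rightarrow> bool" where
  "real_analytic_at f x \<longleftrightarrow> (\<exists>F. F analytic_on {complex_of_real x} \<and>
     (\<forall>\<^sub>F y in nhds x. F (complex_of_real y) = complex_of_real (f y)))"

lemma real_analytic_atI:
  assumes "F analytic_on {complex_of_real x}"
    and "\<forall>\<^sub>F y in nhds x. F (complex_of_real y) = complex_of_real (f y)"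
  shows "real_analytic_at f x"
  using assms unfolding real_analytic_at_def by blast

lemma real_analytic_at_cong:
  assumes "real_analytic_at f x" "\<forall>\<^sub>F y in nhds x. f y = g y"
  shows "real_analytic_at g x"
proof -
  obtain F where F: "F analytic_on {complex_of_real x}"
    "\<forall>\<^sub>F y in nhds x. F (complex_of_real y) = complex_of_real (f y)"
    using assms(1) unfolding real_analytic_at_def by blast
  show ?thesis
    by (rule real_analytic_atI[OF F(1)]) (use F(2) assms(2) in eventually_elim, simp)
qed

lemma real_analytic_at_const: "real_analytic_at (\<lambda>_. c) x"
  by (rule real_analytic_atI[of "\<lambda>_. of_real c"]) auto

lemma real_analytic_at_ident: "real_analytic_at (\<lambda>y. y) x"
  by (rule real_analytic_atI[of "\<lambda>z. z"]) auto

lemma real_analytic_at_add: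
  assumes "real_analytic_at f x" "real_analytic_at g x"
  shows "real_analytic_at (\<lambda>y. f y + g y) x"
proof -
  obtain F G where F: "F analytic_on {complex_of_real x}"
    "\<forall>\<^sub>F y in nhds x. F (complex_of_real y) = complex_of_real (f y)"
    and G: "G analytic_on {complex_of_real x}"
    "\<forall>\<^sub>F y in nhds x. G (complex_of_real y) = complex_of_real (g y)"
    using assms unfolding real_analytic_at_def by blast
  show ?thesis
    by (rule real_analytic_atI[OF analytic_on_add[OF F(1) G(1)]])
      (use F(2) G(2) in eventually_elim, simp)
qed

lemma real_analytic_at_mult:
  assumes "real_analytic_at f x" "real_analytic_at g x"
  shows "real_analytic_at (\<lambda>y. f y * g y) x"
proof -
  obtain F G where F: "F analytic_on {complex_of_real x}"
    "\<forall>\<^sub>F y in nhds x. F (complex_of_real y) = complex_of_real (f y)"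
    and G: "G analytic_on {complex_of_real x}"
    "\<forall>\<^sub>F y in nhds x. G (complex_of_real y) = complex_of_real (g y)"
    using assms unfolding real_analytic_at_def by blast
  show ?thesis
    by (rule real_analytic_atI[OF analytic_on_mult[OF F(1) G(1)]])
      (use F(2) G(2) in eventually_elim, simp)
qed

lemma real_analytic_at_minus:
  assumes "real_analytic_at f x"
  shows "real_analytic_at (\<lambda>y. - f y) x"
  using real_analytic_at_mult[OF real_analytic_at_const[of "-1"] assms] by simp

lemma real_analytic_at_diff:
  assumes "real_analytic_at f x" "real_analytic_at g x"
  shows "real_analytic_at (\<lambda>y. f y - g y) x"
  using real_analytic_at_add[OF assms(1) real_analytic_at_minus[OF assms(2)]] by simp

lemma real_analytic_at_power:
  assumes "real_analytic_at f x"
  shows "real_analytic_at (\<lambda>y. f y ^ n) x"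
  by (induction n) (simp_all add: assms real_analytic_at_const real_analytic_at_mult)

lemma real_analytic_at_sum:
  assumes "\<And>i. i \<in> I \<Longrightarrow> real_analytic_at (f i) x"
  shows "real_analytic_at (\<lambda>y. \<Sum>i\<in>I. f i y) x"
  using assms
  by (induction I rule: infinite_finite_induct)
    (simp_all add: real_analytic_at_const real_analytic_at_add)

lemma real_analytic_at_isCont:
  assumes "real_analytic_at f x"
  shows "isCont f x"
proof -
  obtain F where F: "F analytic_on {complex_of_real x}"
    "\<forall>\<^sub>F y in nhds x. F (complex_of_real y) = complex_of_real (f y)"
    using assms unfolding real_analytic_at_def by blast
  have "isCont F (of_real x)"
    using F(1) by (simp add: analytic_at_imp_isCont)
  then have "isCont (\<lambda>y. F (of_real y)) x"
    by (rule isCont_o2[OF isCont_of_real[OF continuous_ident]])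
  then have "isCont (\<lambda>y. Re (F (of_real y))) x"
    by (rule isCont_Re)
  moreover have "\<forall>\<^sub>F y in nhds x. Re (F (of_real y)) = f y"
    using F(2) by eventually_elim simp
  ultimately show ?thesis
    by (rule isCont_cong[THEN iffD1, rotated])
qed

lemma real_analytic_at_inverse:
  assumes "real_analytic_at f x" "f x \<noteq> 0"
  shows "real_analytic_at (\<lambda>y. inverse (f y)) x"
proof -
  obtain F where F: "F analytic_on {complex_of_real x}"
    "\<forall>\<^sub>F y in nhds x. F (complex_of_real y) = complex_of_real (f y)"
    using assms unfolding real_analytic_at_def by blast
  have "F (of_real x) \<noteq> 0"
    using eventually_nhds_x_imp_x[OF F(2)] assms(2) by simp
  then have "(\<lambda>z. inverse (F z)) analytic_on {complex_of_real x}"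
    using F(1) by (intro analytic_on_inverse) auto
  then show ?thesis
    by (rule real_analytic_atI) (use F(2) in eventually_elim, simp)
qed

lemma real_analytic_at_divide:
  assumes "real_analytic_at f x" "real_analytic_at g x" "g x \<noteq> 0"
  shows "real_analytic_at (\<lambda>y. f y / g y) x"
  using real_analytic_at_mult[OF assms(1) real_analytic_at_inverse[OF assms(2,3)]]
  by (simp add: divide_inverse)

lemma real_analytic_on_if_at:
  assumes "\<And>x. x \<in> S \<Longrightarrow> real_analytic_at f x"
  shows "real_analytic_on f S"
  unfolding real_analytic_on_def
proof
  fix x assume "x \<in> S"
  then obtain F where F: "F analytic_on {complex_of_real x}"
    "\<forall>\<^sub>F y in nhds x. F (complex_of_real y) = complex_of_real (f y)"
    using assms unfolding real_analytic_at_def by blast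
  obtain e where e: "e > 0" "F holomorphic_on ball (of_real x) e"
    using F(1) unfolding analytic_on_def by blast
  obtain d where d: "d > 0" "\<And>y. dist y x < d \<Longrightarrow> F (of_real y) = of_real (f y)"
    using F(2) unfolding eventually_nhds_metric by blast
  \<comment> \<open>The Taylor coefficients of \<open>F\<close> are not known to be real. Real parts
    can be taken term by term because the powers of \<open>y - x\<close> are real.\<close>
  define c where "c n = Re ((deriv ^^ n) F (of_real x) / fact n)" for n
  have "(\<lambda>n. c n * (y - x) ^ n) sums f y" if y: "\<bar>y - x\<bar> < min d e" for y
  proof -
    have "of_real y \<in> ball (complex_of_real x) e"
      using y by (simp add: dist_real_def abs_minus_commute dist_of_real)
    from holomorphic_power_series[OF e(2) this]
    have "(\<lambda>n. Re ((deriv ^^ n) F (of_real x) / fact n * (of_real y - of_real x) ^ n))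
          sums Re (F (of_real y))"
      by (rule sums_Re)
    moreover have "Re ((deriv ^^ n) F (of_real x) / fact n * (of_real y - of_real x) ^ n)
        = c n * (y - x) ^ n" for n
    proof -
      have "(of_real y - of_real x :: complex) ^ n = of_real ((y - x) ^ n)"
        by simp
      then show ?thesis
        unfolding c_def by (simp only: times_complex.sel Re_complex_of_real Im_complex_of_real)
    qed
    ultimately show ?thesis
      using d(2)[of y] y by (simp add: dist_real_def)
  qed
  then show "\<exists>r>0. \<exists>c. \<forall>y. \<bar>y - x\<bar> < r \<longrightarrow> (\<lambda>n. c n * (y - x) ^ n) sums f y"
    using d(1) e(1) by (intro exI[of _ "min d e"]) auto
qed

text \<open>The factorization of \<open>F\<close> at an isolated zero, brought down to the real
  line; a nonzero value \<open>f x\<close> is the case \<open>m = 0\<close>.\<close>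

lemma real_analytic_at_order:
  assumes "real_analytic_at f x"
  obtains (zero) "\<forall>\<^sub>F y in nhds x. f y = 0"
  | (order) m g where "real_analytic_at g x" "g x \<noteq> 0" "\<forall>\<^sub>F y in nhds x. f y = (y - x) ^ m * g y"
proof -
  obtain F where F: "F analytic_on {complex_of_real x}"
    "\<forall>\<^sub>F y in nhds x. F (complex_of_real y) = complex_of_real (f y)"
    using assms unfolding real_analytic_at_def by blast
  obtain e where e: "e > 0" "F holomorphic_on ball (of_real x) e"
    using F(1) unfolding analytic_on_def by blast
  have Fx: "F (of_real x) = of_real (f x)"
    using eventually_nhds_x_imp_x[OF F(2)] .
  have near: "\<forall>\<^sub>F y in nhds x. complex_of_real y \<in> ball (of_real x) r" if "r > 0" for r
    unfolding eventually_nhds_metric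
    by (rule exI[of _ r]) (use that in \<open>auto simp: dist_of_real dist_commute\<close>)
  consider "f x \<noteq> 0" | "f x = 0" "F constant_on ball (of_real x) e"
    | "f x = 0" "\<not> F constant_on ball (of_real x) e" by blast
  then show ?thesis
  proof cases
    case 1
    then show ?thesis
      by (intro order[of f 0]) (use assms in auto)
  next
    case 2
    then have z: "F w = 0" if "w \<in> ball (of_real x) e" for w
      using Fx that e(1) unfolding constant_on_def
      by (metis centre_in_ball of_real_0)
    have "\<forall>\<^sub>F y in nhds x. f y = 0"
      using F(2) near[OF e(1)] by eventually_elim (use z in simp)
    then show ?thesis by (rule zero)
  next
    case 3
    obtain G r n where G: "0 < n" "0 < r" "G holomorphic_on ball (complex_of_real x) r"
      "\<And>w. w \<in> ball (complex_of_real x) r \<Longrightarrow> F w = (w - complex_of_real x) ^ n * G w"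
      "\<And>w. w \<in> ball (complex_of_real x) r \<Longrightarrow> G w \<noteq> 0"
      using holomorphic_factor_zero_nonconstant[OF e(2) open_ball connected_ball, of "of_real x"]
        3 Fx e(1) by (metis centre_in_ball of_real_0)
    have G_an: "G analytic_on {complex_of_real x}"
      unfolding analytic_on_def using G(2,3) by blast
    \<comment> \<open>Off \<open>x\<close> the cofactor \<open>G\<close> is a quotient of real
      numbers, hence real on the real line; at \<open>x\<close> it is real by continuity.\<close>
    have ev: "\<forall>\<^sub>F y in nhds x. y \<noteq> x \<longrightarrow> Im (G (of_real y)) = 0"
      using F(2) near[OF G(2)]
    proof eventually_elim
      case (elim y)
      show ?case
      proof
        assume "y \<noteq> x"
        have "of_real (f y) = of_real ((y - x) ^ n) * G (of_real y)"
          using elim G(4)[of "of_real y"] by simp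
        then have "G (of_real y) = of_real (f y / (y - x) ^ n)"
          using \<open>y \<noteq> x\<close> by (simp add: field_simps)
        then show "Im (G (of_real y)) = 0"
          by (metis Im_complex_of_real)
      qed
    qed
    have "isCont G (of_real x)"
      using G_an by (simp add: analytic_at_imp_isCont)
    then have "isCont (\<lambda>y. G (of_real y)) x"
      by (rule isCont_o2[OF isCont_of_real[OF continuous_ident]])
    then have "isCont (\<lambda>y. Im (G (of_real y))) x"
      by (rule isCont_Im)
    then have "((\<lambda>y. Im (G (of_real y))) \<longlongrightarrow> Im (G (of_real x))) (at x)"
      by (simp add: isCont_def)
    moreover have "((\<lambda>y. Im (G (of_real y))) \<longlongrightarrow> 0) (at x)"
      by (rule tendsto_eventually) (use ev in \<open>simp add: eventually_at_filter\<close>)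
    ultimately have Gx: "Im (G (of_real x)) = 0"
      by (rule tendsto_unique[OF at_neq_bot])
    define g where "g y = Re (G (of_real y))" for y
    have g_eq: "\<forall>\<^sub>F y in nhds x. G (of_real y) = of_real (g y)"
      using ev by eventually_elim (use Gx in \<open>auto simp: g_def complex_eq_iff\<close>)
    have ga: "real_analytic_at g x"
      using real_analytic_atI[OF G_an g_eq] .
    have gx: "g x \<noteq> 0"
      using eventually_nhds_x_imp_x[OF g_eq] G(5)[of "of_real x"] G(2) by auto
    have "\<forall>\<^sub>F y in nhds x. f y = (y - x) ^ n * g y"
      using F(2) near[OF G(2)] g_eq
    proof eventually_elim
      case (elim y)
      have "complex_of_real (f y) = of_real ((y - x) ^ n * g y)"
        using elim G(4)[of "of_real y"] by simp
      then show ?case by (simp only: of_real_eq_iff)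
    qed
    then show ?thesis using order ga gx by blast
  qed
qed

text \<open>In the factorization \<open>(y - x)^m * u y\<close> of the difference with
  \<open>u x \<noteq> 0\<close>, zeros cannot accumulate at \<open>x\<close>; so only the
  identically vanishing case is left.\<close>

lemma real_analytic_at_eventually_eq:
  assumes "real_analytic_at f x" "real_analytic_at g x" "\<exists>\<^sub>F y in at x. f y = g y"
  shows "\<forall>\<^sub>F y in nhds x. f y = g y"
proof -
  consider "\<forall>\<^sub>F y in nhds x. f y - g y = 0" | m u where "real_analytic_at u x" "u x \<noteq> 0"
      "\<forall>\<^sub>F y in nhds x. f y - g y = (y - x) ^ m * u y"
    by (rule real_analytic_at_order[OF real_analytic_at_diff[OF assms(1,2)]]) blast+
  then show ?thesis
  proof cases
    case 1
    then show ?thesis by simp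
  next
    case 2
    have "(u \<longlongrightarrow> u x) (at x)"
      using real_analytic_at_isCont[OF 2(1)] by (simp add: isCont_def)
    then have "\<forall>\<^sub>F y in at x. u y \<noteq> 0"
      using 2(2) by (rule tendsto_imp_eventually_ne)
    moreover have "\<forall>\<^sub>F y in at x. y \<noteq> x"
      by (simp add: eventually_at_filter)
    moreover have "\<forall>\<^sub>F y in at x. f y - g y = (y - x) ^ m * u y"
      using 2(3) by (simp add: eventually_at_filter eventually_mono)
    ultimately have "\<forall>\<^sub>F y in at x. f y \<noteq> g y"
      by eventually_elim auto
    then show ?thesis
      using assms(3) by (simp add: frequently_def)
  qed
qed

text \<open>The set \<open>Z\<close> of points where the germs agree is open and closed in
  \<open>S\<close>. Agreement is asked only frequently near \<open>x0\<close>, which is what a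
  pigeonhole argument over permutations delivers.\<close>

lemma real_analytic_identity:
  assumes S: "open S" "connected S"
    and fg: "\<And>x. x \<in> S \<Longrightarrow> real_analytic_at f x" "\<And>x. x \<in> S \<Longrightarrow> real_analytic_at g x"
    and x0: "x0 \<in> S" "\<exists>\<^sub>F y in at x0. f y = g y"
    and x: "x \<in> S"
  shows "f x = g x"
proof -
  define Z where "Z = {x\<in>S. \<forall>\<^sub>F y in nhds x. f y = g y}"
  have "open Z"
    unfolding open_subopen[of Z]
  proof
    fix z assume "z \<in> Z"
    then have z: "z \<in> S" "\<forall>\<^sub>F y in nhds z. f y = g y"
      by (auto simp: Z_def)
    then obtain T where T: "open T" "z \<in> T" "\<And>y. y \<in> T \<Longrightarrow> f y = g y"
      unfolding eventually_nhds by blast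
    have "T \<inter> S \<subseteq> Z"
    proof
      fix w assume w: "w \<in> T \<inter> S"
      then have "\<forall>\<^sub>F y in nhds w. y \<in> T"
        using T(1) by (intro eventually_nhds_in_open) auto
      then have "\<forall>\<^sub>F y in nhds w. f y = g y"
        by eventually_elim (rule T(3))
      then show "w \<in> Z" using w by (simp add: Z_def)
    qed
    then show "\<exists>T. open T \<and> z \<in> T \<and> T \<subseteq> Z"
      using T(1,2) S(1) z(1) by (intro exI[of _ "T \<inter> S"]) auto
  qed
  moreover have "open (S - Z)"
    unfolding open_subopen[of "S - Z"]
  proof
    fix z assume z: "z \<in> S - Z"
    then have "\<not> (\<exists>\<^sub>F y in at z. f y = g y)"
      using real_analytic_at_eventually_eq[of f z g] fg by (auto simp: Z_def)
    then have "\<forall>\<^sub>F y in nhds z. y \<noteq> z \<longrightarrow> f y \<noteq> g y"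
      by (simp add: frequently_def eventually_at_filter)
    then obtain T where T: "open T" "z \<in> T" "\<And>y. y \<in> T \<Longrightarrow> y \<noteq> z \<Longrightarrow> f y \<noteq> g y"
      unfolding eventually_nhds by blast
    have "w \<notin> Z" if "w \<in> T" for w
      using T(3)[OF that] eventually_nhds_x_imp_x[of "\<lambda>y. f y = g y" w] z
      by (cases "w = z") (auto simp: Z_def)
    then show "\<exists>T. open T \<and> z \<in> T \<and> T \<subseteq> S - Z"
      using T(1,2) S(1) z by (intro exI[of _ "T \<inter> S"]) auto
  qed
  moreover have "x0 \<in> Z"
    using real_analytic_at_eventually_eq[of f x0 g] fg x0 by (auto simp: Z_def)
  ultimately have "S - Z = {}"
    using connectedD[OF S(2), of Z "S - Z"] x0(1) by (auto simp: Z_def)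
  then show ?thesis
    using x eventually_nhds_x_imp_x[of "\<lambda>y. f y = g y" x] by (auto simp: Z_def)
qed

text \<open>The bound forces the order \<open>p\<close> of \<open>f\<close> to be at least
  \<open>m\<close>: for \<open>p < m\<close>, cancelling \<open>\<bar>y - x\<bar>^p\<close> would
  make the cofactor tend to 0 at \<open>x\<close>.\<close>

lemma real_analytic_at_divide_power:
  assumes f: "real_analytic_at f x" and le: "\<forall>\<^sub>F y in nhds x. \<bar>f y\<bar> \<le> C * \<bar>y - x\<bar> ^ m"
  shows "\<exists>g. real_analytic_at g x \<and> (\<forall>\<^sub>F y in nhds x. f y = (y - x) ^ m * g y)"
proof -
  consider "\<forall>\<^sub>F y in nhds x. f y = 0" | p u where "real_analytic_at u x" "u x \<noteq> 0"
      "\<forall>\<^sub>F y in nhds x. f y = (y - x) ^ p * u y"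
    by (rule real_analytic_at_order[OF f]) blast+
  then show ?thesis
  proof cases
    case 1
    then show ?thesis
      by (intro exI[of _ "\<lambda>_. 0"]) (simp add: real_analytic_at_const)
  next
    case 2
    have "m \<le> p"
    proof (rule ccontr)
      assume "\<not> m \<le> p"
      then have p: "p < m" by simp
      have *: "\<forall>\<^sub>F y in at x. \<bar>u y\<bar> \<le> C * \<bar>y - x\<bar> ^ (m - p)"
        unfolding eventually_at_filter using le 2(3)
      proof eventually_elim
        case (elim y)
        show ?case
        proof (intro impI)
          assume "y \<noteq> x"
          then have pos: "\<bar>y - x\<bar> ^ p > 0" by simp
          have m: "\<bar>y - x\<bar> ^ m = \<bar>y - x\<bar> ^ p * \<bar>y - x\<bar> ^ (m - p)"
            using p by (simp flip: power_add)
          have "\<bar>y - x\<bar> ^ p * \<bar>u y\<bar> = \<bar>f y\<bar>"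
            by (simp only: elim(2) abs_mult power_abs)
          also have "\<dots> \<le> C * \<bar>y - x\<bar> ^ m" by (rule elim(1))
          also have "\<dots> = \<bar>y - x\<bar> ^ p * (C * \<bar>y - x\<bar> ^ (m - p))"
            unfolding m by simp
          finally show "\<bar>u y\<bar> \<le> C * \<bar>y - x\<bar> ^ (m - p)"
            by (rule mult_left_le_imp_le) (rule pos)
        qed
      qed
      have "((\<lambda>y. C * \<bar>y - x\<bar> ^ (m - p)) \<longlongrightarrow> C * \<bar>x - x\<bar> ^ (m - p)) (at x)"
        by (intro tendsto_intros)
      moreover have "C * \<bar>x - x\<bar> ^ (m - p) = 0"
        using p by (simp add: zero_less_diff)
      ultimately have "((\<lambda>y. C * \<bar>y - x\<bar> ^ (m - p)) \<longlongrightarrow> 0) (at x)"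
        by (simp only:)
      moreover have "((\<lambda>y. \<bar>u y\<bar>) \<longlongrightarrow> \<bar>u x\<bar>) (at x)"
        using real_analytic_at_isCont[OF 2(1)] by (intro tendsto_intros) (simp add: isCont_def)
      ultimately have "\<bar>u x\<bar> \<le> 0"
        by (rule tendsto_le[OF at_neq_bot _ _ *])
      then show False using 2(2) by simp
    qed
    have "\<forall>\<^sub>F y in nhds x. f y = (y - x) ^ m * ((y - x) ^ (p - m) * u y)"
      using 2(3)
    proof eventually_elim
      case (elim y)
      have "(y - x) ^ p = (y - x) ^ m * (y - x) ^ (p - m)"
        using \<open>m \<le> p\<close> by (simp flip: power_add)
      then show ?case using elim by simp
    qed
    moreover have "real_analytic_at (\<lambda>y. (y - x) ^ (p - m) * u y) x"
      by (intro real_analytic_at_mult real_analytic_at_power real_analytic_at_diff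
          real_analytic_at_ident real_analytic_at_const 2(1))
    ultimately show ?thesis by blast
  qed
qed

section \<open>Power sums of root clusters\<close>

definition psum :: "nat \<Rightarrow> real multiset \<Rightarrow> real" where
  "psum k M = (\<Sum>x\<in>#M. x ^ k)"

lemma psum_empty [simp]: "psum k {#} = 0"
  and psum_add_mset [simp]: "psum k (add_mset x M) = x ^ k + psum k M"
  and psum_union [simp]: "psum k (M + M') = psum k M + psum k M'"
  by (simp_all add: psum_def)

text \<open>The reversed characteristic polynomial: its coefficients are the elementary symmetric
  functions up to sign. As a formal power series it can be multiplied by the generating function of
  the power sums.\<close>

definition newton_fps :: "real multiset \<Rightarrow> real fps" where
  "newton_fps M = (\<Prod>x\<in>#M. 1 - fps_const x * fps_X)"

lemma newton_fps_empty [simp]: "newton_fps {#} = 1"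
  and newton_fps_add_mset [simp]:
    "newton_fps (add_mset x M) = (1 - fps_const x * fps_X) * newton_fps M"
  by (simp_all add: newton_fps_def)

text \<open>This is the logarithmic derivative: a root \<open>x\<close> contributes
  \<open>-x / (1 - x X)\<close>, a geometric series whose coefficients are the powers of
  \<open>x\<close>. In the proof, \<open>Q\<close> is that series without the sign.\<close>

lemma fps_deriv_newton_fps:
  "fps_deriv (newton_fps M) = - newton_fps M * Abs_fps (\<lambda>n. psum (Suc n) M)"
proof (induction M)
  case empty
  then show ?case by (simp add: fps_eq_iff)
next
  case (add x M)
  define Q P E where "Q = Abs_fps (\<lambda>n. x ^ Suc n)" and "P = Abs_fps (\<lambda>n. psum (Suc n) M)"
    and "E = newton_fps M"
  have Q: "(1 - fps_const x * fps_X) * Q = fps_const x"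
    unfolding Q_def
    by (rule fps_ext) (simp add: left_diff_distrib mult.assoc flip: power_Suc split: nat.split)
  have "Abs_fps (\<lambda>n. psum (Suc n) (add_mset x M)) = Q + P"
    by (simp add: fps_eq_iff Q_def P_def)
  moreover have "fps_deriv ((1 - fps_const x * fps_X) * E)
      = - fps_const x * E + (1 - fps_const x * fps_X) * (- E * P)"
    using add by (simp add: E_def P_def)
  moreover have "\<dots> = - ((1 - fps_const x * fps_X) * E) * (Q + P)"
    by (subst Q[symmetric]) (simp add: algebra_simps)
  ultimately show ?case
    by (simp add: E_def)
qed

lemma newton_fps_nth_0 [simp]: "newton_fps M $ 0 = 1"
  by (induction M) simp_all

text \<open>Comparison of coefficients in the logarithmic derivative. Since
  \<open>real (Suc n)\<close> is invertible, each coefficient is a polynomial in the earlier ones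
  and the power sums.\<close>

lemma newton_identity:
  "real (Suc n) * newton_fps M $ Suc n = - (\<Sum>i\<le>n. newton_fps M $ i * psum (Suc (n - i)) M)"
proof -
  have "fps_deriv (newton_fps M) $ n = (- newton_fps M * Abs_fps (\<lambda>n. psum (Suc n) M)) $ n"
    by (simp only: fps_deriv_newton_fps)
  then show ?thesis
    by (simp add: fps_mult_nth atLeast0AtMost sum_negf)
qed

lemma real_analytic_newton_fps:
  assumes "\<And>k. real_analytic_at (\<lambda>h. psum k (M h)) x"
  shows "real_analytic_at (\<lambda>h. newton_fps (M h) $ n) x"
proof (induction n rule: less_induct)
  case (less n)
  show ?case
  proof (cases n)
    case 0
    then show ?thesis by (simp add: real_analytic_at_const)
  next
    case (Suc m)
    have "real_analytic_at (\<lambda>h. (- 1 / real (Suc m)) *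
        (\<Sum>i\<le>m. newton_fps (M h) $ i * psum (Suc (m - i)) (M h))) x"
      by (intro real_analytic_at_mult real_analytic_at_const real_analytic_at_sum assms less) (simp add: Suc)
    moreover have "(- 1 / real (Suc m)) * (\<Sum>i\<le>m. newton_fps (M h) $ i * psum (Suc (m - i)) (M h))
        = newton_fps (M h) $ n" for h
      using newton_identity[of m "M h"] by (simp add: field_simps Suc)
    ultimately show ?thesis by simp
  qed
qed

lemma newton_fps_nth_eq_0: "size M < j \<Longrightarrow> newton_fps M $ j = 0"
proof (induction M arbitrary: j)
  case (add x M)
  then show ?case
    by (cases j) (simp_all add: left_diff_distrib mult.assoc)
qed simp

lemma prod_root_eq_newton_sum:
  fixes z :: complex
  shows "(\<Prod>x\<in>#M. z - of_real x)
    = (\<Sum>j\<le>size M. of_real (newton_fps M $ j) * z ^ (size M - j))"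
proof (induction M)
  case (add x M)
  define e n where "e j = complex_of_real (newton_fps M $ j)" and "n = size M" for j
  have e': "complex_of_real (newton_fps (add_mset x M) $ Suc j) = e (Suc j) - of_real x * e j" for j
    by (simp add: e_def left_diff_distrib mult.assoc)
  have "(\<Sum>j\<le>Suc n. of_real (newton_fps (add_mset x M) $ j) * z ^ (Suc n - j))
      = z ^ Suc n + (\<Sum>j\<le>n. (e (Suc j) - of_real x * e j) * z ^ (n - j))"
    unfolding sum.atMost_Suc_shift by (simp only: e') simp
  also have "\<dots> = (z ^ Suc n + (\<Sum>j\<le>n. e (Suc j) * z ^ (n - j))) - of_real x * (\<Sum>j\<le>n. e j * z ^ (n - j))"
    by (simp add: algebra_simps sum_subtractf sum_distrib_left)
  also have "z ^ Suc n + (\<Sum>j\<le>n. e (Suc j) * z ^ (n - j)) = (\<Sum>j\<le>Suc n. e j * z ^ (Suc n - j))"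
    unfolding sum.atMost_Suc_shift by (simp add: e_def)
  also have "\<dots> = z * (\<Sum>j\<le>n. e j * z ^ (n - j))"
    using newton_fps_nth_eq_0[of M "Suc n"]
    by (simp add: e_def n_def sum_distrib_left Suc_diff_le mult.left_commute)
  finally show ?case
    using add by (simp add: e_def n_def algebra_simps)
qed simp

text \<open>The identity \<open>P' = P * (P'/P)\<close>, with the partial fractions of
  \<open>P'/P\<close> to which the residue computation applies.\<close>

lemma deriv_prod_roots:
  fixes z :: complex
  assumes "\<And>x. x \<in># M \<Longrightarrow> z \<noteq> of_real x"
  shows "((\<lambda>z. \<Prod>x\<in>#M. z - of_real x) has_field_derivative
           (\<Prod>x\<in>#M. z - of_real x) * (\<Sum>x\<in>#M. 1 / (z - of_real x))) (at z)"
  using assms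
proof (induction M)
  case (add x M)
  have "((\<lambda>z. (z - of_real x) * (\<Prod>x\<in>#M. z - of_real x)) has_field_derivative
      1 * (\<Prod>x\<in>#M. z - of_real x) +
      ((\<Prod>x\<in>#M. z - of_real x) * (\<Sum>x\<in>#M. 1 / (z - of_real x))) * (z - of_real x)) (at z)"
    by (intro DERIV_mult add.IH) (auto intro!: derivative_eq_intros simp: add.prems)
  moreover have "1 * p + (p * s) * (z - of_real x) = ((z - of_real x) * p) * (1 / (z - of_real x) + s)"
    for p s :: complex
    using add.prems[of x] by (simp add: field_simps)
  ultimately show ?case by simp
qed simp

text \<open>Cauchy's formula for each enclosed root. For a root outside, the integrand is
  holomorphic on the ball around \<open>c\<close> that reaches up to the root, and this ball
  contains the circle.\<close>

lemma contour_integral_power_roots: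
  assumes "\<And>x. x \<in># M \<Longrightarrow> cmod (of_real x - c) \<noteq> \<rho>" "\<rho> > 0"
  shows "((\<lambda>z. z ^ k * (\<Sum>x\<in>#M. 1 / (z - of_real x))) has_contour_integral
     2 * of_real pi * \<i> * of_real (psum k (filter_mset (\<lambda>x. cmod (of_real x - c) < \<rho>) M)))
     (circlepath c \<rho>)"
  using assms(1)
proof (induction M)
  case empty
  show ?case using has_contour_integral_is_0[of "circlepath c \<rho>" "\<lambda>_. 0"] by simp
next
  case (add x M)
  let ?\<gamma> = "circlepath c \<rho>"
  have "((\<lambda>z. z ^ k / (z - of_real x)) has_contour_integral
      (if cmod (of_real x - c) < \<rho> then 2 * of_real pi * \<i> * of_real x ^ k else 0)) ?\<gamma>"
  proof (cases "cmod (of_real x - c) < \<rho>")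
    case True
    have "((\<lambda>z. z ^ k / (z - of_real x)) has_contour_integral 2 * of_real pi * \<i> * of_real x ^ k) ?\<gamma>"
      by (rule Cauchy_integral_circlepath) (auto intro!: continuous_intros holomorphic_intros True)
    then show ?thesis using True by simp
  next
    case False
    define d where "d = cmod (of_real x - c)"
    have d: "d > \<rho>" using False add.prems[of x] by (simp add: d_def)
    have "(\<lambda>z. z ^ k / (z - of_real x)) holomorphic_on ball c d"
      by (auto intro!: holomorphic_intros simp: d_def dist_norm norm_minus_commute)
    then have "((\<lambda>z. z ^ k / (z - of_real x)) has_contour_integral 0) ?\<gamma>"
      by (rule Cauchy_theorem_disc_simple) (use d assms(2) in \<open>auto simp: dist_norm norm_minus_commute\<close>)
    then show ?thesis using False by simp
  qed
  from has_contour_integral_add[OF this add.IH] add.prems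
  show ?case by (auto simp: algebra_simps)
qed

text \<open>Differentiation under the integral sign. Numerator and denominator are linear in the
  same coefficients \<open>G j\<close>, as are a polynomial and its derivative when only the
  coefficients depend on the parameter.\<close>

lemma analytic_contour_integral_quotient:
  fixes G :: "'i \<Rightarrow> complex \<Rightarrow> complex" and a b :: "'i \<Rightarrow> complex \<Rightarrow> complex"
  assumes J: "finite J" and G: "\<And>j. j \<in> J \<Longrightarrow> G j analytic_on {w0}"
    and a: "\<And>j. j \<in> J \<Longrightarrow> continuous_on UNIV (a j)"
    and b: "\<And>j. j \<in> J \<Longrightarrow> continuous_on UNIV (b j)"
    and \<rho>: "\<rho> > 0" and nz: "\<And>z. z \<in> sphere c \<rho> \<Longrightarrow> (\<Sum>j\<in>J. G j w0 * a j z) \<noteq> 0"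
  shows "\<forall>\<^sub>F w in nhds w0. \<forall>z\<in>sphere c \<rho>. (\<Sum>j\<in>J. G j w * a j z) \<noteq> 0"
    and "(\<lambda>w. contour_integral (circlepath c \<rho>)
            (\<lambda>z. (\<Sum>j\<in>J. G j w * b j z) / (\<Sum>j\<in>J. G j w * a j z))) analytic_on {w0}"
proof -
  define P where "P w z = (\<Sum>j\<in>J. G j w * a j z)" for w z
  define N where "N w z = (\<Sum>j\<in>J. G j w * b j z)" for w z
  let ?S = "sphere c \<rho>"
  have "continuous_on ?S (P w0)"
    unfolding P_def by (intro continuous_intros continuous_on_subset[OF a]) auto
  then have "compact (P w0 ` ?S)" by (rule compact_continuous_image) simp
  moreover have "0 \<notin> P w0 ` ?S" using nz by (auto simp: P_def)
  ultimately obtain m where m: "m > 0" "\<And>z. z \<in> ?S \<Longrightarrow> m \<le> cmod (P w0 z)"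
    using separate_point_closed[OF compact_imp_closed, of "P w0 ` ?S" 0] by (auto simp: dist_norm)
  have "\<exists>B. \<forall>z\<in>?S. cmod (a j z) \<le> B" if "j \<in> J" for j
  proof -
    have "bounded (a j ` ?S)"
      by (intro compact_imp_bounded compact_continuous_image continuous_on_subset[OF a[OF that]]) auto
    then show ?thesis by (auto simp: bounded_iff)
  qed
  then obtain B where B: "\<And>j z. j \<in> J \<Longrightarrow> z \<in> ?S \<Longrightarrow> cmod (a j z) \<le> B j" by metis
  \<comment> \<open>This sum bounds the change of the denominator on the whole circle. It tends to
    0, hence falls below the minimum modulus \<open>m\<close> at \<open>w0\<close>.\<close>
  have "((\<lambda>w. \<Sum>j\<in>J. cmod (G j w - G j w0) * B j) \<longlongrightarrow> (\<Sum>j\<in>J. cmod (G j w0 - G j w0) * B j)) (nhds w0)"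
    by (intro tendsto_intros) (use G in \<open>simp add: tendsto_nhds_iff analytic_at_imp_isCont flip: isCont_def\<close>)
  then have "\<forall>\<^sub>F w in nhds w0. (\<Sum>j\<in>J. cmod (G j w - G j w0) * B j) < m"
    using m(1) by (intro order_tendstoD) auto
  then have ev: "\<forall>\<^sub>F w in nhds w0. \<forall>z\<in>?S. P w z \<noteq> 0"
  proof eventually_elim
    case (elim w)
    show ?case
    proof
      fix z assume z: "z \<in> ?S"
      have "cmod (P w z - P w0 z) = cmod (\<Sum>j\<in>J. (G j w - G j w0) * a j z)"
        by (simp add: P_def sum_subtractf algebra_simps)
      also have "\<dots> \<le> (\<Sum>j\<in>J. cmod (G j w - G j w0) * B j)"
        by (rule sum_norm_le) (use B z in \<open>auto simp: norm_mult intro: mult_left_mono\<close>)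
      also have "\<dots> < m" by (rule elim)
      finally show "P w z \<noteq> 0" using m(2)[OF z] by auto
    qed
  qed
  then show "\<forall>\<^sub>F w in nhds w0. \<forall>z\<in>?S. (\<Sum>j\<in>J. G j w * a j z) \<noteq> 0"
    by (simp add: P_def)
  have "\<forall>j\<in>J. \<exists>e>0. G j holomorphic_on ball w0 e"
    using G unfolding analytic_on_def by blast
  then obtain e where e: "\<And>j. j \<in> J \<Longrightarrow> e j > 0 \<and> G j holomorphic_on ball w0 (e j)" by metis
  obtain d where d: "d > 0" "\<And>w. w \<in> ball w0 d \<Longrightarrow> \<forall>z\<in>?S. P w z \<noteq> 0"
    using ev unfolding eventually_nhds_metric by (auto simp: dist_commute)
  define r where "r = Min (insert d (e ` J))"
  have r: "r > 0" "r \<le> d" "\<And>j. j \<in> J \<Longrightarrow> r \<le> e j"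
    using J e d(1) by (auto simp: r_def)
  let ?U = "ball w0 r"
  have hol: "G j holomorphic_on ?U" if "j \<in> J" for j
    by (rule holomorphic_on_subset[of _ "ball w0 (e j)"]) (use e that r in \<open>auto simp: subset_ball\<close>)
  have dhol: "deriv (G j) holomorphic_on ?U" if "j \<in> J" for j
    using hol[OF that] by (intro holomorphic_deriv) auto
  have nz: "P w z \<noteq> 0" if "w \<in> ?U" "z \<in> ?S" for w z
    using d(2) that r(2) by auto
  \<comment> \<open>\<open>D\<close> is the velocity of the parametrization, which turns the contour
    integral into one over \<open>[0,1]\<close>.\<close>
  define \<gamma> D where "\<gamma> = circlepath c \<rho>" and "D t = 2 * pi * \<i> * \<rho> * exp (2 * of_real pi * \<i> * of_real t)" for t :: real
  have \<gamma>S: "\<gamma> t \<in> ?S" for t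
    using \<rho> by (simp add: \<gamma>_def circlepath dist_norm norm_mult)
  have \<gamma>c: "continuous_on UNIV \<gamma>"
    unfolding \<gamma>_def circlepath by (intro continuous_intros)
  have Dc: "continuous_on UNIV D"
    unfolding D_def by (intro continuous_intros)
  define P' where "P' w z = (\<Sum>j\<in>J. deriv (G j) w * a j z)" for w z
  define N' where "N' w z = (\<Sum>j\<in>J. deriv (G j) w * b j z)" for w z
  have dG: "(G j has_field_derivative deriv (G j) w) (at w within ?U)" if "j \<in> J" "w \<in> ?U" for j w
    using holomorphic_derivI[OF hol[OF that(1)] open_ball that(2)] by (rule has_field_derivative_at_within)
  have Gc: "continuous_on (?U \<times> cbox 0 1) (\<lambda>p. G j (fst p))"
    and dGc: "continuous_on (?U \<times> cbox 0 1) (\<lambda>p. deriv (G j) (fst p))"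
    if "j \<in> J" for j
    by (rule continuous_on_compose2[OF holomorphic_on_imp_continuous_on[OF hol[OF that]]]
        continuous_on_compose2[OF holomorphic_on_imp_continuous_on[OF dhol[OF that]]];
      (force intro: continuous_intros))+
  have ac: "continuous_on (?U \<times> cbox 0 1) (\<lambda>p. a j (\<gamma> (snd p)))"
    and bc: "continuous_on (?U \<times> cbox 0 1) (\<lambda>p. b j (\<gamma> (snd p)))" if "j \<in> J" for j
    by (rule continuous_on_compose2[OF a[OF that]] continuous_on_compose2[OF b[OF that]],
      rule continuous_on_compose2[OF \<gamma>c]; (force intro: continuous_intros))+
  have Dc': "continuous_on (?U \<times> cbox 0 1) (\<lambda>p. D (snd p))"
    by (rule continuous_on_compose2[OF Dc]) (auto intro: continuous_intros)
  have "(\<lambda>w. integral (cbox 0 1) (\<lambda>t. N w (\<gamma> t) / P w (\<gamma> t) * D t)) holomorphic_on ?U"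
  proof (rule leibniz_rule_holomorphic)
    fix w t assume w: "w \<in> ?U"
    show "((\<lambda>w. N w (\<gamma> t) / P w (\<gamma> t) * D t) has_field_derivative
        (N' w (\<gamma> t) * P w (\<gamma> t) - N w (\<gamma> t) * P' w (\<gamma> t)) / (P w (\<gamma> t) * P w (\<gamma> t)) * D t) (at w within ?U)"
      unfolding N_def P_def N'_def P'_def
      by (intro DERIV_cmult_right DERIV_divide DERIV_sum dG w)
        (use nz[OF w \<gamma>S] in \<open>auto simp: P_def\<close>)
  next
    fix w assume w: "w \<in> ?U"
    have "continuous_on (cbox 0 1) (\<lambda>t. N w (\<gamma> t) / P w (\<gamma> t) * D t)"
      unfolding N_def P_def
      by (intro continuous_intros continuous_on_compose2[OF a] continuous_on_compose2[OF b]
            continuous_on_subset[OF \<gamma>c] continuous_on_subset[OF Dc])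
        (use nz[OF w \<gamma>S] in \<open>auto simp: P_def\<close>)
    then show "(\<lambda>t. N w (\<gamma> t) / P w (\<gamma> t) * D t) integrable_on cbox 0 1"
      by (rule integrable_continuous)
  next
    show "continuous_on (?U \<times> cbox 0 1) (\<lambda>(w, t).
        (N' w (\<gamma> t) * P w (\<gamma> t) - N w (\<gamma> t) * P' w (\<gamma> t)) / (P w (\<gamma> t) * P w (\<gamma> t)) * D t)"
      unfolding case_prod_beta N_def P_def N'_def P'_def
      by (intro continuous_intros Gc dGc ac bc Dc')
        (use nz \<gamma>S in \<open>auto simp: P_def\<close>)
  qed (rule convex_ball)
  moreover have "contour_integral \<gamma> (\<lambda>z. N w z / P w z)
      = integral (cbox 0 1) (\<lambda>t. N w (\<gamma> t) / P w (\<gamma> t) * D t)" for w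
    by (simp add: contour_integral_integral \<gamma>_def vector_derivative_circlepath D_def)
  ultimately have "(\<lambda>w. contour_integral \<gamma> (\<lambda>z. N w z / P w z)) holomorphic_on ?U"
    by simp
  then show "(\<lambda>w. contour_integral (circlepath c \<rho>)
            (\<lambda>z. (\<Sum>j\<in>J. G j w * b j z) / (\<Sum>j\<in>J. G j w * a j z))) analytic_on {w0}"
    unfolding N_def P_def \<gamma>_def using r(1) by (auto simp: analytic_on_def)
qed

section \<open>Analytic eigenbranches near a point\<close>

lemma eventually_of_real_nhds:
  assumes "\<forall>\<^sub>F w in nhds (complex_of_real x). P w"
  shows "\<forall>\<^sub>F h in nhds x. P (complex_of_real h)"
proof -
  have "filterlim complex_of_real (nhds (of_real x)) (nhds x)"
    by (intro tendsto_of_real filterlim_ident)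
  then show ?thesis using assms by (simp add: filterlim_iff)
qed

text \<open>The cluster power sum is the integral of \<open>z^k P'(z)/P(z)\<close> over the circle
  divided by \<open>2 pi i\<close>, where the coefficients of \<open>P\<close> are analytic in
  \<open>h\<close>.\<close>

lemma real_analytic_psum_cluster:
  assumes M: "\<And>k. real_analytic_at (\<lambda>h. psum k (M h)) x0"
    and size: "\<forall>\<^sub>F h in nhds x0. size (M h) = n"
    and \<rho>: "\<rho> > 0" "\<And>x. x \<in># M x0 \<Longrightarrow> \<bar>x - c\<bar> \<noteq> \<rho>"
  shows "real_analytic_at (\<lambda>h. psum k (filter_mset (\<lambda>x. \<bar>x - c\<bar> < \<rho>) (M h))) x0"
proof -
  let ?c = "complex_of_real c" and ?w0 = "complex_of_real x0"
  have "\<exists>F. F analytic_on {?w0} \<and>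
      (\<forall>\<^sub>F h in nhds x0. F (of_real h) = complex_of_real (newton_fps (M h) $ j))" for j
    using real_analytic_newton_fps[OF M, of j] unfolding real_analytic_at_def .
  then obtain G where G: "\<And>j. G j analytic_on {?w0}"
      "\<And>j. \<forall>\<^sub>F h in nhds x0. G j (of_real h) = complex_of_real (newton_fps (M h) $ j)"
    by metis
  have ev: "\<forall>\<^sub>F h in nhds x0. size (M h) = n \<and>
      (\<forall>j\<in>{..n}. G j (of_real h) = complex_of_real (newton_fps (M h) $ j))"
    using size G(2) by (simp add: eventually_conj_iff eventually_ball_finite)
  define P where "P w z = (\<Sum>j\<le>n. G j w * z ^ (n - j))" for w z
  \<comment> \<open>\<open>z^k\<close> times the derivative of \<open>P w\<close> in
    \<open>z\<close>. For \<open>j = n\<close> the truncated exponent \<open>n - j - 1\<close> is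
    harmless, since the factor \<open>of_nat (n - j)\<close> is 0.\<close>
  define N where "N w z = (\<Sum>j\<le>n. G j w * (z ^ k * (of_nat (n - j) * z ^ (n - j - 1))))" for w z
  have P: "P (of_real h) z = (\<Prod>x\<in>#M h. z - of_real x)"
    if "size (M h) = n \<and> (\<forall>j\<in>{..n}. G j (of_real h) = complex_of_real (newton_fps (M h) $ j))" for h z
    using that unfolding P_def prod_root_eq_newton_sum by simp
  have nz0: "P ?w0 z \<noteq> 0" if "z \<in> sphere ?c \<rho>" for z
  proof -
    have "z \<noteq> of_real x" if "x \<in># M x0" for x
      using \<rho>(2)[OF that] \<open>z \<in> sphere ?c \<rho>\<close>
      by (auto simp: dist_norm norm_minus_commute simp flip: of_real_diff)
    then show ?thesis
      using P[OF eventually_nhds_x_imp_x[OF ev]] by (auto simp: prod_mset_zero_iff)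
  qed
  have cont: "continuous_on UNIV (\<lambda>z::complex. z ^ (n - j))"
    "continuous_on UNIV (\<lambda>z::complex. z ^ k * (of_nat (n - j) * z ^ (n - j - 1)))" for j
    by (intro continuous_intros)+
  define I where "I w = contour_integral (circlepath ?c \<rho>) (\<lambda>z. N w z / P w z)" for w
  note quot = analytic_contour_integral_quotient[where J = "{..n}" and G = G and c = ?c,
      OF finite_atMost G(1) cont \<rho>(1) nz0[unfolded P_def]]
  have nz: "\<forall>\<^sub>F w in nhds ?w0. \<forall>z\<in>sphere ?c \<rho>. P w z \<noteq> 0"
    unfolding P_def by (rule quot(1))
  have I: "I analytic_on {?w0}"
    unfolding I_def N_def P_def by (rule quot(2))
  have "(\<lambda>w. I w / (2 * of_real pi * \<i>)) analytic_on {?w0}"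
    by (intro analytic_on_divide I analytic_on_const) simp
  moreover have "\<forall>\<^sub>F h in nhds x0. I (of_real h) / (2 * of_real pi * \<i>)
      = of_real (psum k (filter_mset (\<lambda>x. \<bar>x - c\<bar> < \<rho>) (M h)))"
    using ev eventually_of_real_nhds[OF nz]
  proof eventually_elim
    case (elim h)
    let ?M = "M h"
    \<comment> \<open>The hypothesis keeps only the elements of \<open>M x0\<close> off the circle;
      for nearby \<open>h\<close> this follows from \<open>P\<close> having no zero there.\<close>
    have ne: "z \<noteq> of_real x" if "z \<in> sphere ?c \<rho>" "x \<in># ?M" for z x
    proof
      assume "z = of_real x"
      then have "(\<Prod>x\<in>#?M. z - of_real x) = 0"
        using that(2) by (force simp: prod_mset_zero_iff)
      then have "P (of_real h) z = 0" by (simp only: P[OF elim(1)])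
      then show False using elim(2) that(1) by blast
    qed
    have "cmod (of_real x - ?c) \<noteq> \<rho>" if "x \<in># ?M" for x
      using ne[of "of_real x" x] that by (auto simp: dist_norm norm_minus_commute)
    then have hci: "((\<lambda>z. z ^ k * (\<Sum>x\<in>#?M. 1 / (z - of_real x))) has_contour_integral
       2 * of_real pi * \<i> * of_real (psum k (filter_mset (\<lambda>x. cmod (of_real x - ?c) < \<rho>) ?M)))
       (circlepath ?c \<rho>)"
      by (rule contour_integral_power_roots) (use \<rho>(1) in auto)
    have "z ^ k * (\<Sum>x\<in>#?M. 1 / (z - of_real x)) = N (of_real h) z / P (of_real h) z"
      if z: "z \<in> sphere ?c \<rho>" for z
    proof -
      define Q where "Q = (\<Prod>x\<in>#?M. z - of_real x)"
      have Q0: "Q \<noteq> 0" using elim(2) z P[OF elim(1)] by (simp add: Q_def)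
      have "((\<lambda>z. \<Prod>x\<in>#?M. z - of_real x) has_field_derivative Q * (\<Sum>x\<in>#?M. 1 / (z - of_real x))) (at z)"
        unfolding Q_def by (rule deriv_prod_roots) (use ne z in auto)
      moreover have "((\<lambda>z. P (of_real h) z) has_field_derivative
          (\<Sum>j\<le>n. G j (of_real h) * (of_nat (n - j) * z ^ (n - j - 1)))) (at z)"
        unfolding P_def by (auto intro!: derivative_eq_intros sum.cong)
      ultimately have "Q * (\<Sum>x\<in>#?M. 1 / (z - of_real x))
          = (\<Sum>j\<le>n. G j (of_real h) * (of_nat (n - j) * z ^ (n - j - 1)))"
        unfolding P[OF elim(1)] by (rule DERIV_unique)
      then have "N (of_real h) z = z ^ k * (Q * (\<Sum>x\<in>#?M. 1 / (z - of_real x)))"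
        unfolding N_def by (simp add: sum_distrib_left algebra_simps)
      then show ?thesis
        using Q0 P[OF elim(1), of z] by (simp add: Q_def)
    qed
    then have "((\<lambda>z. N (of_real h) z / P (of_real h) z) has_contour_integral
       2 * of_real pi * \<i> * of_real (psum k (filter_mset (\<lambda>x. cmod (of_real x - ?c) < \<rho>) ?M)))
       (circlepath ?c \<rho>)"
      by (intro has_contour_integral_eq[OF hci]) (use \<rho>(1) in auto)
    then have "I (of_real h) = 2 * of_real pi * \<i> *
        of_real (psum k (filter_mset (\<lambda>x. cmod (of_real x - ?c) < \<rho>) ?M))"
      unfolding I_def by (rule contour_integral_unique)
    moreover have "cmod (of_real x - ?c) = \<bar>x - c\<bar>" for x
      by (simp flip: of_real_diff)
    ultimately show ?case by simp
  qed
  ultimately show ?thesis by (rule real_analytic_atI)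
qed

text \<open>A list, so that coinciding branches keep their multiplicity.\<close>

definition has_branches :: "(real \<Rightarrow> real multiset) \<Rightarrow> real \<Rightarrow> bool" where
  "has_branches M x0 \<longleftrightarrow> (\<exists>fs. (\<forall>f\<in>set fs. real_analytic_at f x0) \<and>
     (\<forall>\<^sub>F h in nhds x0. M h = mset (map (\<lambda>f. f h) fs)))"

text \<open>Reverses the normalizations, namely subtraction of the mean and division by a power of
  \<open>h - x0\<close>. The factor \<open>s\<close> may therefore vanish at
  \<open>x0\<close>.\<close>

lemma has_branches_affine:
  assumes "has_branches M x0" "real_analytic_at s x0" "real_analytic_at b x0"
    and "\<forall>\<^sub>F h in nhds x0. M' h = image_mset (\<lambda>x. s h * x + b h) (M h)"
  shows "has_branches M' x0"
proof -
  obtain fs where fs: "\<forall>f\<in>set fs. real_analytic_at f x0"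
    "\<forall>\<^sub>F h in nhds x0. M h = mset (map (\<lambda>f. f h) fs)"
    using assms(1) unfolding has_branches_def by blast
  have "\<forall>\<^sub>F h in nhds x0. M' h = mset (map (\<lambda>f. f h) (map (\<lambda>f h. s h * f h + b h) fs))"
    using fs(2) assms(4) by eventually_elim (simp add: multiset.map_comp o_def)
  moreover have "\<forall>f\<in>set (map (\<lambda>f h. s h * f h + b h) fs). real_analytic_at f x0"
    using fs(1) by (auto intro!: real_analytic_at_add real_analytic_at_mult assms)
  ultimately show ?thesis
    unfolding has_branches_def by blast
qed

lemma has_branches_union:
  assumes "has_branches M x0" "has_branches M' x0"
  shows "has_branches (\<lambda>h. M h + M' h) x0"
proof -
  obtain fs fs' where fs: "\<forall>f\<in>set fs. real_analytic_at f x0"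
    "\<forall>\<^sub>F h in nhds x0. M h = mset (map (\<lambda>f. f h) fs)" "\<forall>f\<in>set fs'. real_analytic_at f x0"
    "\<forall>\<^sub>F h in nhds x0. M' h = mset (map (\<lambda>f. f h) fs')"
    using assms unfolding has_branches_def by blast
  have "\<forall>\<^sub>F h in nhds x0. M h + M' h = mset (map (\<lambda>f. f h) (fs @ fs'))"
    using fs(2,4) by eventually_elim simp
  then show ?thesis
    unfolding has_branches_def using fs(1,3) by (intro exI[of _ "fs @ fs'"]) auto
qed

text \<open>Bolzano-Weierstrass for unordered \<open>n\<close>-tuples, applied to one element at a
  time along nested subsequences. It provides the value of the rescaled family at the point where
  the division is undefined.\<close>

lemma bounded_multisets_psum_limit:
  fixes X :: "nat \<Rightarrow> real multiset"
  assumes "\<And>j. size (X j) = n" "\<And>j x. x \<in># X j \<Longrightarrow> \<bar>x\<bar> \<le> C"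
  shows "\<exists>L \<sigma>. strict_mono (\<sigma> :: nat \<Rightarrow> nat) \<and> size L = n \<and>
    (\<forall>k. (\<lambda>j. psum k (X (\<sigma> j))) \<longlonglongrightarrow> psum k L)"
  using assms
proof (induction n arbitrary: X)
  case 0
  then show ?case by (intro exI[of _ "{#}"] exI[of _ id]) (auto simp: strict_mono_def)
next
  case (Suc n)
  have "\<exists>x Y. X j = add_mset x Y" for j
    using Suc.prems(1)[of j] by (metis size_Suc_Diff1 size_eq_Suc_imp_eq_union)
  then obtain x Y where XY: "\<And>j. X j = add_mset (x j) (Y j)" by metis
  have "\<exists>L \<sigma>. strict_mono (\<sigma> :: nat \<Rightarrow> nat) \<and> size L = n \<and>
      (\<forall>k. (\<lambda>j. psum k (Y (\<sigma> j))) \<longlonglongrightarrow> psum k L)"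
    by (rule Suc.IH) (use Suc.prems XY in auto)
  then obtain L \<sigma> where L: "strict_mono (\<sigma> :: nat \<Rightarrow> nat)" "size L = n"
    "\<And>k. (\<lambda>j. psum k (Y (\<sigma> j))) \<longlonglongrightarrow> psum k L" by blast
  have "\<forall>j. (x \<circ> \<sigma>) j \<in> {-C..C}"
    using Suc.prems(2) by (auto simp: XY abs_le_iff) (metis XY minus_le_iff union_single_eq_member)+
  then obtain l \<tau> where \<tau>: "strict_mono (\<tau> :: nat \<Rightarrow> nat)" "((x \<circ> \<sigma>) \<circ> \<tau>) \<longlonglongrightarrow> l"
    using compact_Icc[of "-C" C] unfolding compact_def by meson
  have "(\<lambda>j. psum k (X (\<sigma> (\<tau> j)))) \<longlonglongrightarrow> psum k (add_mset l L)" for k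
  proof -
    have "(\<lambda>j. psum k (Y (\<sigma> (\<tau> j)))) \<longlonglongrightarrow> psum k L"
      using LIMSEQ_subseq_LIMSEQ[OF L(3) \<tau>(1)] by (simp add: o_def)
    moreover have "(\<lambda>j. x (\<sigma> (\<tau> j)) ^ k) \<longlonglongrightarrow> l ^ k"
      using \<tau>(2) by (intro tendsto_power) (simp add: o_def)
    ultimately show ?thesis by (simp add: XY tendsto_add)
  qed
  moreover have "strict_mono (\<lambda>j. \<sigma> (\<tau> j))"
    using L(1) \<tau>(1) by (simp add: strict_mono_def)
  ultimately show ?case
    using L(2) by (intro exI[of _ "add_mset l L"] exI[of _ "\<lambda>j. \<sigma> (\<tau> j)"]) auto
qed

section \<open>Power sums under affine maps, and the bounds they give on elements\<close>

lemma psum_0 [simp]: "psum 0 M = size M"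
  by (induction M) auto

lemma psum_image_mult: "psum k (image_mset (\<lambda>x. c * x) M) = c ^ k * psum k M"
  by (induction M) (auto simp: algebra_simps power_mult_distrib)

lemma psum_image_shift:
  "psum k (image_mset (\<lambda>x. x + b) M) = (\<Sum>j\<le>k. of_nat (k choose j) * b ^ (k - j) * psum j M)"
proof (induction M)
  case (add x M)
  have "(x + b) ^ k = (\<Sum>j\<le>k. of_nat (k choose j) * b ^ (k - j) * x ^ j)"
    by (simp add: binomial_ring mult_ac)
  then show ?case
    using add by (simp add: sum.distrib distrib_left)
qed simp

lemma psum_even_nonneg: "psum (2 * k) M \<ge> 0"
  by (induction M) (auto simp: power_mult)

lemma psum_2_eq_0_iff: "psum 2 M = 0 \<longleftrightarrow> (\<forall>x\<in>#M. x = 0)"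
proof (induction M)
  case (add x M)
  then show ?case
    using psum_even_nonneg[of 1 M] by (auto simp: add_nonneg_eq_0_iff)
qed simp

lemma member_square_le_psum_2: "x \<in># M \<Longrightarrow> x\<^sup>2 \<le> psum 2 M"
proof (induction M)
  case (add y M)
  then show ?case
    using psum_even_nonneg[of 1 M] by (auto intro: add_increasing)
qed simp

lemma abs_psum_le:
  fixes C :: real
  assumes "\<And>x. x \<in># M \<Longrightarrow> \<bar>x\<bar> \<le> C"
  shows "\<bar>psum k M\<bar> \<le> real (size M) * C ^ k"
  using assms
proof (induction M)
  case (add x M)
  have "\<bar>x ^ k\<bar> \<le> C ^ k"
    using add.prems[of x] by (simp add: power_abs power_mono)
  moreover have "\<bar>psum k M\<bar> \<le> real (size M) * C ^ k" using add by simp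
  ultimately show ?case by (simp add: algebra_simps) 
qed simp

lemma isCont_eq_if_eventually_eq:
  fixes f g :: "real \<Rightarrow> real"
  assumes "isCont f x" "isCont g x" "\<forall>\<^sub>F y in at x. f y = g y"
  shows "f x = g x"
proof -
  have "(g \<longlongrightarrow> f x) (at x)"
    using assms(1) tendsto_cong[OF assms(3)] by (simp add: isCont_def)
  then show ?thesis
    using assms(2) tendsto_unique[OF at_neq_bot] unfolding isCont_def by blast
qed


text \<open>An odd power would change sign across \<open>x0\<close>, whereas a sum of squares does
  not.\<close>

lemma psum_even_order:
  assumes g: "isCont g x0" "g x0 \<noteq> 0"
    and eq: "\<forall>\<^sub>F h in nhds x0. psum 2 (M h) = (h - x0) ^ m * g h"
  shows "even m"
proof (rule ccontr)
  assume odd: "odd m"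
  have gt: "\<forall>\<^sub>F h in nhds x0. g h * g x0 > 0"
  proof -
    have "((\<lambda>h. g h * g x0) \<longlongrightarrow> g x0 * g x0) (nhds x0)"
      using g(1) by (intro tendsto_intros) (simp add: isCont_def tendsto_nhds_iff)
    moreover have "g x0 * g x0 > 0" using g(2) by (cases "g x0 > 0") (auto simp: zero_less_mult_iff)
    ultimately show ?thesis by (rule order_tendstoD(1))
  qed
  have "\<forall>\<^sub>F h in nhds x0. 0 \<le> (h - x0) ^ m * g h \<and> g h * g x0 > 0"
    using eq gt by eventually_elim (metis psum_even_nonneg mult.right_neutral)
  then obtain d where d: "d > 0" "\<And>h. dist h x0 < d \<Longrightarrow> 0 \<le> (h - x0) ^ m * g h \<and> g h * g x0 > 0"
    unfolding eventually_nhds_metric by blast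
  \<comment> \<open>The offset is taken on the side where, for odd \<open>m\<close>,
    \<open>t^m\<close> has the sign opposite to \<open>g\<close>.\<close>
  define t where "t = (if g x0 > 0 then - (d/2) else d/2)"
  have "dist (x0 + t) x0 < d" using d(1) by (simp add: t_def dist_real_def)
  from d(2)[OF this] have *: "0 \<le> t ^ m * g (x0 + t)" "g (x0 + t) * g x0 > 0" by auto
  show False
  proof (cases "g x0 > 0")
    case True
    then have "g (x0 + t) > 0" using *(2) by (simp add: zero_less_mult_iff)
    moreover have "t ^ m < 0"
      using True d(1) odd power_less_zero_eq[of t m] by (simp add: t_def)
    ultimately show False
      using *(1) mult_neg_pos[of "t ^ m" "g (x0 + t)"] by linarith
  next
    case False
    then have "g (x0 + t) < 0" using *(2) g(2) by (auto simp: zero_less_mult_iff)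
    moreover have "t ^ m > 0" using False d(1) by (simp add: t_def)
    ultimately show False
      using *(1) mult_pos_neg[of "t ^ m" "g (x0 + t)"] by linarith
  qed
qed

text \<open>Integer values that vary continuously are locally constant. Applied to
  \<open>psum 0\<close>, this shows that the size of a cluster does not jump.\<close>

lemma eventually_const_if_real_analytic_nat:
  assumes "real_analytic_at (\<lambda>h. real (c h)) x0"
  shows "\<forall>\<^sub>F h in nhds x0. c h = c x0"
proof -
  have "((\<lambda>h. real (c h)) \<longlongrightarrow> real (c x0)) (nhds x0)"
    using real_analytic_at_isCont[OF assms] by (simp add: isCont_def tendsto_nhds_iff)
  then have "\<forall>\<^sub>F h in nhds x0. dist (real (c h)) (real (c x0)) < 1"
    by (rule tendstoD) simp
  then show ?thesis
    by eventually_elim (simp add: dist_real_def)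
qed

text \<open>Only a point with two distinct values allows a split into smaller families; the shift by
  the mean and the rescaling exist to reach such a point, or else the zero family.\<close>

theorem has_branches_if_psum_analytic:
  assumes "\<And>k. real_analytic_at (\<lambda>h. psum k (M h)) x0"
    and "\<forall>\<^sub>F h in nhds x0. size (M h) = n"
  shows "has_branches M x0"
  using assms
proof (induction n arbitrary: M rule: less_induct)
  case (less n)
  \<comment> \<open>Stated for any family of size \<open>n\<close>: it is used for the mean-free
    family \<open>M1\<close> when \<open>q = 0\<close> and for the rescaled family \<open>M2\<close>
    otherwise.\<close>
  have split: "has_branches M' x0"
    if psum: "\<And>k. real_analytic_at (\<lambda>h. psum k (M' h)) x0"
      and size: "\<forall>\<^sub>F h in nhds x0. size (M' h) = n"
      and c: "c \<in># M' x0" "c' \<in># M' x0" "c \<noteq> c'" for M' c c'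
  proof -
    \<comment> \<open>Half the distance from \<open>c\<close> to the nearest other value, so the
      circle isolates \<open>c\<close> at \<open>x0\<close>. Both parts are nonempty,
      \<open>c\<close> being inside and \<open>c'\<close> outside, hence smaller than
      \<open>n\<close>.\<close>
    define \<rho> where "\<rho> = Min ((\<lambda>x. \<bar>x - c\<bar>) ` (set_mset (M' x0) - {c})) / 2"
    let ?D = "(\<lambda>x. \<bar>x - c\<bar>) ` (set_mset (M' x0) - {c})"
    have "Min ?D \<in> ?D" using c by (intro Min_in) auto
    then have \<rho>: "\<rho> > 0" by (auto simp: \<rho>_def)
    have far: "\<bar>x - c\<bar> > \<rho>" if "x \<in># M' x0" "x \<noteq> c" for x
    proof -
      have "Min ?D \<le> \<bar>x - c\<bar>" using that by (intro Min_le) auto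
      then show ?thesis using \<rho> by (simp add: \<rho>_def)
    qed
    define In where "In h = filter_mset (\<lambda>x. \<bar>x - c\<bar> < \<rho>) (M' h)" for h
    define Out where "Out h = filter_mset (\<lambda>x. \<not> \<bar>x - c\<bar> < \<rho>) (M' h)" for h
    have InOut: "M' h = In h + Out h" for h
      by (simp add: In_def Out_def flip: multiset_partition)
    have In: "real_analytic_at (\<lambda>h. psum k (In h)) x0" for k
      unfolding In_def
      by (rule real_analytic_psum_cluster[OF psum size \<rho>]) (use far \<rho> in force)
    have Out: "real_analytic_at (\<lambda>h. psum k (Out h)) x0" for k
      using real_analytic_at_diff[OF psum[of k] In[of k]] by (simp add: InOut)
    have "c \<in># In x0" "c' \<in># Out x0"
      using c far[of c'] \<rho> by (auto simp: In_def Out_def)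
    then have pos: "size (In x0) > 0" "size (Out x0) > 0"
      using nonempty_has_size by fastforce+
    have n: "size (In x0) + size (Out x0) = n"
      using eventually_nhds_x_imp_x[OF size] by (simp add: InOut)
    have "has_branches In x0"
      by (rule less.IH[of "size (In x0)"])
        (use pos n In eventually_const_if_real_analytic_nat[of "\<lambda>h. size (In h)"] In[of 0] in auto)
    moreover have "has_branches Out x0"
      by (rule less.IH[of "size (Out x0)"])
        (use pos n Out eventually_const_if_real_analytic_nat[of "\<lambda>h. size (Out h)"] Out[of 0] in auto)
    ultimately show ?thesis
      using has_branches_union[of In x0 Out] by (simp flip: InOut)
  qed
  have zero: "has_branches M' x0" if "\<forall>\<^sub>F h in nhds x0. M' h = replicate_mset n 0" for M'
    unfolding has_branches_def
    by (rule exI[of _ "replicate n (\<lambda>_. 0)"])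
      (use that in \<open>auto simp: real_analytic_at_const\<close>)
  have replicate: "X = replicate_mset n a" if "\<forall>x\<in>#X. x = a" "size X = n" for X :: "real multiset" and a
    using that by (metis set_mset_subset_singletonD subset_singleton_iff subsetI singleton_iff)
  show ?case
  proof (cases "n = 0")
    case True
    then show ?thesis
      using less.prems(2) by (intro zero) simp
  next
    case False
    define a where "a h = psum 1 (M h) / n" for h
    have a: "real_analytic_at a x0"
      unfolding a_def using False
      by (intro real_analytic_at_divide real_analytic_at_const less.prems) auto
    define M1 where "M1 h = image_mset (\<lambda>x. x + - a h) (M h)" for h
    have M1: "real_analytic_at (\<lambda>h. psum k (M1 h)) x0" for k
      unfolding M1_def psum_image_shift
      by (intro real_analytic_at_sum real_analytic_at_mult real_analytic_at_const
          real_analytic_at_power real_analytic_at_minus a less.prems)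
    have size1: "\<forall>\<^sub>F h in nhds x0. size (M1 h) = n"
      using less.prems(2) by (simp add: M1_def)
    have mean: "\<forall>\<^sub>F h in nhds x0. psum 1 (M1 h) = 0"
      using less.prems(2)
    proof eventually_elim
      case (elim h)
      have "psum 1 (M1 h) = psum 1 (M h) - a h * n"
        using psum_image_shift[of 1 "- a h" "M h"] elim
        by (simp add: M1_def)
      then show ?case using False by (simp add: a_def)
    qed
    have "has_branches M1 x0"
    proof -
      consider "\<forall>\<^sub>F h in nhds x0. psum 2 (M1 h) = 0" | m g where "real_analytic_at g x0" "g x0 \<noteq> 0"
          "\<forall>\<^sub>F h in nhds x0. psum 2 (M1 h) = (h - x0) ^ m * g h"
        by (rule real_analytic_at_order[OF M1[of 2]]) blast+
      then show ?thesis
      proof cases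
        case 1
        then have "\<forall>\<^sub>F h in nhds x0. M1 h = replicate_mset n 0"
          using size1 by eventually_elim (rule replicate, auto simp: psum_2_eq_0_iff)
        then show ?thesis by (rule zero)
      next
        case 2
        \<comment> \<open>Equal elements with sum 0 would all be 0, against the nonzero sum of
          squares.\<close>
        have not_all_equal: "\<exists>c\<in>#X. \<exists>c'\<in>#X. c \<noteq> c'"
          if "size X = n" "psum 1 X = 0" "psum 2 X \<noteq> 0" for X
        proof (rule ccontr)
          assume "\<not> ?thesis"
          moreover obtain c where "c \<in># X" using \<open>n \<noteq> 0\<close> \<open>size X = n\<close> by (cases X) auto
          ultimately have "\<forall>x\<in>#X. x = c" by blast
          then have X: "X = replicate_mset n c" using that(1) by (rule replicate)
          have "psum k X = n * c ^ k" for k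
            unfolding X by (simp add: psum_def)
          then show False using that \<open>n \<noteq> 0\<close> by simp
        qed
        have "even m"
          using psum_even_order[OF real_analytic_at_isCont[OF 2(1)] 2(2,3)] .
        then obtain q where q: "m = 2 * q" by (elim evenE)
        show ?thesis
        proof (cases "q = 0")
          case True
          have "psum 2 (M1 x0) = g x0"
            using eventually_nhds_x_imp_x[OF 2(3)] by (simp add: q True)
          then show ?thesis
            using not_all_equal[of "M1 x0"] split[of M1, OF M1 size1] 2(2)
              eventually_nhds_x_imp_x[OF mean] eventually_nhds_x_imp_x[OF size1] by auto
        next
          case q0: False
          \<comment> \<open>Near \<open>x0\<close> one has \<open>\<bar>g h\<bar> < C^2\<close>, and
            the square of every element is at most
            \<open>psum 2 (M1 h) = (h - x0)^(2q) * g h\<close>.\<close>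
          define C where "C = sqrt (\<bar>g x0\<bar> + 1)"
          have bound: "\<forall>\<^sub>F h in nhds x0. \<forall>x\<in>#M1 h. \<bar>x\<bar> \<le> C * \<bar>h - x0\<bar> ^ q"
          proof -
            have "((\<lambda>h. \<bar>g h\<bar>) \<longlongrightarrow> \<bar>g x0\<bar>) (nhds x0)"
              using real_analytic_at_isCont[OF 2(1)]
              by (intro tendsto_intros) (simp add: isCont_def tendsto_nhds_iff)
            then have "\<forall>\<^sub>F h in nhds x0. \<bar>g h\<bar> < \<bar>g x0\<bar> + 1"
              by (rule order_tendstoD) simp
            then show ?thesis using 2(3)
            proof eventually_elim
              case (elim h)
              show ?case
              proof
                fix x assume "x \<in># M1 h"
                then have "x\<^sup>2 \<le> psum 2 (M1 h)" by (rule member_square_le_psum_2)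
                also have "\<dots> \<le> \<bar>h - x0\<bar> ^ m * \<bar>g h\<bar>"
                  unfolding elim(2) power_abs[symmetric] abs_mult[symmetric] by (rule abs_ge_self)
                also have "\<dots> \<le> \<bar>h - x0\<bar> ^ m * (\<bar>g x0\<bar> + 1)"
                  using elim(1) by (intro mult_left_mono) auto
                also have "\<dots> = (C * \<bar>h - x0\<bar> ^ q)\<^sup>2"
                proof -
                  have "\<bar>h - x0\<bar> ^ m = (\<bar>h - x0\<bar> ^ q)\<^sup>2"
                    by (simp only: q power_mult mult.commute[of 2])
                  moreover have "\<bar>g x0\<bar> + 1 = C\<^sup>2" by (simp add: C_def)
                  ultimately show ?thesis by (simp only: power_mult_distrib mult.commute)
                qed
                finally have "\<bar>x\<bar> \<le> \<bar>C * \<bar>h - x0\<bar> ^ q\<bar>"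
                  by (simp only: abs_le_square_iff)
                moreover have "C * \<bar>h - x0\<bar> ^ q \<ge> 0"
                  by (simp add: C_def)
                ultimately show "\<bar>x\<bar> \<le> C * \<bar>h - x0\<bar> ^ q"
                  by (simp only: abs_of_nonneg)
              qed
            qed
          qed
          \<comment> \<open>Every element is at most \<open>C * \<bar>h - x0\<bar>^q\<close> in
            modulus, so the \<open>k\<close>-th power sum has order at least \<open>q * k\<close>
            and division leaves it analytic.\<close>
          have "\<exists>g. real_analytic_at g x0 \<and>
              (\<forall>\<^sub>F h in nhds x0. psum k (M1 h) = (h - x0) ^ (q * k) * g h)" for k
          proof (rule real_analytic_at_divide_power[OF M1, of _ "n * C ^ k"])
            show "\<forall>\<^sub>F h in nhds x0. \<bar>psum k (M1 h)\<bar> \<le> n * C ^ k * \<bar>h - x0\<bar> ^ (q * k)"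
              using bound size1
            proof eventually_elim
              case (elim h)
              then have "\<bar>psum k (M1 h)\<bar> \<le> real (size (M1 h)) * (C * \<bar>h - x0\<bar> ^ q) ^ k"
                by (intro abs_psum_le) auto
              then show ?case using elim(2) by (simp add: power_mult_distrib power_mult mult.assoc)
            qed
          qed
          then obtain G where G: "\<And>k. real_analytic_at (G k) x0"
            "\<And>k. \<forall>\<^sub>F h in nhds x0. psum k (M1 h) = (h - x0) ^ (q * k) * G k h" by metis
          define R where "R h = image_mset (\<lambda>x. (1 / (h - x0) ^ q) * x) (M1 h)" for h
          have R: "\<forall>\<^sub>F h in at x0. psum k (R h) = G k h" for k
            unfolding eventually_at_filter using G(2)[of k]
          proof eventually_elim
            case (elim h)
            have "psum k (R h) = (1 / (h - x0) ^ q) ^ k * psum k (M1 h)"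
              unfolding R_def by (rule psum_image_mult)
            then show ?case using elim by (simp add: power_mult power_divide)
          qed
          have Rbd: "\<forall>\<^sub>F h in at x0. size (R h) = n \<and> (\<forall>x\<in>#R h. \<bar>x\<bar> \<le> C)"
            unfolding eventually_at_filter using bound size1
            by eventually_elim (auto simp: R_def abs_mult power_abs field_simps)
          obtain d where d: "d > 0"
            "\<And>h. h \<noteq> x0 \<Longrightarrow> dist h x0 < d \<Longrightarrow> size (R h) = n \<and> (\<forall>x\<in>#R h. \<bar>x\<bar> \<le> C)"
            using Rbd unfolding eventually_at by blast
          \<comment> \<open>A sequence inside the punctured neighbourhood of radius
            \<open>d\<close>: the shift by 2 makes the distance at most \<open>d/2\<close> from the
            first term on.\<close>
          define s where "s j = x0 + d / (j + 2)" for j :: nat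
          have s: "s j \<noteq> x0" "dist (s j) x0 < d" for j
            using d(1) by (auto simp: s_def dist_real_def field_simps add_pos_nonneg)
          have s_lim: "filterlim s (at x0) sequentially"
          proof -
            have "s \<longlonglongrightarrow> x0" unfolding s_def by real_asymp
            then show ?thesis using s(1) by (simp add: filterlim_at)
          qed
          obtain L \<sigma> where L: "strict_mono (\<sigma> :: nat \<Rightarrow> nat)" "size L = n"
            "\<And>k. (\<lambda>j. psum k (R (s (\<sigma> j)))) \<longlonglongrightarrow> psum k L"
            using bounded_multisets_psum_limit[of "\<lambda>j. R (s j)" n C] d(2)[OF s] by blast
          have L_psum: "psum k L = G k x0" for k
          proof -
            have "((\<lambda>h. psum k (R h)) \<longlongrightarrow> G k x0) (at x0)"
              using real_analytic_at_isCont[OF G(1)[of k]] tendsto_cong[OF R[of k]]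
              by (simp add: isCont_def)
            then have "(\<lambda>j. psum k (R (s j))) \<longlonglongrightarrow> G k x0"
              by (rule filterlim_compose[OF _ s_lim])
            from LIMSEQ_subseq_LIMSEQ[OF this L(1)] L(3)[of k] show ?thesis
              by (intro LIMSEQ_unique) (auto simp: o_def)
          qed
          \<comment> \<open>With \<open>L\<close> filled in at \<open>x0\<close>, all power sums
            equal the analytic \<open>G k\<close> on a full neighbourhood. As
            \<open>G 1 x0 = 0\<close> and \<open>G 2 x0 = g x0 \<noteq> 0\<close>, the elements of
            \<open>L\<close> are not all equal.\<close>
          define M2 where "M2 h = (if h = x0 then L else R h)" for h
          have M2: "\<forall>\<^sub>F h in nhds x0. psum k (M2 h) = G k h" for k
            using R[of k] unfolding eventually_at_filter
            by eventually_elim (auto simp: M2_def L_psum)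
          have M2_an: "real_analytic_at (\<lambda>h. psum k (M2 h)) x0" for k
            by (rule real_analytic_at_cong[OF G(1)[of k]]) (use M2[of k] in eventually_elim, simp)
          have size2: "\<forall>\<^sub>F h in nhds x0. size (M2 h) = n"
            using Rbd unfolding eventually_at_filter
            by eventually_elim (auto simp: M2_def L(2))
          have L1: "psum 1 L = 0"
          proof -
            have "G 1 x0 = 0"
            proof (rule isCont_eq_if_eventually_eq[OF real_analytic_at_isCont[OF G(1)]])
              show "\<forall>\<^sub>F h in at x0. G 1 h = 0"
                unfolding eventually_at_filter using G(2)[of 1] mean by eventually_elim auto
            qed simp
            then show ?thesis by (simp only: L_psum)
          qed
          have L2: "psum 2 L \<noteq> 0"
          proof -
            have "G 2 x0 = g x0"
            proof (rule isCont_eq_if_eventually_eq[where f = "G 2" and g = g])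
              show "\<forall>\<^sub>F h in at x0. G 2 h = g h"
                unfolding eventually_at_filter using G(2)[of 2] 2(3)
                by eventually_elim (auto simp: q mult.commute)
            qed (use real_analytic_at_isCont G(1) 2(1) in auto)
            then show ?thesis using 2(2) by (simp add: L_psum)
          qed
          have "M2 x0 = L" by (simp add: M2_def)
          then have "has_branches M2 x0"
            using not_all_equal[OF L(2) L1 L2] split[OF M2_an size2] by auto
          then show ?thesis
          proof (rule has_branches_affine)
            show "real_analytic_at (\<lambda>h. (h - x0) ^ q) x0"
              by (intro real_analytic_at_power real_analytic_at_diff real_analytic_at_ident
                  real_analytic_at_const)
            show "real_analytic_at (\<lambda>_. 0) x0" by (rule real_analytic_at_const)
            \<comment> \<open>Because \<open>q > 0\<close>, both \<open>M1 x0\<close> and the scaled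
              copy of \<open>L\<close> consist of zeros; the scaling identity thus holds at
              \<open>x0\<close> as well.\<close>
            have "\<forall>x\<in>#M1 x0. x = 0"
              using eventually_nhds_x_imp_x[OF 2(3)] q0 by (simp add: q flip: psum_2_eq_0_iff)
            then have x0: "M1 x0 = replicate_mset n 0"
              using eventually_nhds_x_imp_x[OF size1] by (rule replicate)
            show "\<forall>\<^sub>F h in nhds x0. M1 h = image_mset (\<lambda>x. (h - x0) ^ q * x + 0) (M2 h)"
            proof (intro always_eventually allI)
              fix h
              show "M1 h = image_mset (\<lambda>x. (h - x0) ^ q * x + 0) (M2 h)"
              proof (cases "h = x0")
                case True
                have "image_mset (\<lambda>x. (h - x0) ^ q * x + 0) L = replicate_mset n 0"
                  by (rule replicate) (use q0 L(2) True in auto)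
                then show ?thesis using x0 by (simp add: M2_def True)
              next
                case False
                then show ?thesis by (simp add: M2_def R_def multiset.map_comp o_def)
              qed
            qed
          qed
        qed
      qed
    qed
    then show ?thesis
      by (rule has_branches_affine[where s="\<lambda>_. 1" and b=a])
        (auto simp: a real_analytic_at_const M1_def multiset.map_comp o_def)
  qed
qed

section \<open>Gluing branches along the half-line\<close>

lemma real_analytic_at_eventually_at:
  assumes "real_analytic_at f x"
  shows "\<forall>\<^sub>F y in nhds x. real_analytic_at f y"
proof -
  obtain F where F: "F analytic_on {complex_of_real x}"
    "\<forall>\<^sub>F y in nhds x. F (complex_of_real y) = complex_of_real (f y)"
    using assms unfolding real_analytic_at_def by blast
  have "\<forall>\<^sub>F z in nhds (complex_of_real x). F analytic_on {z}"
  proof -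
    obtain S where S: "open S" "complex_of_real x \<in> S" "F holomorphic_on S"
      using F(1) by (auto simp: analytic_at)
    from eventually_nhds_in_open[OF S(1,2)] show ?thesis
      by eventually_elim (use S in \<open>auto simp: analytic_at\<close>)
  qed
  from eventually_of_real_nhds[OF this] show ?thesis
    using F(2)[THEN eventually_eventually[THEN iffD2]]
    by eventually_elim (rule real_analytic_atI)
qed

definition branches_on :: "(real \<Rightarrow> real multiset) \<Rightarrow> nat \<Rightarrow> real set \<Rightarrow> (nat \<Rightarrow> real \<Rightarrow> real) \<Rightarrow> bool" where
  "branches_on M n S f \<longleftrightarrow> (\<forall>i<n. \<forall>x\<in>S. real_analytic_at (f i) x) \<and>
     (\<forall>h\<in>S. M h = image_mset (\<lambda>i. f i h) (mset_set {..<n}))"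

lemma branches_on_subset: "branches_on M n S f \<Longrightarrow> T \<subseteq> S \<Longrightarrow> branches_on M n T f"
  unfolding branches_on_def by blast

lemma branches_on_cong:
  assumes "branches_on M n S f" "open S" "\<And>i h. i < n \<Longrightarrow> h \<in> S \<Longrightarrow> f i h = g i h"
  shows "branches_on M n S g"
proof -
  have "real_analytic_at (g i) x" if "i < n" "x \<in> S" for i x
  proof (rule real_analytic_at_cong)
    show "real_analytic_at (f i) x" using assms(1) that by (simp add: branches_on_def)
    show "\<forall>\<^sub>F y in nhds x. f i y = g i y"
      using eventually_nhds_in_open[OF assms(2) that(2)]
      by eventually_elim (use assms(3) that(1) in auto)
  qed
  moreover have "image_mset (\<lambda>i. f i h) (mset_set {..<n}) = image_mset (\<lambda>i. g i h) (mset_set {..<n})"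
    if "h \<in> S" for h
    by (rule image_mset_cong) (use assms(3) that in auto)
  ultimately show ?thesis
    using assms(1) unfolding branches_on_def by auto
qed

lemma has_branches_imp_branches_on:
  assumes "has_branches M x" "size (M x) = n"
  shows "\<exists>e>0. \<exists>f. branches_on M n {x-e<..<x+e} f"
proof -
  obtain fs where fs: "\<forall>f\<in>set fs. real_analytic_at f x"
    "\<forall>\<^sub>F h in nhds x. M h = mset (map (\<lambda>f. f h) fs)"
    using assms(1) unfolding has_branches_def by blast
  have n: "length fs = n"
    using eventually_nhds_x_imp_x[OF fs(2)] assms(2) by simp
  have "\<forall>\<^sub>F h in nhds x. (\<forall>i\<in>{..<n}. real_analytic_at (fs ! i) h) \<and> M h = mset (map (\<lambda>f. f h) fs)"
    using fs n by (auto intro!: eventually_conj eventually_ball_finite real_analytic_at_eventually_at)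
  then obtain e where e: "e > 0" "\<And>h. dist h x < e \<Longrightarrow>
      (\<forall>i\<in>{..<n}. real_analytic_at (fs ! i) h) \<and> M h = mset (map (\<lambda>f. f h) fs)"
    unfolding eventually_nhds_metric by blast
  have "map (\<lambda>f. f h) fs = map (\<lambda>i. (fs ! i) h) [0..<n]" for h
    using n by (intro nth_equalityI) auto
  then have "mset (map (\<lambda>f. f h) fs) = image_mset (\<lambda>i. (fs ! i) h) (mset_set {..<n})" for h
    by (simp add: atLeast0LessThan)
  then have "branches_on M n {x-e<..<x+e} (\<lambda>i. fs ! i)"
    using e(2) unfolding branches_on_def by (auto simp: dist_real_def)
  then show ?thesis using e(1) by blast
qed

text \<open>Finitely many permutations cover an interval, so one of them matches the two families of
  branches on an infinite set, and hence everywhere by the identity theorem.\<close>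

lemma branches_on_unique:
  assumes f: "branches_on M n {a<..<b} f" and g: "branches_on M n {a<..<b} g" and ab: "a < b"
  shows "\<exists>\<sigma>. \<sigma> permutes {..<n} \<and> (\<forall>i<n. \<forall>h\<in>{a<..<b}. f i h = g (\<sigma> i) h)"
proof -
  define x where "x = (a + b) / 2"
  have x: "x \<in> {a<..<b}" using ab by (simp add: x_def)
  let ?S = "{\<sigma>. \<sigma> permutes {..<n}}"
  have "\<forall>\<^sub>F h in at x. h \<in> {a<..<b}"
    using x by (intro eventually_at_in_open') auto
  then have "\<forall>\<^sub>F h in at x. \<exists>\<sigma>\<in>?S. \<forall>i<n. f i h = g (\<sigma> i) h"
  proof eventually_elim
    case (elim h)
    have "image_mset (\<lambda>i. f i h) (mset_set {..<n}) = image_mset (\<lambda>i. g i h) (mset_set {..<n})"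
      using f g elim unfolding branches_on_def by simp
    then obtain \<sigma> where "\<sigma> permutes {..<n}" "\<forall>i\<in>{..<n}. f i h = g (\<sigma> i) h"
      by (rule image_mset_eq_implies_permutes[OF finite_lessThan])
    then show ?case by auto
  qed
  then have "\<exists>\<^sub>F h in at x. \<exists>\<sigma>\<in>?S. \<forall>i<n. f i h = g (\<sigma> i) h"
    by (rule eventually_frequently[OF at_neq_bot])
  from frequently_bex_finite[OF finite_permutations[OF finite_lessThan] this]
  obtain \<sigma> where \<sigma>: "\<sigma> permutes {..<n}" "\<exists>\<^sub>F h in at x. \<forall>i<n. f i h = g (\<sigma> i) h"
    by auto
  have "f i h = g (\<sigma> i) h" if "i < n" "h \<in> {a<..<b}" for i h
  proof (rule real_analytic_identity[of "{a<..<b}" "f i" "g (\<sigma> i)" x h])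
    show "\<exists>\<^sub>F h in at x. f i h = g (\<sigma> i) h"
      by (rule frequently_elim1[OF \<sigma>(2)]) (use that in auto)
    have "\<sigma> i < n" using permutes_in_image[OF \<sigma>(1), of i] that(1) by simp
    then show "\<And>x. x \<in> {a<..<b} \<Longrightarrow> real_analytic_at (g (\<sigma> i)) x"
      using g by (simp add: branches_on_def)
    show "\<And>x. x \<in> {a<..<b} \<Longrightarrow> real_analytic_at (f i) x"
      using f that(1) by (simp add: branches_on_def)
  qed (use x that in auto)
  then show ?thesis using \<sigma>(1) by blast
qed

lemma branches_on_permute:
  assumes "branches_on M n S g" "\<sigma> permutes {..<n}"
  shows "branches_on M n S (\<lambda>i. g (\<sigma> i))"
proof -
  have "image_mset (\<lambda>i. g (\<sigma> i) h) (mset_set {..<n}) = image_mset (\<lambda>i. g i h) (mset_set {..<n})" for h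
  proof -
    have "image_mset (\<lambda>i. g (\<sigma> i) h) (mset_set {..<n})
        = image_mset (\<lambda>i. g i h) (image_mset \<sigma> (mset_set {..<n}))"
      by (simp add: multiset.map_comp o_def)
    then show ?thesis by (simp only: permutes_image_mset[OF assms(2)])
  qed
  then show ?thesis
    using assms permutes_in_image[OF assms(2)] unfolding branches_on_def by simp
qed

text \<open>Local branches at the endpoint exist but may be numbered differently; uniqueness on the
  overlap \<open>{c<..<b}\<close> gives the permutation that matches them.\<close>

lemma branches_on_extend:
  assumes f: "branches_on M n {a<..<b} f" and ab: "a < b"
    and loc: "has_branches M b" "size (M b) = n"
  shows "\<exists>e>0. \<exists>g. branches_on M n {a<..<b+e} g \<and> (\<forall>i<n. \<forall>h\<in>{a<..<b}. g i h = f i h)"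
proof -
  obtain e g where e: "e > 0" and g: "branches_on M n {b-e<..<b+e} g"
    using has_branches_imp_branches_on[OF loc] by blast
  define c where "c = max a (b - e)"
  have c: "c < b" "a \<le> c" "b - e \<le> c" using ab e by (auto simp: c_def)
  have "branches_on M n {c<..<b} f"
    by (rule branches_on_subset[OF f]) (use c in auto)
  moreover have gc: "branches_on M n {c<..<b+e} g"
    by (rule branches_on_subset[OF g]) (use c in auto)
  then have "branches_on M n {c<..<b} g"
    by (rule branches_on_subset) (use e in auto)
  ultimately obtain \<sigma> where \<sigma>: "\<sigma> permutes {..<n}"
      "\<And>i h. i < n \<Longrightarrow> h \<in> {c<..<b} \<Longrightarrow> f i h = g (\<sigma> i) h"
    using branches_on_unique c(1) by blast
  \<comment> \<open>On \<open>{c<..<b}\<close> both formulas agree, so \<open>k\<close> coincides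
    with the renumbered \<open>g\<close> on an open interval around \<open>b\<close> and is analytic
    across it.\<close>
  define k where "k i h = (if h < b then f i h else g (\<sigma> i) h)" for i h
  have "branches_on M n {a<..<b} k"
    by (rule branches_on_cong[OF f]) (auto simp: k_def)
  moreover have "branches_on M n {c<..<b+e} k"
    by (rule branches_on_cong[OF branches_on_permute[OF gc \<sigma>(1)]])
      (use c \<sigma>(2) in \<open>auto simp: k_def\<close>)
  ultimately have "branches_on M n ({a<..<b} \<union> {c<..<b+e}) k"
    unfolding branches_on_def by blast
  moreover have "{a<..<b+e} \<subseteq> {a<..<b} \<union> {c<..<b+e}" using c by auto
  ultimately have "branches_on M n {a<..<b+e} k" by (rule branches_on_subset)
  then show ?thesis using e by (auto simp: k_def intro!: exI[of _ e] exI[of _ k])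
qed

text \<open>Any two of the extensions agree on their common interval by the identity theorem, since
  both continue \<open>f\<close>. The choice of \<open>T\<close> made by \<open>SOME\<close> is
  therefore immaterial.\<close>

lemma branches_on_Union:
  fixes E :: "real set"
  assumes ab: "a < b" and E: "\<And>T. T \<in> E \<Longrightarrow> b \<le> T"
    and F: "\<And>T. T \<in> E \<Longrightarrow> branches_on M n {a<..<T} (F T)"
      "\<And>T i h. T \<in> E \<Longrightarrow> i < n \<Longrightarrow> h \<in> {a<..<b} \<Longrightarrow> F T i h = f i h"
  shows "\<exists>g. branches_on M n (\<Union>T\<in>E. {a<..<T}) g \<and> (E \<noteq> {} \<longrightarrow> (\<forall>i<n. \<forall>h\<in>{a<..<b}. g i h = f i h))"
proof -
  have agree: "F T i h = F T' i h" if "T \<in> E" "T' \<in> E" "i < n" "h \<in> {a<..<min T T'}" for T T' i h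
  proof (rule real_analytic_identity[of "{a<..<min T T'}" "F T i" "F T' i" "(a + b) / 2"])
    have "\<forall>\<^sub>F h in at ((a + b) / 2). h \<in> {a<..<b}"
      using ab by (intro eventually_at_in_open') auto
    then have "\<forall>\<^sub>F h in at ((a + b) / 2). F T i h = F T' i h"
      by eventually_elim (use F(2) that in simp)
    then show "\<exists>\<^sub>F h in at ((a + b) / 2). F T i h = F T' i h"
      by (rule eventually_frequently[OF at_neq_bot])
    show "real_analytic_at (F T i) x" if "x \<in> {a<..<min T T'}" for x
      using F(1)[OF \<open>T \<in> E\<close>] \<open>i < n\<close> that by (simp add: branches_on_def)
    show "real_analytic_at (F T' i) x" if "x \<in> {a<..<min T T'}" for x
      using F(1)[OF \<open>T' \<in> E\<close>] \<open>i < n\<close> that by (simp add: branches_on_def)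
    show "(a + b) / 2 \<in> {a<..<min T T'}"
      using ab E[OF \<open>T \<in> E\<close>] E[OF \<open>T' \<in> E\<close>] by simp
    show "h \<in> {a<..<min T T'}" by (rule that(4))
  qed auto
  define g where "g i h = F (SOME T. T \<in> E \<and> h < T) i h" for i h
  have gF: "g i h = F T i h" if "T \<in> E" "i < n" "h \<in> {a<..<T}" for T i h
  proof -
    have "(SOME T. T \<in> E \<and> h < T) \<in> E \<and> h < (SOME T. T \<in> E \<and> h < T)"
      by (rule someI[of _ T]) (use that in auto)
    then show ?thesis
      unfolding g_def using that by (intro agree) auto
  qed
  have "branches_on M n {a<..<T} g" if "T \<in> E" for T
    by (rule branches_on_cong[OF F(1)[OF that]]) (use gF[OF that] in auto)
  then have "branches_on M n (\<Union>T\<in>E. {a<..<T}) g"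
    by (simp add: branches_on_def)
  moreover have "g i h = f i h" if "T \<in> E" "i < n" "h \<in> {a<..<b}" for T i h
    using gF[OF that(1,2)] F(2)[OF that] E[OF that(1)] that(3) by auto
  ultimately show ?thesis by (intro exI[of _ g]) blast
qed

text \<open>A supremum argument on the right endpoints that admit an extension: if they were
  bounded, the union would reach the supremum, and the local branches there would carry it further.
  No uniform lower bound on the local radii is involved.\<close>

theorem global_branches:
  assumes loc: "\<And>x. has_branches M x" and size: "\<And>h. size (M h) = n"
  shows "\<exists>a<0. \<exists>f. branches_on M n {a<..} f"
proof -
  obtain e f0 where e: "e > 0" and f0: "branches_on M n {0-e<..<0+e} f0"
    using has_branches_imp_branches_on[OF loc size, of 0] by blast
  define a b where "a = -e" and "b = e"
  have ab: "a < b" and a0: "a < 0" and b0: "b > 0" using e by (auto simp: a_def b_def)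
  define Ext where "Ext T f \<longleftrightarrow> branches_on M n {a<..<T} f \<and> (\<forall>i<n. \<forall>h\<in>{a<..<b}. f i h = f0 i h)" for T f
  define E where "E = {T. b \<le> T \<and> (\<exists>f. Ext T f)}"
  have bE: "b \<in> E" using f0 by (auto simp: E_def Ext_def a_def b_def)
  obtain F where F: "\<And>T. T \<in> E \<Longrightarrow> Ext T (F T)"
  proof -
    have "\<forall>T. \<exists>f. T \<in> E \<longrightarrow> Ext T f" unfolding E_def by blast
    then show ?thesis using that by metis
  qed
  obtain g where g: "branches_on M n (\<Union>T\<in>E. {a<..<T}) g" "\<forall>i<n. \<forall>h\<in>{a<..<b}. g i h = f0 i h"
  proof -
    have "b \<le> T" "branches_on M n {a<..<T} (F T)" "\<forall>i<n. \<forall>h\<in>{a<..<b}. F T i h = f0 i h" if "T \<in> E" for T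
      using that F[OF that] by (auto simp: E_def Ext_def)
    then have "\<exists>g. branches_on M n (\<Union>T\<in>E. {a<..<T}) g \<and>
        (E \<noteq> {} \<longrightarrow> (\<forall>i<n. \<forall>h\<in>{a<..<b}. g i h = f0 i h))"
      by (intro branches_on_Union[OF ab, where F = F]) simp_all
    then show ?thesis using that bE by blast
  qed
  have unbounded: "\<not> bdd_above E"
  proof
    assume bdd: "bdd_above E"
    define s where "s = Sup E"
    have bs: "b \<le> s" unfolding s_def using bE bdd by (rule cSup_upper)
    have "{a<..<s} \<subseteq> (\<Union>T\<in>E. {a<..<T})"
      using less_cSup_iff[OF _ bdd] bE unfolding s_def by fastforce
    then have gs: "branches_on M n {a<..<s} g" by (rule branches_on_subset[OF g(1)])
    obtain d k where d: "d > 0" and k: "branches_on M n {a<..<s+d} k" "\<forall>i<n. \<forall>h\<in>{a<..<s}. k i h = g i h"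
      using branches_on_extend[OF gs _ loc size] bs ab by auto
    have "k i h = f0 i h" if "i < n" "h \<in> {a<..<b}" for i h
      using that k(2) g(2) bs by auto
    then have "s + d \<in> E" using k(1) bs d unfolding E_def Ext_def by (auto intro!: exI[of _ k])
    then have "s + d \<le> s" unfolding s_def using bdd by (rule cSup_upper)
    then show False using d by simp
  qed
  have "{a<..} \<subseteq> (\<Union>T\<in>E. {a<..<T})"
    using unbounded unfolding bdd_above_def by (force simp: not_le)
  then have "branches_on M n {a<..} g" by (rule branches_on_subset[OF g(1)])
  then show ?thesis using a0 by blast
qed

section \<open>Orthonormal eigenbases and eigenvalue counts\<close>

definition orthonormal :: "'a::euclidean_space set \<Rightarrow> bool" where
  "orthonormal B \<longleftrightarrow> pairwise orthogonal B \<and> (\<forall>b\<in>B. norm b = 1)"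

lemma orthonormal_inner:
  assumes "orthonormal B" "b \<in> B" "c \<in> B"
  shows "b \<bullet> c = (if b = c then 1 else 0)"
  using assms unfolding orthonormal_def pairwise_def orthogonal_def
  by (auto simp: norm_eq_1)

lemma orthonormal_subset: "orthonormal B \<Longrightarrow> C \<subseteq> B \<Longrightarrow> orthonormal C"
  unfolding orthonormal_def by (meson pairwise_subset subsetD)

lemma orthonormal_independent: "orthonormal B \<Longrightarrow> independent B"
  unfolding orthonormal_def by (metis norm_zero pairwise_orthogonal_independent zero_neq_one)

lemma orthonormal_finite: "orthonormal B \<Longrightarrow> finite B"
  by (simp add: orthonormal_independent independent_imp_finite)

lemma dim_span_orthonormal: "orthonormal B \<Longrightarrow> dim (span B) = card B"
  by (simp add: orthonormal_independent dim_eq_card_independent)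

lemma orthonormal_sum_inner:
  assumes "orthonormal B" "b \<in> B"
  shows "(\<Sum>c\<in>B. a c *\<^sub>R c) \<bullet> b = a b"
proof -
  have "(\<Sum>c\<in>B. a c *\<^sub>R c) \<bullet> b = (\<Sum>c\<in>B. if c = b then a c else 0)"
    unfolding inner_sum_left
    by (rule sum.cong) (use orthonormal_inner[OF assms(1) _ assms(2)] in auto)
  then show ?thesis using assms(2) orthonormal_finite[OF assms(1)] by simp
qed

lemma orthonormal_expand:
  assumes "orthonormal B" "x \<in> span B"
  shows "x = (\<Sum>b\<in>B. (x \<bullet> b) *\<^sub>R b)"
  using orthonormal_basis_expand[of B x] assms orthonormal_finite[OF assms(1)]
  by (auto simp: orthonormal_def)

lemma orthonormal_inner_expand:
  assumes "orthonormal B" "x \<in> span B"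
  shows "x \<bullet> y = (\<Sum>b\<in>B. (x \<bullet> b) * (b \<bullet> y))"
  by (subst orthonormal_expand[OF assms]) (simp add: inner_sum_left)

lemma orthonormal_mem_span_subset:
  assumes B: "orthonormal B" "x \<in> span B" and C: "C \<subseteq> B" "\<And>b. b \<in> B - C \<Longrightarrow> x \<bullet> b = 0"
  shows "x \<in> span C"
proof -
  have "x = (\<Sum>b\<in>B. (x \<bullet> b) *\<^sub>R b)" by (rule orthonormal_expand[OF B])
  also have "\<dots> = (\<Sum>b\<in>C. (x \<bullet> b) *\<^sub>R b)"
    by (rule sum.mono_neutral_right) (use C orthonormal_finite[OF B(1)] in auto)
  finally show ?thesis
    by (metis (no_types, lifting) span_base span_mul span_sum)
qed

section \<open>The spectral theorem on an invariant subspace\<close>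

definition orthonormal_eigenbasis :: "('a::euclidean_space \<Rightarrow> 'a) \<Rightarrow> 'a set \<Rightarrow> 'a set \<Rightarrow> bool" where
  "orthonormal_eigenbasis T W B \<longleftrightarrow>
     orthonormal B \<and> span B = W \<and> (\<forall>b\<in>B. T b = (b \<bullet> T b) *\<^sub>R b)"

text \<open>A maximizer \<open>v\<close> of the Rayleigh quotient is perturbed in the direction of
  its own residual \<open>w = \<mu> v - T v\<close>; maximality then forces
  \<open>w = 0\<close>.\<close>

lemma symmetric_max_eigenvector:
  fixes T :: "'a::euclidean_space \<Rightarrow> 'a"
  assumes T: "linear T" and W: "subspace W" "W \<noteq> {0}" and inv: "\<And>x. x \<in> W \<Longrightarrow> T x \<in> W"
    and sym: "\<And>x y. x \<in> W \<Longrightarrow> y \<in> W \<Longrightarrow> x \<bullet> T y = T x \<bullet> y"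
  shows "\<exists>v\<in>W. norm v = 1 \<and> T v = (v \<bullet> T v) *\<^sub>R v"
proof -
  let ?K = "W \<inter> sphere 0 1"
  have "compact ?K"
    using closed_subspace[OF W(1)] by (simp add: closed_Int_compact)
  moreover obtain w where w: "w \<in> W" "w \<noteq> 0" using W subspace_0 by blast
  then have "w /\<^sub>R norm w \<in> ?K"
    using subspace_mul[OF W(1)] by simp
  then have "?K \<noteq> {}" by blast
  moreover have "continuous_on ?K (\<lambda>x. x \<bullet> T x)"
    by (intro continuous_intros linear_continuous_on_compose[OF _ T])
  ultimately obtain v where v: "v \<in> ?K" "\<And>x. x \<in> ?K \<Longrightarrow> x \<bullet> T x \<le> v \<bullet> T v"
    using continuous_attains_sup by metis
  define \<mu> where "\<mu> = v \<bullet> T v"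
  have vv: "v \<in> W" "v \<bullet> v = 1" using v(1) by (auto simp: norm_eq_1)
  have max: "x \<bullet> T x \<le> \<mu> * (x \<bullet> x)" if "x \<in> W" for x
  proof (cases "x = 0")
    case True
    then show ?thesis by simp
  next
    case False
    have "(x /\<^sub>R norm x) \<bullet> T (x /\<^sub>R norm x) \<le> \<mu>"
      unfolding \<mu>_def by (rule v(2)) (use that False subspace_mul[OF W(1)] in simp)
    then have "(x \<bullet> T x) / (norm x)\<^sup>2 \<le> \<mu>"
      by (simp add: linear_cmul[OF T] power2_eq_square divide_inverse mult.commute mult.left_commute)
    then show ?thesis
      using False by (simp add: field_simps dot_square_norm)
  qed
  define w where "w = \<mu> *\<^sub>R v - T v"
  have wW: "w \<in> W" unfolding w_def using vv(1) inv W(1) by (simp add: subspace_diff subspace_mul)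
  \<comment> \<open>The gap in the Rayleigh inequality at \<open>v + t w\<close> has no constant
    term, and its linear coefficient is \<open>2 (w \<bullet> w)\<close>.\<close>
  have lin: "2 * t * (w \<bullet> w) + t\<^sup>2 * (\<mu> * (w \<bullet> w) - w \<bullet> T w) \<ge> 0" for t
  proof -
    have "0 \<le> \<mu> * ((v + t *\<^sub>R w) \<bullet> (v + t *\<^sub>R w)) - (v + t *\<^sub>R w) \<bullet> T (v + t *\<^sub>R w)"
      using max[of "v + t *\<^sub>R w"] vv(1) wW W(1) by (simp add: subspace_add subspace_mul)
    also have "\<dots> = 2 * t * (\<mu> * (v \<bullet> w) - w \<bullet> T v) + t\<^sup>2 * (\<mu> * (w \<bullet> w) - w \<bullet> T w)"
    proof -
      have 1: "(v + t *\<^sub>R w) \<bullet> (v + t *\<^sub>R w) = v \<bullet> v + 2 * t * (v \<bullet> w) + t\<^sup>2 * (w \<bullet> w)"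
        by (simp add: inner_add_left inner_add_right inner_commute[of w v] power2_eq_square algebra_simps)
      have 2: "(v + t *\<^sub>R w) \<bullet> T (v + t *\<^sub>R w)
          = v \<bullet> T v + t * (v \<bullet> T w) + t * (w \<bullet> T v) + t\<^sup>2 * (w \<bullet> T w)"
        by (simp add: linear_add[OF T] linear_cmul[OF T] inner_add_left inner_add_right
            power2_eq_square distrib_left)
      have 3: "v \<bullet> T w = w \<bullet> T v"
        using sym[OF vv(1) wW] by (simp add: inner_commute)
      show ?thesis
        unfolding 1 2 3 vv(2) \<mu>_def[symmetric] by (simp add: algebra_simps)
    qed
    also have "\<mu> * (v \<bullet> w) - w \<bullet> T v = w \<bullet> w"
      by (subst (3) w_def) (simp add: inner_diff_right inner_commute)
    finally show ?thesis .
  qed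
  have "w \<bullet> w = 0"
  proof (rule ccontr)
    assume "w \<bullet> w \<noteq> 0"
    then have pos: "w \<bullet> w > 0" by (simp add: less_le)
    \<comment> \<open>\<open>d\<close> exceeds the quadratic coefficient, and \<open>t\<close>
      minimizes \<open>2 t (w \<bullet> w) + t^2 d\<close>, with the negative value
      \<open>-(w \<bullet> w)^2 / d\<close>.\<close>
    define d where "d = \<bar>\<mu> * (w \<bullet> w) - w \<bullet> T w\<bar> + 1"
    define t where "t = - (w \<bullet> w) / d"
    have d: "d > 0" "\<mu> * (w \<bullet> w) - w \<bullet> T w \<le> d" by (auto simp: d_def)
    have "2 * t * (w \<bullet> w) + t\<^sup>2 * (\<mu> * (w \<bullet> w) - w \<bullet> T w) \<le> 2 * t * (w \<bullet> w) + t\<^sup>2 * d"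
      using d by (intro add_left_mono mult_left_mono) auto
    also have "\<dots> = - ((w \<bullet> w)\<^sup>2 / d)"
      using d(1) by (simp add: t_def power2_eq_square field_simps)
    also have "\<dots> < 0" using pos d(1) by simp
    finally show False using lin[of t] by simp
  qed
  then have "T v = \<mu> *\<^sub>R v" by (simp add: w_def)
  then show ?thesis using v(1) by (auto simp: \<mu>_def)
qed

text \<open>Split off one eigenvector and pass to its complement in \<open>W\<close>. Symmetry is
  required only on \<open>W\<close>, as \<open>Ahat N A j\<close> is symmetric only on
  \<open>Wdom N A j\<close>.\<close>

theorem symmetric_orthonormal_eigenbasis:
  fixes T :: "'a::euclidean_space \<Rightarrow> 'a"
  assumes T: "linear T" and "subspace W" "\<And>x. x \<in> W \<Longrightarrow> T x \<in> W"
    and "\<And>x y. x \<in> W \<Longrightarrow> y \<in> W \<Longrightarrow> x \<bullet> T y = T x \<bullet> y"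
  shows "\<exists>B. orthonormal_eigenbasis T W B"
  using assms(2-)
proof (induction "dim W" arbitrary: W rule: less_induct)
  case less
  show ?case
  proof (cases "W = {0}")
    case True
    then show ?thesis
      by (intro exI[of _ "{}"]) (auto simp: orthonormal_eigenbasis_def orthonormal_def)
  next
    case False
    obtain v where v: "v \<in> W" "norm v = 1" "T v = (v \<bullet> T v) *\<^sub>R v"
      using symmetric_max_eigenvector[OF T less.prems(1) False less.prems(2,3)] by blast
    define W' where "W' = {x \<in> W. orthogonal v x}"
    have W': "subspace W'"
      using less.prems(1)
      by (auto simp: W'_def subspace_def orthogonal_def inner_add_right)
    have "span {v} \<subseteq> W" using v(1) less.prems(1) by (simp add: span_minimal)
    then have "dim {y \<in> W. \<forall>x\<in>span {v}. orthogonal x y} + dim (span {v}) = dim W"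
      by (intro dim_subspace_orthogonal_to_vectors less.prems subspace_span)
    moreover have "{y \<in> W. \<forall>x\<in>span {v}. orthogonal x y} = W'"
      unfolding W'_def by (auto simp: span_singleton orthogonal_def)
    moreover have "dim (span {v}) = 1"
      using v(2) by (subst dim_span, subst dim_singleton) auto
    ultimately have dim: "dim W' < dim W" by simp
    have "T x \<in> W'" if "x \<in> W'" for x
    proof -
      have "v \<bullet> T x = T v \<bullet> x" using less.prems(3) v(1) that by (simp add: W'_def)
      also have "\<dots> = (v \<bullet> T v) * (v \<bullet> x)" by (subst v(3)) simp
      also have "\<dots> = 0" using that by (simp add: W'_def orthogonal_def)
      finally show ?thesis using that less.prems(2) by (simp add: W'_def orthogonal_def)
    qed
    then obtain B where B: "orthonormal_eigenbasis T W' B"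
      using less.hyps[OF dim W'] less.prems(3) unfolding W'_def by blast
    then have B': "orthonormal B" "span B = W'" "\<And>b. b \<in> B \<Longrightarrow> T b = (b \<bullet> T b) *\<^sub>R b"
      by (auto simp: orthonormal_eigenbasis_def)
    have BW': "B \<subseteq> W'" using B'(2) span_superset by blast
    have "orthonormal (insert v B)"
      using B'(1) v(2) BW'
      by (auto simp: orthonormal_def pairwise_insert W'_def orthogonal_commute)
    moreover have "span (insert v B) = W"
    proof
      show "span (insert v B) \<subseteq> W"
        using v(1) BW' less.prems(1) by (intro span_minimal) (auto simp: W'_def)
      show "W \<subseteq> span (insert v B)"
      proof
        fix x assume x: "x \<in> W"
        have "x - (v \<bullet> x) *\<^sub>R v \<in> W'"
          using x v less.prems(1)
          by (auto simp: W'_def orthogonal_def inner_diff_right subspace_diff subspace_mul norm_eq_1)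
        then show "x \<in> span (insert v B)"
          unfolding B'(2)[symmetric] span_insert by blast
      qed
    qed
    ultimately have "orthonormal_eigenbasis T W (insert v B)"
      using B'(3) v(3) by (auto simp: orthonormal_eigenbasis_def)
    then show ?thesis by blast
  qed
qed

section \<open>Multiplicities, traces and quadratic forms in an eigenbasis\<close>

lemma eigenbasis_funpow:
  assumes S: "linear S" and s: "\<And>b. b \<in> B \<Longrightarrow> S b = s b *\<^sub>R b"
  shows "(S ^^ k) (\<Sum>b\<in>B. c b *\<^sub>R b) = (\<Sum>b\<in>B. (c b * s b ^ k) *\<^sub>R b)"
proof (induction k)
  case (Suc k)
  have "(S ^^ Suc k) (\<Sum>b\<in>B. c b *\<^sub>R b) = (\<Sum>b\<in>B. (c b * s b ^ k) *\<^sub>R S b)"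
    by (simp add: Suc.IH linear_sum[OF S] linear_cmul[OF S])
  also have "\<dots> = (\<Sum>b\<in>B. (c b * s b ^ Suc k) *\<^sub>R b)"
    by (rule sum.cong) (auto simp: s)
  finally show ?case .
qed simp

text \<open>In the eigenbasis, powers of \<open>T - \<mu>\<close> scale each coordinate by powers of
  \<open>b \<bullet> T b - \<mu>\<close>; so the generalized eigenspace is spanned by the basis
  vectors with eigenvalue \<open>\<mu>\<close>, and exponent 1 already annihilates it.\<close>

lemma alg_mult_eigenbasis:
  fixes T :: "real^'d \<Rightarrow> real^'d"
  assumes T: "linear T" and B: "orthonormal_eigenbasis T W B"
  shows "alg_mult T W \<mu> = card {b \<in> B. b \<bullet> T b = \<mu>}"
proof -
  let ?C = "{b \<in> B. b \<bullet> T b = \<mu>}"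
  have B': "orthonormal B" "span B = W" "\<And>b. b \<in> B \<Longrightarrow> T b = (b \<bullet> T b) *\<^sub>R b"
    using B by (auto simp: orthonormal_eigenbasis_def)
  define S where "S x = T x - \<mu> *\<^sub>R x" for x
  have S: "linear S"
    unfolding S_def by (intro linear_compose_sub T linear_scaleR)
  have s: "S b = (b \<bullet> T b - \<mu>) *\<^sub>R b" if "b \<in> B" for b
    unfolding S_def by (subst B'(3)[OF that]) (simp add: scaleR_left_diff_distrib)
  have C: "orthonormal ?C" by (rule orthonormal_subset[OF B'(1)]) auto
  have "{v \<in> W. \<exists>k. (S ^^ k) v = 0} = span ?C"
  proof (intro equalityI subsetI)
    fix v assume "v \<in> {v \<in> W. \<exists>k. (S ^^ k) v = 0}"
    then obtain k where v: "v \<in> span B" "(S ^^ k) v = 0" using B'(2) by blast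
    have *: "(\<Sum>b\<in>B. ((v \<bullet> b) * (b \<bullet> T b - \<mu>) ^ k) *\<^sub>R b) = 0"
      using eigenbasis_funpow[OF S s, of B k "\<lambda>b. v \<bullet> b"] v(2)
      by (simp flip: orthonormal_expand[OF B'(1) v(1)])
    show "v \<in> span ?C"
    proof (rule orthonormal_mem_span_subset[OF B'(1) v(1)])
      fix b assume b: "b \<in> B - ?C"
      then have "(v \<bullet> b) * (b \<bullet> T b - \<mu>) ^ k = 0"
        using orthonormal_sum_inner[OF B'(1), of b "\<lambda>b. (v \<bullet> b) * (b \<bullet> T b - \<mu>) ^ k"] *
        by simp
      then show "v \<bullet> b = 0" using b by auto
    qed auto
  next
    fix v assume v: "v \<in> span ?C"
    have "(S ^^ 1) (\<Sum>b\<in>?C. (v \<bullet> b) *\<^sub>R b) = (\<Sum>b\<in>?C. ((v \<bullet> b) * (b \<bullet> T b - \<mu>) ^ 1) *\<^sub>R b)"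
      by (rule eigenbasis_funpow[OF S s]) auto
    then have "(S ^^ 1) v = 0"
      unfolding orthonormal_expand[OF C v, symmetric] by simp
    moreover have "v \<in> W" using v B'(2) span_mono[of ?C B] by blast
    ultimately show "v \<in> {v \<in> W. \<exists>k. (S ^^ k) v = 0}" by blast
  qed
  then show ?thesis
    unfolding alg_mult_def S_def by (simp add: dim_span_orthonormal[OF C] del: dim_span)
qed

text \<open>Both sides are the trace of \<open>T^k\<close>: the weight of each \<open>b\<close> is
  its squared norm expanded in \<open>Basis\<close>, which is 1.\<close>

lemma eigenbasis_trace_funpow:
  fixes T :: "'a::euclidean_space \<Rightarrow> 'a"
  assumes T: "linear T" and B: "orthonormal_eigenbasis T UNIV B"
  shows "(\<Sum>b\<in>B. (b \<bullet> T b) ^ k) = (\<Sum>i\<in>Basis. i \<bullet> (T ^^ k) i)"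
proof -
  have B': "orthonormal B" "span B = UNIV" "\<And>b. b \<in> B \<Longrightarrow> T b = (b \<bullet> T b) *\<^sub>R b"
    using B by (auto simp: orthonormal_eigenbasis_def)
  have "i \<bullet> (T ^^ k) i = (\<Sum>b\<in>B. (b \<bullet> T b) ^ k * (i \<bullet> b)\<^sup>2)" for i
  proof -
    have "(T ^^ k) (\<Sum>b\<in>B. (i \<bullet> b) *\<^sub>R b) = (\<Sum>b\<in>B. ((i \<bullet> b) * (b \<bullet> T b) ^ k) *\<^sub>R b)"
      by (rule eigenbasis_funpow[OF T B'(3)])
    then have "(T ^^ k) i = (\<Sum>b\<in>B. ((i \<bullet> b) * (b \<bullet> T b) ^ k) *\<^sub>R b)"
      using orthonormal_expand[OF B'(1), of i] B'(2) by simp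
    then show ?thesis by (simp add: inner_sum_right power2_eq_square mult_ac)
  qed
  then have "(\<Sum>i\<in>Basis. i \<bullet> (T ^^ k) i) = (\<Sum>i\<in>Basis. \<Sum>b\<in>B. (b \<bullet> T b) ^ k * (i \<bullet> b)\<^sup>2)"
    by simp
  also have "\<dots> = (\<Sum>b\<in>B. (b \<bullet> T b) ^ k * (\<Sum>i\<in>Basis. (i \<bullet> b)\<^sup>2))"
    by (subst sum.swap) (simp add: sum_distrib_left)
  also have "\<dots> = (\<Sum>b\<in>B. (b \<bullet> T b) ^ k)"
  proof (rule sum.cong)
    fix b assume "b \<in> B"
    then have "b \<bullet> b = 1" using orthonormal_inner[OF B'(1)] by simp
    moreover have "b \<bullet> b = (\<Sum>i\<in>Basis. (i \<bullet> b)\<^sup>2)"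
      by (subst euclidean_inner) (simp add: power2_eq_square inner_commute)
    ultimately show "(b \<bullet> T b) ^ k * (\<Sum>i\<in>Basis. (i \<bullet> b)\<^sup>2) = (b \<bullet> T b) ^ k" by simp
  qed simp
  finally show ?thesis ..
qed

lemma eigenbasis_quadratic_form:
  assumes T: "linear T" and B: "orthonormal_eigenbasis T W B" and x: "x \<in> W"
  shows "x \<bullet> T x = (\<Sum>b\<in>B. (b \<bullet> T b) * (x \<bullet> b)\<^sup>2)"
    and "x \<bullet> x = (\<Sum>b\<in>B. (x \<bullet> b)\<^sup>2)"
proof -
  have B': "orthonormal B" "x \<in> span B" "\<And>b. b \<in> B \<Longrightarrow> T b = (b \<bullet> T b) *\<^sub>R b"
    using B x by (auto simp: orthonormal_eigenbasis_def)
  have "T x = (\<Sum>b\<in>B. ((x \<bullet> b) * (b \<bullet> T b)) *\<^sub>R b)"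
    using eigenbasis_funpow[OF T B'(3), of B 1 "\<lambda>b. x \<bullet> b"]
    by (simp flip: orthonormal_expand[OF B'(1,2)])
  then show "x \<bullet> T x = (\<Sum>b\<in>B. (b \<bullet> T b) * (x \<bullet> b)\<^sup>2)"
    by (simp add: inner_sum_right power2_eq_square mult_ac)
  show "x \<bullet> x = (\<Sum>b\<in>B. (x \<bullet> b)\<^sup>2)"
    using orthonormal_inner_expand[OF B'(1,2), of x] by (simp add: power2_eq_square inner_commute)
qed

text \<open>One half of the min-max principle: \<open>U\<close> meets the span of the eigenvectors
  with eigenvalue at least \<open>t\<close> only in 0, so the dimensions cannot exceed that of the
  space.\<close>

lemma eigenvalue_count_ge_dim:
  fixes T :: "'a::euclidean_space \<Rightarrow> 'a"
  assumes T: "linear T" and B: "orthonormal_eigenbasis T UNIV B"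
    and U: "subspace U" "\<And>x. x \<in> U \<Longrightarrow> x \<noteq> 0 \<Longrightarrow> x \<bullet> T x < t * (x \<bullet> x)"
  shows "dim U \<le> card {b \<in> B. b \<bullet> T b < t}"
proof -
  let ?C = "{b \<in> B. t \<le> b \<bullet> T b}"
  have B': "orthonormal B" "span B = UNIV" "\<And>b. b \<in> B \<Longrightarrow> T b = (b \<bullet> T b) *\<^sub>R b"
    using B by (auto simp: orthonormal_eigenbasis_def)
  have C: "orthonormal ?C" by (rule orthonormal_subset[OF B'(1)]) auto
  have "orthonormal_eigenbasis T (span ?C) ?C"
    using C B'(3) by (simp add: orthonormal_eigenbasis_def)
  note q = eigenbasis_quadratic_form[OF T this]
  have "x = 0" if "x \<in> U" "x \<in> span ?C" for x
  proof (rule ccontr)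
    assume "x \<noteq> 0"
    have "t * (x \<bullet> x) \<le> x \<bullet> T x"
      unfolding q[OF that(2)] sum_distrib_left by (rule sum_mono) (auto intro: mult_right_mono)
    then show False using U(2)[OF that(1) \<open>x \<noteq> 0\<close>] by simp
  qed
  then have "U \<inter> span ?C = {0}"
    using subspace_0[OF U(1)] span_zero by auto
  then have "dim (U \<inter> span ?C) = 0" by (simp only: dim_eq_0)
  then have "dim U + card ?C = dim {x + y |x y. x \<in> U \<and> y \<in> span ?C}"
    using dim_sums_Int[OF U(1) subspace_span[of ?C]] dim_span_orthonormal[OF C] by linarith
  also have "\<dots> \<le> DIM('a)" by (rule dim_subset_UNIV)
  also have "DIM('a) = card B"
    using dim_span_orthonormal[OF B'(1)] B'(2) by simp
  also have "\<dots> = card {b \<in> B. b \<bullet> T b < t} + card ?C"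
  proof -
    have "card ({b \<in> B. b \<bullet> T b < t} \<union> ?C) = card {b \<in> B. b \<bullet> T b < t} + card ?C"
      using orthonormal_finite[OF B'(1)] by (intro card_Un_disjoint) auto
    moreover have "{b \<in> B. b \<bullet> T b < t} \<union> ?C = B" by auto
    ultimately show ?thesis by simp
  qed
  finally show ?thesis by simp
qed

text \<open>The one-sided bound for \<open>T\<close> on \<open>U\<close> and for \<open>-T\<close>
  on \<open>U'\<close>; since the two dimensions fill the space, both bounds are attained.\<close>

lemma eigenvalue_count_eq_dim:
  fixes T :: "'a::euclidean_space \<Rightarrow> 'a"
  assumes T: "linear T" and B: "orthonormal_eigenbasis T UNIV B"
    and U: "subspace U" "\<And>x. x \<in> U \<Longrightarrow> x \<noteq> 0 \<Longrightarrow> x \<bullet> T x < t * (x \<bullet> x)"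
    and U': "subspace U'" "\<And>x. x \<in> U' \<Longrightarrow> x \<noteq> 0 \<Longrightarrow> t * (x \<bullet> x) < x \<bullet> T x"
    and dim: "dim U + dim U' = DIM('a)"
  shows "card {b \<in> B. b \<bullet> T b < t} = dim U"
proof -
  have B': "orthonormal B" "span B = UNIV" "\<And>b. b \<in> B \<Longrightarrow> T b = (b \<bullet> T b) *\<^sub>R b"
    using B by (auto simp: orthonormal_eigenbasis_def)
  have "dim U \<le> card {b \<in> B. b \<bullet> T b < t}"
    by (rule eigenvalue_count_ge_dim[OF T B U])
  moreover have "dim U' \<le> card {b \<in> B. b \<bullet> (- T b) < - t}"
  proof (rule eigenvalue_count_ge_dim)
    show "linear (\<lambda>x. - T x)" by (rule linear_compose_neg[OF T])
    show "orthonormal_eigenbasis (\<lambda>x. - T x) UNIV B"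
      using B by (auto simp: orthonormal_eigenbasis_def)
  qed (use U' in auto)
  then have "dim U' \<le> card {b \<in> B. t < b \<bullet> T b}" by simp
  moreover have "card {b \<in> B. b \<bullet> T b < t} + card {b \<in> B. t < b \<bullet> T b} \<le> DIM('a)"
  proof -
    have "card {b \<in> B. b \<bullet> T b < t} + card {b \<in> B. t < b \<bullet> T b}
        = card ({b \<in> B. b \<bullet> T b < t} \<union> {b \<in> B. t < b \<bullet> T b})"
      using orthonormal_finite[OF B'(1)] by (subst card_Un_disjoint) auto
    also have "\<dots> \<le> card B"
      using orthonormal_finite[OF B'(1)] by (intro card_mono) auto
    also have "card B = DIM('a)"
      using dim_span_orthonormal[OF B'(1)] B'(2) by simp
    finally show ?thesis .
  qed
  ultimately show ?thesis using dim by simp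
qed

section \<open>The operators of the filtration\<close>

lemma orth_proj:
  assumes W: "subspace W"
  shows orth_proj_in: "orth_proj W x \<in> W"
    and orth_proj_diff: "x - orth_proj W x \<in> orthogonal_comp W"
    and orth_proj_unique: "\<And>y. y \<in> W \<Longrightarrow> x - y \<in> orthogonal_comp W \<Longrightarrow> orth_proj W x = y"
proof -
  have uniq: "y = z" if "y \<in> W" "x - y \<in> orthogonal_comp W" "z \<in> W" "x - z \<in> orthogonal_comp W" for y z
  proof -
    have "(x - z) - (x - y) \<in> orthogonal_comp W"
      using that subspace_orthogonal_comp subspace_diff by blast
    then have "y - z \<in> W \<inter> orthogonal_comp W"
      using that subspace_diff[OF W] by simp
    then show ?thesis using orthogonal_Int_0[OF W] by simp
  qed
  have "x \<in> W + orthogonal_comp W" using subspace_sum_orthogonal_comp[OF W] by simp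
  then obtain y where "y \<in> W" "x - y \<in> orthogonal_comp W"
    by (force elim: set_plus_elim)
  then have "\<exists>!y. y \<in> W \<and> x - y \<in> orthogonal_comp W" using uniq by blast
  from theI'[OF this] show 1: "orth_proj W x \<in> W" and 2: "x - orth_proj W x \<in> orthogonal_comp W"
    unfolding orth_proj_def by blast+
  show "orth_proj W x = y" if "y \<in> W" "x - y \<in> orthogonal_comp W" for y
    using uniq[OF 1 2 that] .
qed

lemma orth_proj_UNIV: "orth_proj UNIV x = x"
  by (rule orth_proj_unique) simp_all

lemma linear_orth_proj:
  assumes W: "subspace W"
  shows "linear (orth_proj W)"
proof (rule linearI)
  fix x y
  have "x + y - (orth_proj W x + orth_proj W y)
      = (x - orth_proj W x) + (y - orth_proj W y)" by simp
  then show "orth_proj W (x + y) = orth_proj W x + orth_proj W y"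
    by (metis orth_proj_unique[OF W] orth_proj_in[OF W] orth_proj_diff[OF W]
        subspace_add[OF W] subspace_add[OF subspace_orthogonal_comp])
next
  fix c x
  have "c *\<^sub>R x - c *\<^sub>R orth_proj W x = c *\<^sub>R (x - orth_proj W x)"
    by (simp add: scaleR_diff_right)
  then show "orth_proj W (c *\<^sub>R x) = c *\<^sub>R orth_proj W x"
    by (metis orth_proj_unique[OF W] orth_proj_in[OF W] orth_proj_diff[OF W]
        subspace_mul[OF W] subspace_mul[OF subspace_orthogonal_comp])
qed

lemma inner_orth_proj:
  assumes "subspace W" "z \<in> W"
  shows "z \<bullet> orth_proj W x = z \<bullet> x"
proof -
  have "z \<bullet> (x - orth_proj W x) = 0"
    using orth_proj_diff[OF assms(1)] assms(2) by (auto simp: orthogonal_comp_def orthogonal_def)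
  then show ?thesis by (simp add: inner_diff_right)
qed

lemma dim_orthogonal_comp:
  fixes U :: "'a::euclidean_space set"
  assumes "subspace U"
  shows "dim U + dim (orthogonal_comp U) = DIM('a)"
  using dim_subspace_orthogonal_to_vectors[OF assms subspace_UNIV]
  by (simp add: orthogonal_comp_def add.commute)

section \<open>Gram matrices, their quadratic forms and kernels\<close>

lemma gram_mult_vec: "gram n A *v x = (\<Sum>k<n. (A k \<bullet> x) *\<^sub>R A k)"
proof -
  have "(gram n A *v x) $ a = (\<Sum>k<n. (A k \<bullet> x) *\<^sub>R A k) $ a" for a
  proof -
    have "(gram n A *v x) $ a = (\<Sum>b\<in>UNIV. \<Sum>k<n. A k $ a * A k $ b * x $ b)"
      by (simp add: matrix_vector_mult_def gram_def sum_distrib_right)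
    also have "\<dots> = (\<Sum>k<n. \<Sum>b\<in>UNIV. A k $ a * A k $ b * x $ b)"
      by (rule sum.swap)
    also have "\<dots> = (\<Sum>k<n. (A k \<bullet> x) * A k $ a)"
      by (simp add: inner_vec_def sum_distrib_left sum_distrib_right mult_ac)
    finally show ?thesis by simp
  qed
  then show ?thesis by (simp add: vec_eq_iff)
qed

lemma inner_gram: "y \<bullet> (gram n A *v x) = (\<Sum>k<n. (A k \<bullet> y) * (A k \<bullet> x))"
  by (simp add: gram_mult_vec inner_sum_right inner_commute mult.commute)

lemma inner_gram_commute: "y \<bullet> (gram n A *v x) = x \<bullet> (gram n A *v y)"
  by (simp add: inner_gram mult.commute)

lemma inner_gram_self: "x \<bullet> (gram n A *v x) = (\<Sum>k<n. (A k \<bullet> x)\<^sup>2)"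
  by (simp add: inner_gram power2_eq_square)

lemma inner_gram_nonneg: "x \<bullet> (gram n A *v x) \<ge> 0"
  unfolding inner_gram_self by (intro sum_nonneg) simp

lemma inner_gram_eq_0_iff: "x \<bullet> (gram n A *v x) = 0 \<longleftrightarrow> x \<in> mat_ker n A"
  unfolding inner_gram_self by (subst sum_nonneg_eq_0_iff) (auto simp: mat_ker_def)

lemma gram_mult_vec_eq_0_iff: "gram n A *v x = 0 \<longleftrightarrow> x \<in> mat_ker n A"
proof
  assume "gram n A *v x = 0"
  then show "x \<in> mat_ker n A" by (simp flip: inner_gram_eq_0_iff)
qed (simp add: gram_mult_vec mat_ker_def)

lemma subspace_mat_ker: "subspace (mat_ker n A)"
  by (auto simp: mat_ker_def subspace_def inner_add_right)

lemma inner_calA: "x \<bullet> (calA r N A h *v y) = (\<Sum>i\<le>r. h ^ (2 * i) * (x \<bullet> (gram (N i) (A i) *v y)))"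
proof -
  have "(\<Sum>i\<in>I. h ^ (2 * i) *\<^sub>R gram (N i) (A i)) *v y
      = (\<Sum>i\<in>I. h ^ (2 * i) *\<^sub>R (gram (N i) (A i) *v y))" if "finite I" for I
    using that
    by (induction I) (simp_all add: matrix_vector_mult_add_rdistrib scaleR_matrix_vector_assoc)
  then show ?thesis by (simp add: calA_def inner_sum_right)
qed

text \<open>Positive semidefiniteness turns orthogonality to the new image into membership in the
  new kernel. That \<open>Vsp N A j\<close> is a subspace is carried along because forming the next
  sum needs it.\<close>

lemma Vsp_orthogonal_comp:
  "subspace (Vsp N A j) \<and> orthogonal_comp (Vsp N A j) = (\<Inter>i\<in>{..j}. mat_ker (N i) (A i))"
proof (induction j)
  case 0
  have "subspace (Vsp N A 0)"
    by (simp add: linear_subspace_image matrix_vector_mul_linear)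
  moreover have "orthogonal_comp (Vsp N A 0) = mat_ker (N 0) (A 0)"
  proof (intro equalityI subsetI)
    fix x assume "x \<in> orthogonal_comp (Vsp N A 0)"
    then show "x \<in> mat_ker (N 0) (A 0)"
      by (auto simp: orthogonal_comp_def orthogonal_def inner_commute simp flip: inner_gram_eq_0_iff)
  next
    fix x assume "x \<in> mat_ker (N 0) (A 0)"
    then have "gram (N 0) (A 0) *v x = 0" by (simp add: gram_mult_vec_eq_0_iff)
    then have "x \<bullet> (gram (N 0) (A 0) *v y) = 0" for y
      by (simp add: inner_gram_commute[of x])
    then show "x \<in> orthogonal_comp (Vsp N A 0)"
      by (auto simp: orthogonal_comp_def orthogonal_def inner_commute)
  qed
  ultimately show ?case by simp
next
  case (Suc j)
  let ?V = "Vsp N A j" and ?G = "\<lambda>x. gram (N (Suc j)) (A (Suc j)) *v x"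
  let ?W = "orthogonal_comp ?V"
  let ?Im = "(\<lambda>x. orth_proj ?W (?G x)) ` ?W"
  have W: "subspace ?W" by (rule subspace_orthogonal_comp)
  have "linear (orth_proj ?W \<circ> ?G)"
    by (rule linear_compose[OF matrix_vector_mul_linear linear_orth_proj[OF W]])
  then have Im: "subspace ?Im"
    using linear_subspace_image[OF _ W] by (simp add: o_def)
  have V: "Vsp N A (Suc j) = ?V + ?Im" by simp
  have "?V + ?Im = {x + y |x y. x \<in> ?V \<and> y \<in> ?Im}" by (auto simp only: set_plus_def)
  then have "subspace (?V + ?Im)"
    using subspace_sums[OF Suc[THEN conjunct1] Im] by (simp only:)
  moreover have "orthogonal_comp (?V + ?Im) = ?W \<inter> mat_ker (N (Suc j)) (A (Suc j))"
  proof (intro equalityI subsetI)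
    fix x assume x: "x \<in> orthogonal_comp (?V + ?Im)"
    have "?V \<subseteq> ?V + ?Im"
      using set_plus_intro[OF _ subspace_0[OF Im], of _ ?V] by auto
    moreover have "?Im \<subseteq> ?V + ?Im"
      using set_plus_intro[OF subspace_0[OF Suc[THEN conjunct1]], of _ ?Im] by auto
    ultimately have "x \<in> ?W" "x \<in> orthogonal_comp ?Im"
      using x orthogonal_comp_anti_mono by blast+
    \<comment> \<open>The vector is tested against its own image; as \<open>x\<close> lies in
      \<open>?W\<close>, the projection drops out and the form vanishes at \<open>x\<close>.\<close>
    then have "x \<bullet> orth_proj ?W (?G x) = 0"
      by (auto simp: orthogonal_comp_def orthogonal_def inner_commute)
    then have "x \<bullet> ?G x = 0"
      using inner_orth_proj[OF W \<open>x \<in> ?W\<close>] by simp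
    then show "x \<in> ?W \<inter> mat_ker (N (Suc j)) (A (Suc j))"
      using \<open>x \<in> ?W\<close> by (simp add: inner_gram_eq_0_iff)
  next
    fix x assume x: "x \<in> ?W \<inter> mat_ker (N (Suc j)) (A (Suc j))"
    then have "?G x = 0" by (simp add: gram_mult_vec_eq_0_iff)
    then have "x \<bullet> orth_proj ?W (?G y) = 0" for y
      using x by (simp add: inner_orth_proj[OF W] inner_gram_commute[of x])
    moreover have "x \<bullet> v = 0" if "v \<in> ?V" for v
      using x that by (auto simp: orthogonal_comp_def orthogonal_def inner_commute)
    ultimately show "x \<in> orthogonal_comp (?V + ?Im)"
      by (auto simp: orthogonal_comp_def orthogonal_def inner_commute inner_add_right elim!: set_plus_elim)
  qed
  ultimately show ?case
    unfolding V using Suc by (auto simp: atMost_Suc)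
qed

lemma Wdom_eq: "Wdom N A j = (\<Inter>i\<in>{..<j}. mat_ker (N i) (A i))"
proof (cases j)
  case (Suc k)
  then show ?thesis
    using Vsp_orthogonal_comp[of N A k] by (simp add: Wdom_def lessThan_Suc_atMost)
qed (simp add: Wdom_def)

lemma Wdom_Suc: "Wdom N A (Suc j) = orthogonal_comp (Vsp N A j)"
  by (simp add: Wdom_def)

lemma subspace_Wdom: "subspace (Wdom N A j)"
  unfolding Wdom_eq by (intro subspace_Inter) (auto simp: subspace_mat_ker)

lemma Ahat_eq: "Ahat N A j x = orth_proj (Wdom N A j) (gram (N j) (A j) *v x)"
  by (simp add: Ahat_def Wdom_def orth_proj_UNIV)

lemma linear_Ahat: "linear (Ahat N A j)"
  using linear_compose[OF matrix_vector_mul_linear[of "gram (N j) (A j)"] linear_orth_proj[OF subspace_Wdom[of N A j]]]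
  by (simp add: Ahat_eq[abs_def] o_def)

lemma Ahat_in_Wdom: "Ahat N A j x \<in> Wdom N A j"
  unfolding Ahat_eq by (rule orth_proj_in[OF subspace_Wdom])

lemma inner_Ahat: "x \<in> Wdom N A j \<Longrightarrow> x \<bullet> Ahat N A j y = x \<bullet> (gram (N j) (A j) *v y)"
  unfolding Ahat_eq by (rule inner_orth_proj[OF subspace_Wdom])

lemma Ahat_eigenbasis: "\<exists>B. orthonormal_eigenbasis (Ahat N A j) (Wdom N A j) B"
proof (rule symmetric_orthonormal_eigenbasis[OF linear_Ahat subspace_Wdom Ahat_in_Wdom])
  fix x y assume xy: "x \<in> Wdom N A j" "y \<in> Wdom N A j"
  have "x \<bullet> Ahat N A j y = y \<bullet> (gram (N j) (A j) *v x)"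
    unfolding inner_Ahat[OF xy(1)] by (rule inner_gram_commute)
  then show "x \<bullet> Ahat N A j y = Ahat N A j x \<bullet> y"
    using inner_Ahat[OF xy(2)] by (simp add: inner_commute)
qed

lemma Ahat_eigenvalue_nonneg:
  assumes "orthonormal_eigenbasis (Ahat N A j) (Wdom N A j) B" "b \<in> B"
  shows "b \<bullet> Ahat N A j b \<ge> 0"
proof -
  have "b \<in> Wdom N A j" using assms span_base by (auto simp: orthonormal_eigenbasis_def)
  then show ?thesis by (simp add: inner_Ahat inner_gram_nonneg)
qed

text \<open>On \<open>Wdom N A j\<close> the form of \<open>Ahat N A j\<close> is the Gram form of
  \<open>A j\<close>, so its zero eigenvectors span \<open>Wdom N A j\<close> intersected with the
  kernel of \<open>A j\<close>, which is the next domain.\<close>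

lemma card_Ahat_eigenbasis:
  assumes B: "orthonormal_eigenbasis (Ahat N A j) (Wdom N A j) B"
  shows "card B = dim (Wdom N A j)"
    and "card {b \<in> B. b \<bullet> Ahat N A j b = 0} = dim (Wdom N A (Suc j))"
proof -
  have B': "orthonormal B" "span B = Wdom N A j" "\<And>b. b \<in> B \<Longrightarrow> Ahat N A j b = (b \<bullet> Ahat N A j b) *\<^sub>R b"
    using B by (auto simp: orthonormal_eigenbasis_def)
  show "card B = dim (Wdom N A j)"
    using dim_span_orthonormal[OF B'(1)] B'(2) by simp
  let ?C = "{b \<in> B. b \<bullet> Ahat N A j b = 0}"
  have Suc: "Wdom N A (Suc j) = Wdom N A j \<inter> mat_ker (N j) (A j)"
    by (auto simp: Wdom_eq lessThan_Suc)
  have "span ?C = Wdom N A (Suc j)"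
  proof (intro equalityI subsetI)
    have "?C \<subseteq> Wdom N A (Suc j)"
    proof
      fix b assume b: "b \<in> ?C"
      then have "b \<in> Wdom N A j" using B'(2) span_base by blast
      then show "b \<in> Wdom N A (Suc j)"
        using b inner_Ahat[of b N A j b] by (simp add: Suc inner_gram_eq_0_iff)
    qed
    then show "x \<in> Wdom N A (Suc j)" if "x \<in> span ?C" for x
      using that span_minimal[OF _ subspace_Wdom] by blast
  next
    fix x assume "x \<in> Wdom N A (Suc j)"
    then have x: "x \<in> Wdom N A j" "gram (N j) (A j) *v x = 0"
      by (auto simp: Suc gram_mult_vec_eq_0_iff)
    show "x \<in> span ?C"
    proof (rule orthonormal_mem_span_subset[OF B'(1)])
      fix b assume b: "b \<in> B - ?C"
      have "(b \<bullet> Ahat N A j b) * (x \<bullet> b) = x \<bullet> Ahat N A j b"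
        using b by (subst (2) B'(3)) auto
      also have "\<dots> = 0"
        using inner_Ahat[OF x(1)] x(2) by (simp add: inner_gram_commute[of x])
      finally show "x \<bullet> b = 0" using b by simp
    qed (use x B'(2) in auto)
  qed
  moreover have "orthonormal ?C" by (rule orthonormal_subset[OF B'(1)]) auto
  ultimately show "card ?C = dim (Wdom N A (Suc j))"
    using dim_span_orthonormal by metis
qed

lemma ndim_add_dim_Wdom:
  fixes A :: "nat \<Rightarrow> nat \<Rightarrow> real^'d"
  shows "ndim N A j + dim (Wdom N A (Suc j)) = CARD('d)"
  using dim_orthogonal_comp[of "Vsp N A j"] Vsp_orthogonal_comp[of N A j]
  by (simp add: ndim_def Wdom_Suc)

lemma nincr_eq: "nincr N A j = dim (Wdom N A j) - dim (Wdom N A (Suc j))"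
proof (cases j)
  case 0
  then show ?thesis using ndim_add_dim_Wdom[of N A 0] by (simp add: nincr_def Wdom_def)
next
  case (Suc k)
  then show ?thesis
    using ndim_add_dim_Wdom[of N A k] ndim_add_dim_Wdom[of N A j] by (simp add: nincr_def)
qed

lemma real_analytic_calA_funpow:
  fixes A :: "nat \<Rightarrow> nat \<Rightarrow> real^'d"
  shows
  "real_analytic_at (\<lambda>h. (((*v) (calA r N A h)) ^^ k) v $ a) x"
proof (induction k arbitrary: a)
  case 0
  then show ?case by (simp add: real_analytic_at_const)
next
  case (Suc k)
  have "real_analytic_at (\<lambda>h. calA r N A h $ a $ b) x" for b
    unfolding calA_def sum_component vector_scaleR_component real_scaleR_def
    by (intro real_analytic_at_sum real_analytic_at_mult real_analytic_at_power
        real_analytic_at_ident real_analytic_at_const)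
  then have "real_analytic_at (\<lambda>h. \<Sum>b\<in>UNIV. calA r N A h $ a $ b * (((*v) (calA r N A h)) ^^ k) v $ b) x"
    by (intro real_analytic_at_sum real_analytic_at_mult Suc.IH)
  moreover have "(((*v) C) ^^ Suc k) v $ a = (\<Sum>b\<in>UNIV. C $ a $ b * (((*v) C) ^^ k) v $ b)"
    for C :: "real^'d^'d"
    by (simp add: matrix_vector_mult_def)
  ultimately show ?case by (simp only:)
qed

lemma calA_eigenbasis: "\<exists>B. orthonormal_eigenbasis ((*v) (calA r N A h)) UNIV B"
proof (rule symmetric_orthonormal_eigenbasis)
  fix x y
  have "x \<bullet> (calA r N A h *v y) = y \<bullet> (calA r N A h *v x)"
    by (simp only: inner_calA inner_gram_commute[of x])
  then show "x \<bullet> (calA r N A h *v y) = (calA r N A h *v x) \<bullet> y"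
    by (simp add: inner_commute)
qed (auto simp: matrix_vector_mul_linear)

section \<open>Quadratic forms at small parameters\<close>

lemma gram_form_bounded:
  fixes r :: nat
  shows "\<exists>C\<ge>0. \<forall>i\<le>r. \<forall>x. x \<bullet> (gram (N i) (A i) *v x) \<le> C * (x \<bullet> x)"
proof -
  define C where "C = (\<Sum>i\<le>r. \<Sum>k<N i. (norm (A i k))\<^sup>2)"
  have "x \<bullet> (gram (N i) (A i) *v x) \<le> C * (x \<bullet> x)" if "i \<le> r" for i x
  proof -
    have "x \<bullet> (gram (N i) (A i) *v x) \<le> (\<Sum>k<N i. (norm (A i k))\<^sup>2 * (x \<bullet> x))"
      unfolding inner_gram_self
    proof (rule sum_mono)
      fix k
      have "(A i k \<bullet> x)\<^sup>2 \<le> (A i k \<bullet> A i k) * (x \<bullet> x)" by (rule Cauchy_Schwarz_ineq)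
      then show "(A i k \<bullet> x)\<^sup>2 \<le> (norm (A i k))\<^sup>2 * (x \<bullet> x)" by (simp add: dot_square_norm)
    qed
    also have "\<dots> = (\<Sum>k<N i. (norm (A i k))\<^sup>2) * (x \<bullet> x)" by (simp add: sum_distrib_right)
    also have "\<dots> \<le> C * (x \<bullet> x)"
      unfolding C_def
      by (intro mult_right_mono member_le_sum[of i "{..r}" "\<lambda>i. \<Sum>k<N i. (norm (A i k))\<^sup>2"])
        (use that in \<open>auto intro: sum_nonneg\<close>)
    finally show ?thesis .
  qed
  moreover have "C \<ge> 0" unfolding C_def by (intro sum_nonneg) auto
  ultimately show ?thesis by blast
qed

text \<open>The sum of these forms vanishes only on \<open>Wdom N A k\<close>; on the unit sphere of
  the complement it has a positive minimum by compactness. If that sphere is empty, the complement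
  is 0 and the constant 1 serves.\<close>

lemma gram_forms_coercive:
  "\<exists>c>0. \<forall>y\<in>orthogonal_comp (Wdom N A k). c * (y \<bullet> y) \<le> (\<Sum>i<k. y \<bullet> (gram (N i) (A i) *v y))"
proof -
  define Q where "Q y = (\<Sum>i<k. y \<bullet> (gram (N i) (A i) *v y))" for y
  let ?U = "orthogonal_comp (Wdom N A k)"
  let ?K = "?U \<inter> sphere 0 1"
  have U: "subspace ?U" by (rule subspace_orthogonal_comp)
  have pos: "Q y > 0" if "y \<in> ?U" "y \<noteq> 0" for y
  proof -
    have "y \<notin> Wdom N A k" using that orthogonal_Int_0[OF subspace_Wdom[of N A k]] by blast
    then obtain i where i: "i < k" "y \<notin> mat_ker (N i) (A i)" by (auto simp: Wdom_eq)
    then have "y \<bullet> (gram (N i) (A i) *v y) > 0"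
      using inner_gram_nonneg[of y "N i" "A i"] by (simp add: less_le inner_gram_eq_0_iff eq_commute[of 0])
    then show ?thesis
      unfolding Q_def using i(1) by (intro sum_pos2[of _ i]) (auto simp: inner_gram_nonneg)
  qed
  have scale: "Q (a *\<^sub>R y) = a\<^sup>2 * Q y" for a y
    by (simp add: Q_def matrix_vector_mult_scaleR sum_distrib_left power2_eq_square mult.assoc)
  show ?thesis
  proof (cases "?K = {}")
    case True
    have "y = 0" if "y \<in> ?U" for y
    proof (rule ccontr)
      assume "y \<noteq> 0"
      then have "y /\<^sub>R norm y \<in> ?K" using that subspace_mul[OF U] by simp
      then show False using True by blast
    qed
    then have "1 * (y \<bullet> y) \<le> Q y" if "y \<in> ?U" for y
    proof -
      have "y = 0" using \<open>\<And>y. y \<in> ?U \<Longrightarrow> y = 0\<close> that by blast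
      then show ?thesis by (simp add: Q_def)
    qed
    then show ?thesis unfolding Q_def using zero_less_one by blast
  next
    case False
    have "compact ?K" using closed_subspace[OF U] by (simp add: closed_Int_compact)
    moreover have "continuous_on ?K Q"
      unfolding Q_def
      by (intro continuous_intros linear_continuous_on_compose[OF continuous_on_id matrix_vector_mul_linear])
    ultimately obtain v where v: "v \<in> ?K" "\<And>y. y \<in> ?K \<Longrightarrow> Q v \<le> Q y"
      using continuous_attains_inf[OF _ False] by metis
    have "v \<noteq> 0" using v(1) by auto
    then have "Q v > 0" using v(1) by (intro pos) auto
    moreover have "Q v * (y \<bullet> y) \<le> Q y" if "y \<in> ?U" for y
    proof (cases "y = 0")
      case True
      then show ?thesis by (simp add: Q_def)
    next
      case False
      then have "Q v \<le> Q (y /\<^sub>R norm y)"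
        using that subspace_mul[OF U] by (intro v(2)) simp
      also have "\<dots> = Q y / (y \<bullet> y)"
        unfolding scale by (simp add: dot_square_norm divide_inverse power_inverse mult.commute)
      finally show ?thesis using False by (simp add: field_simps)
    qed
    ultimately show ?thesis unfolding Q_def by blast
  qed
qed

text \<open>The difference of the two sides is \<open>a^2 + (a + \<delta> b)^2 / \<delta>\<close>.
  The term in \<open>b\<close> loses only the factor \<open>1 - \<delta>\<close>; the cross term is
  charged to \<open>a\<close>.\<close>

lemma square_add_ge:
  fixes a b \<delta> :: real
  assumes "\<delta> > 0"
  shows "(1 - \<delta>) * b\<^sup>2 - a\<^sup>2 / \<delta> \<le> (a + b)\<^sup>2"
proof -
  have "(a + b)\<^sup>2 - ((1 - \<delta>) * b\<^sup>2 - a\<^sup>2 / \<delta>) = a\<^sup>2 + (a + \<delta> * b)\<^sup>2 / \<delta>"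
    using assms by (simp add: power2_eq_square field_simps)
  then show ?thesis using assms by (smt (verit) zero_le_power2 divide_nonneg_pos)
qed

lemma gram_form_add_ge:
  assumes "\<delta> > 0"
  shows "(1 - \<delta>) * (z \<bullet> (gram n A *v z)) - (y \<bullet> (gram n A *v y)) / \<delta> \<le> (y + z) \<bullet> (gram n A *v (y + z))"
proof -
  have "(\<Sum>k<n. (1 - \<delta>) * (A k \<bullet> z)\<^sup>2 - (A k \<bullet> y)\<^sup>2 / \<delta>) \<le> (\<Sum>k<n. (A k \<bullet> y + A k \<bullet> z)\<^sup>2)"
    by (intro sum_mono square_add_ge assms)
  then show ?thesis
    unfolding inner_gram_self by (simp add: inner_add_right sum_subtractf sum_distrib_left sum_divide_distrib)
qed

section \<open>Comparison of forms at a threshold that is no eigenvalue of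
  \<open>Ahat N A k\<close>\<close>

context
  fixes r k :: nat and N :: "nat \<Rightarrow> nat" and A :: "nat \<Rightarrow> nat \<Rightarrow> real^'d"
    and B :: "(real^'d) set" and \<mu> :: real
  assumes k: "k \<le> r"
    and B: "orthonormal_eigenbasis (Ahat N A k) (Wdom N A k) B"
    and \<mu>: "\<mu> > 0" "\<And>b. b \<in> B \<Longrightarrow> b \<bullet> Ahat N A k b \<noteq> \<mu>"
begin

lemma low_space:
  shows "orthonormal {b \<in> B. b \<bullet> Ahat N A k b < \<mu>}"
    and "span {b \<in> B. b \<bullet> Ahat N A k b < \<mu>} \<subseteq> Wdom N A k"
  using B orthonormal_subset[of B "{b \<in> B. b \<bullet> Ahat N A k b < \<mu>}"]
    span_mono[of "{b \<in> B. b \<bullet> Ahat N A k b < \<mu>}" B]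
  unfolding orthonormal_eigenbasis_def by auto

text \<open>The vectors lie in \<open>Wdom N A k\<close>, where the forms with index below
  \<open>k\<close> vanish; the \<open>k\<close>-th form stays below \<open>\<mu>\<close>, and the
  later ones carry an extra factor \<open>h^2\<close>.\<close>

lemma calA_form_less:
  "\<forall>\<^sub>F h in at_right 0. \<forall>x\<in>span {b \<in> B. b \<bullet> Ahat N A k b < \<mu>}. x \<noteq> 0 \<longrightarrow>
     x \<bullet> (calA r N A h *v x) < \<mu> * h ^ (2 * k) * (x \<bullet> x)"
proof -
  let ?C = "{b \<in> B. b \<bullet> Ahat N A k b < \<mu>}"
  have finB: "finite B" using B orthonormal_finite by (auto simp: orthonormal_eigenbasis_def)
  \<comment> \<open>The largest eigenvalue below \<open>\<mu>\<close>; the inserted 0 covers the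
    case of none and stays below \<open>\<mu>\<close> because \<open>\<mu> > 0\<close>.\<close>
  define m where "m = Max (insert 0 ((\<lambda>b. b \<bullet> Ahat N A k b) ` ?C))"
  have m: "m < \<mu>" "\<And>b. b \<in> ?C \<Longrightarrow> b \<bullet> Ahat N A k b \<le> m"
    using finB \<mu>(1) by (auto simp: m_def)
  obtain C where C: "C \<ge> 0" "\<And>i x. i \<le> r \<Longrightarrow> x \<bullet> (gram (N i) (A i) *v x) \<le> C * (x \<bullet> x)"
    using gram_form_bounded[of r N A] by blast
  have "((\<lambda>h. m + h\<^sup>2 * (real (Suc r) * C)) \<longlongrightarrow> m + 0\<^sup>2 * (real (Suc r) * C)) (at_right 0)"
    by (intro tendsto_intros)
  then have "\<forall>\<^sub>F h in at_right 0. m + h\<^sup>2 * (real (Suc r) * C) < \<mu>"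
    by (rule order_tendstoD(2)) (use m(1) in simp)
  moreover have "\<forall>\<^sub>F h in at_right 0. (0::real) < h \<and> h < 1"
    by (auto simp: eventually_at_right_field intro: exI[of _ 1])
  ultimately show ?thesis
  proof eventually_elim
    case (elim h)
    show ?case
    proof (intro ballI impI)
      fix x assume xC: "x \<in> span ?C" and x0: "x \<noteq> 0"
      have xW: "x \<in> Wdom N A k" using low_space(2) xC by blast
      have eb: "orthonormal_eigenbasis (Ahat N A k) (span ?C) ?C"
        using B low_space(1) by (auto simp: orthonormal_eigenbasis_def)
      have qk: "x \<bullet> (gram (N k) (A k) *v x) \<le> m * (x \<bullet> x)"
        unfolding inner_Ahat[OF xW, symmetric] eigenbasis_quadratic_form[OF linear_Ahat eb xC] sum_distrib_left
        by (intro sum_mono mult_right_mono m(2)) auto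
      \<comment> \<open>Every index is granted the slack \<open>h^2 * C\<close>, which makes the
        total simply \<open>m + h^2 (r+1) C\<close>.\<close>
      have "x \<bullet> (calA r N A h *v x) \<le> (\<Sum>i\<le>r. h ^ (2 * k) * ((if i = k then m else 0) + h\<^sup>2 * C) * (x \<bullet> x))"
        unfolding inner_calA
      proof (rule sum_mono)
        fix i assume i: "i \<in> {..r}"
        consider "i < k" | "i = k" | "i > k" by linarith
        then show "h ^ (2 * i) * (x \<bullet> (gram (N i) (A i) *v x))
            \<le> h ^ (2 * k) * ((if i = k then m else 0) + h\<^sup>2 * C) * (x \<bullet> x)"
        proof cases
          case 1
          then have "x \<bullet> (gram (N i) (A i) *v x) = 0"
            using xW by (simp add: Wdom_eq inner_gram_eq_0_iff)
          then show ?thesis using 1 C(1) elim by simp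
        next
          case 2
          have "h ^ (2 * k) * (x \<bullet> (gram (N k) (A k) *v x)) \<le> h ^ (2 * k) * ((m + h\<^sup>2 * C) * (x \<bullet> x))"
            using qk C(1) by (intro mult_left_mono) (auto simp: distrib_right add_increasing2)
          then show ?thesis using 2 by (simp add: mult.assoc)
        next
          case 3
          have "h ^ (2 * i) \<le> h ^ (2 * k + 2)"
            using elim 3 by (intro power_decreasing) auto
          then have "h ^ (2 * i) * (x \<bullet> (gram (N i) (A i) *v x)) \<le> h ^ (2 * k + 2) * (C * (x \<bullet> x))"
            using C i elim by (intro mult_mono) (auto simp: inner_gram_nonneg)
          then show ?thesis using 3 by (simp add: power_add mult_ac power2_eq_square)
        qed
      qed
      also have "\<dots> = h ^ (2 * k) * (x \<bullet> x) * (\<Sum>i\<le>r. (if i = k then m else 0) + h\<^sup>2 * C)"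
        by (simp add: sum_distrib_left mult_ac)
      also have "(\<Sum>i\<le>r. (if i = k then m else 0) + h\<^sup>2 * C) = m + h\<^sup>2 * (real (Suc r) * C)"
        using k by (simp add: sum.distrib mult_ac)
      also have "h ^ (2 * k) * (x \<bullet> x) * (m + h\<^sup>2 * (real (Suc r) * C)) < h ^ (2 * k) * (x \<bullet> x) * \<mu>"
        using elim x0 by (intro mult_strict_left_mono) auto
      finally show "x \<bullet> (calA r N A h *v x) < \<mu> * h ^ (2 * k) * (x \<bullet> x)"
        by (simp add: mult_ac)
    qed
  qed
qed

text \<open>Here \<open>x\<close> has a part \<open>y\<close> orthogonal to
  \<open>Wdom N A k\<close>, which interferes with the \<open>k\<close>-th form. The forms of lower
  index control \<open>y\<close> with weights at least \<open>h^(2k-2)\<close>, large enough to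
  absorb the cross terms.\<close>

lemma calA_form_greater:
  "\<forall>\<^sub>F h in at_right 0. \<forall>x\<in>orthogonal_comp (span {b \<in> B. b \<bullet> Ahat N A k b < \<mu>}). x \<noteq> 0 \<longrightarrow>
     \<mu> * h ^ (2 * k) * (x \<bullet> x) < x \<bullet> (calA r N A h *v x)"
proof -
  let ?C = "{b \<in> B. b \<bullet> Ahat N A k b < \<mu>}"
  let ?q = "\<lambda>i x. x \<bullet> (gram (N i) (A i) *v x)"
  have finB: "finite B" using B orthonormal_finite by (auto simp: orthonormal_eigenbasis_def)
  \<comment> \<open>A number above \<open>\<mu>\<close> and below or equal to all eigenvalues above
    \<open>\<mu>\<close>; \<open>\<mu> + 1\<close> keeps it defined when there are none.\<close>
  define m where "m = Min (insert (\<mu> + 1) ((\<lambda>b. b \<bullet> Ahat N A k b) ` (B - ?C)))"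
  have "\<mu> < b \<bullet> Ahat N A k b" if "b \<in> B - ?C" for b
    using that \<mu>(2)[of b] by auto
  then have m: "\<mu> < m"
    unfolding m_def using finB by (subst Min_gr_iff) auto
  have m_le: "m \<le> b \<bullet> Ahat N A k b" if "b \<in> B - ?C" for b
    unfolding m_def using finB that by (intro Min_le) auto
  \<comment> \<open>Chosen so that after the loss of the factor \<open>1 - \<delta>\<close> the
    constant for \<open>z\<close> is the midpoint of \<open>\<mu>\<close> and \<open>m\<close>,
    still above \<open>\<mu>\<close>.\<close>
  define \<delta> where "\<delta> = (m - \<mu>) / (2 * m)"
  have \<delta>: "\<delta> > 0" "1 - \<delta> > 0" "(1 - \<delta>) * m = (m + \<mu>) / 2"
    using m \<mu>(1) by (auto simp: \<delta>_def field_simps)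
  obtain C where C: "C \<ge> 0" "\<And>i x. i \<le> r \<Longrightarrow> ?q i x \<le> C * (x \<bullet> x)"
    using gram_form_bounded[of r N A] by blast
  obtain c where c: "c > 0" "\<And>y. y \<in> orthogonal_comp (Wdom N A k) \<Longrightarrow> c * (y \<bullet> y) \<le> (\<Sum>i<k. ?q i y)"
    using gram_forms_coercive[of N A k] by blast
  \<comment> \<open>What the lower forms must yield per unit of \<open>y \<bullet> y\<close>:
    \<open>C / \<delta>\<close> pays for the cross terms, and \<open>\<mu> + 1\<close> keeps the
    final inequality strict.\<close>
  define K where "K = \<mu> + 1 + C / \<delta>"
  have K: "K \<ge> 0" using \<mu>(1) C(1) \<delta>(1) by (simp add: K_def)
  have "((\<lambda>h. h\<^sup>2 * K) \<longlongrightarrow> 0\<^sup>2 * K) (at_right 0)"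
    by (intro tendsto_intros)
  then have "\<forall>\<^sub>F h in at_right 0. h\<^sup>2 * K < c"
    by (rule order_tendstoD(2)) (use c(1) in simp)
  moreover have "\<forall>\<^sub>F h in at_right 0. (0::real) < h \<and> h < 1"
    by (auto simp: eventually_at_right_field intro: exI[of _ 1])
  ultimately show ?thesis
  proof eventually_elim
    case (elim h)
    show ?case
    proof (intro ballI impI)
      fix x assume xC: "x \<in> orthogonal_comp (span ?C)" and x0: "x \<noteq> 0"
      define z y where "z = orth_proj (Wdom N A k) x" and "y = x - z"
      have z: "z \<in> Wdom N A k" unfolding z_def by (rule orth_proj_in[OF subspace_Wdom])
      have y: "y \<in> orthogonal_comp (Wdom N A k)"
        unfolding y_def z_def by (rule orth_proj_diff[OF subspace_Wdom])
      have xyz: "x = y + z" by (simp add: y_def)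
      have yw: "y \<bullet> w = 0" if "w \<in> Wdom N A k" for w
        using y that by (auto simp: orthogonal_comp_def orthogonal_def inner_commute)
      have xx: "x \<bullet> x = y \<bullet> y + z \<bullet> z"
        using yw[OF z] by (simp add: xyz inner_add_left inner_add_right inner_commute)
      \<comment> \<open>The low eigenvectors lie in \<open>Wdom N A k\<close>, to which
        \<open>y\<close> is orthogonal, so \<open>z\<close> inherits orthogonality to them from
        \<open>x\<close>.\<close>
      have zb: "z \<bullet> b = 0" if "b \<in> ?C" for b
      proof -
        have "x \<bullet> b = 0"
          using xC span_base[OF that] by (auto simp: orthogonal_comp_def orthogonal_def inner_commute)
        moreover have "y \<bullet> b = 0"
          using low_space(2) span_base[OF that] by (intro yw) blast
        ultimately show ?thesis by (simp add: xyz inner_add_left)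
      qed
      have qz: "m * (z \<bullet> z) \<le> ?q k z"
        unfolding inner_Ahat[OF z, symmetric] eigenbasis_quadratic_form[OF linear_Ahat B z] sum_distrib_left
      proof (rule sum_mono)
        fix b assume "b \<in> B"
        then show "m * (z \<bullet> b)\<^sup>2 \<le> (b \<bullet> Ahat N A k b) * (z \<bullet> b)\<^sup>2"
          using zb[of b] m_le[of b] by (cases "b \<in> ?C") (auto intro: mult_right_mono)
      qed
      have qx: "?q i x = ?q i y" if "i < k" for i
      proof -
        have "gram (N i) (A i) *v z = 0"
          using z that by (simp add: Wdom_eq gram_mult_vec_eq_0_iff)
        then show ?thesis
          by (simp add: xyz matrix_vector_right_distrib inner_add_left inner_gram_commute[of z])
      qed
      \<comment> \<open>For \<open>i < k\<close> one has \<open>h^(2i) \<ge> h^(2k) / h^2\<close>,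
        and \<open>h^2 * K < c\<close> converts coercivity into the factor \<open>K\<close>. For
        \<open>k = 0\<close> the part \<open>y\<close> is 0 and both sides vanish.\<close>
      have low: "h ^ (2 * k) * (K * (y \<bullet> y)) \<le> (\<Sum>i<k. h ^ (2 * i) * ?q i x)"
      proof -
        have "h ^ (2 * k) * (K * (y \<bullet> y)) \<le> (\<Sum>i<k. (h ^ (2 * k) / h\<^sup>2) * ?q i y)"
        proof -
          have "h\<^sup>2 * K * (y \<bullet> y) \<le> c * (y \<bullet> y)"
            using elim by (intro mult_right_mono) auto
          also have "\<dots> \<le> (\<Sum>i<k. ?q i y)" by (rule c(2)[OF y])
          finally have "(h ^ (2 * k) / h\<^sup>2) * (h\<^sup>2 * K * (y \<bullet> y)) \<le> (h ^ (2 * k) / h\<^sup>2) * (\<Sum>i<k. ?q i y)"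
            by (intro mult_left_mono) auto
          then show ?thesis using elim by (simp add: sum_distrib_left)
        qed
        also have "\<dots> \<le> (\<Sum>i<k. h ^ (2 * i) * ?q i x)"
        proof (rule sum_mono)
          fix i assume "i \<in> {..<k}"
          then have i: "i < k" by simp
          have "h ^ (2 * k) \<le> h ^ (2 * i + 2)"
            using elim i by (intro power_decreasing) auto
          then have "h ^ (2 * k) / h\<^sup>2 \<le> h ^ (2 * i)"
            using elim by (simp add: field_simps power_add power2_eq_square)
          then show "h ^ (2 * k) / h\<^sup>2 * ?q i y \<le> h ^ (2 * i) * ?q i x"
            unfolding qx[OF i] by (intro mult_right_mono inner_gram_nonneg)
        qed
        finally show ?thesis .
      qed
      have high: "h ^ (2 * k) * ((m + \<mu>) / 2 * (z \<bullet> z) - C / \<delta> * (y \<bullet> y)) \<le> h ^ (2 * k) * ?q k x"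
      proof (rule mult_left_mono)
        have "(m + \<mu>) / 2 * (z \<bullet> z) \<le> (1 - \<delta>) * ?q k z"
          using mult_left_mono[OF qz, of "1 - \<delta>"] \<delta>(2)
          unfolding \<delta>(3)[symmetric] by (simp add: mult.assoc)
        moreover have "?q k y / \<delta> \<le> C / \<delta> * (y \<bullet> y)"
          using C(2)[OF k, of y] \<delta>(1) by (simp add: divide_right_mono)
        moreover have "(1 - \<delta>) * ?q k z - ?q k y / \<delta> \<le> ?q k x"
          unfolding xyz by (rule gram_form_add_ge[OF \<delta>(1)])
        ultimately show "(m + \<mu>) / 2 * (z \<bullet> z) - C / \<delta> * (y \<bullet> y) \<le> ?q k x"
          by linarith
      qed (use elim in simp)
      have pos: "\<mu> * (x \<bullet> x) < (\<mu> + 1) * (y \<bullet> y) + (m + \<mu>) / 2 * (z \<bullet> z)"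
      proof -
        have "(m - \<mu>) / 2 * (z \<bullet> z) \<ge> 0" "y \<bullet> y \<ge> 0"
          using m by simp_all
        moreover have "y \<bullet> y > 0 \<or> (m - \<mu>) / 2 * (z \<bullet> z) > 0"
          using x0 xyz m by (cases "z = 0") auto
        ultimately have "0 < (y \<bullet> y) + (m - \<mu>) / 2 * (z \<bullet> z)" by linarith
        also have "\<dots> = (\<mu> + 1) * (y \<bullet> y) + (m + \<mu>) / 2 * (z \<bullet> z) - \<mu> * (x \<bullet> x)"
          unfolding xx by (simp add: field_simps)
        finally show ?thesis by simp
      qed
      have "\<mu> * h ^ (2 * k) * (x \<bullet> x) = h ^ (2 * k) * (\<mu> * (x \<bullet> x))" by simp
      also have "\<dots> < h ^ (2 * k) * ((\<mu> + 1) * (y \<bullet> y) + (m + \<mu>) / 2 * (z \<bullet> z))"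
        using elim by (intro mult_strict_left_mono pos) auto
      also have "\<dots> = h ^ (2 * k) * (K * (y \<bullet> y))
          + h ^ (2 * k) * ((m + \<mu>) / 2 * (z \<bullet> z) - C / \<delta> * (y \<bullet> y))"
        by (simp add: K_def algebra_simps)
      also have "\<dots> \<le> (\<Sum>i<k. h ^ (2 * i) * ?q i x) + h ^ (2 * k) * ?q k x"
        by (rule add_mono[OF low high])
      also have "\<dots> = (\<Sum>i\<le>k. h ^ (2 * i) * ?q i x)"
        by (simp add: lessThan_Suc_atMost[symmetric])
      also have "\<dots> \<le> x \<bullet> (calA r N A h *v x)"
        unfolding inner_calA using k elim
        by (intro sum_mono2) (auto intro!: mult_nonneg_nonneg inner_gram_nonneg)
      finally show "\<mu> * h ^ (2 * k) * (x \<bullet> x) < x \<bullet> (calA r N A h *v x)" .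
    qed
  qed
qed

lemma eventually_eigenvalue_count:
  "\<forall>\<^sub>F h in at_right 0. \<forall>E. orthonormal_eigenbasis ((*v) (calA r N A h)) UNIV E \<longrightarrow>
     card {b \<in> E. b \<bullet> (calA r N A h *v b) < \<mu> * h ^ (2 * k)} = card {b \<in> B. b \<bullet> Ahat N A k b < \<mu>}"
  using calA_form_less calA_form_greater
proof eventually_elim
  case (elim h)
  let ?U = "span {b \<in> B. b \<bullet> Ahat N A k b < \<mu>}"
  show ?case
  proof (intro allI impI)
    fix E assume E: "orthonormal_eigenbasis ((*v) (calA r N A h)) UNIV E"
    have "card {b \<in> E. b \<bullet> (calA r N A h *v b) < \<mu> * h ^ (2 * k)} = dim ?U"
    proof (rule eigenvalue_count_eq_dim[OF matrix_vector_mul_linear E])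
      show "dim ?U + dim (orthogonal_comp ?U) = DIM(real^'d)"
        by (rule dim_orthogonal_comp) simp
    qed (use elim in \<open>auto simp: subspace_orthogonal_comp simp del: dim_span\<close>)
    also have "dim ?U = card {b \<in> B. b \<bullet> Ahat N A k b < \<mu>}"
      by (rule dim_span_orthonormal[OF low_space(1)])
    finally show "card {b \<in> E. b \<bullet> (calA r N A h *v b) < \<mu> * h ^ (2 * k)}
        = card {b \<in> B. b \<bullet> Ahat N A k b < \<mu>}" .
  qed
qed

end

section \<open>Asymptotics of the branches\<close>

lemma card_eq_if_image_mset_eq:
  assumes "finite I" "finite J" "image_mset f (mset_set I) = image_mset g (mset_set J)"
  shows "card {i \<in> I. P (f i)} = card {j \<in> J. P (g j)}"
proof -
  have "card {i \<in> I. P (f i)} = size (filter_mset P (image_mset f (mset_set I)))"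
    using assms(1) by (simp add: filter_mset_image_mset)
  also have "\<dots> = card {j \<in> J. P (g j)}"
    using assms(2) by (simp add: assms(3) filter_mset_image_mset)
  finally show ?thesis .
qed

text \<open>Positivity on the right excludes the zero germ and fixes the sign of the leading
  coefficient.\<close>

lemma positive_branch_order:
  assumes f: "real_analytic_at f 0" and pos: "\<forall>\<^sub>F h in at_right 0. f h > 0"
  shows "\<exists>m c. c > 0 \<and> ((\<lambda>h. f h / h ^ m) \<longlongrightarrow> c) (at_right 0)"
proof -
  consider "\<forall>\<^sub>F y in nhds 0. f y = 0" | m g where "real_analytic_at g 0" "g 0 \<noteq> 0"
      "\<forall>\<^sub>F y in nhds 0. f y = (y - 0) ^ m * g y"
    by (rule real_analytic_at_order[OF f]) blast+
  then show ?thesis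
  proof cases
    case 1
    then have "\<forall>\<^sub>F h in at_right 0. f h = 0"
      by (simp add: eventually_at_filter eventually_mono)
    then have "\<forall>\<^sub>F h in at_right (0::real). False"
      using pos by eventually_elim simp
    then show ?thesis by (simp add: trivial_limit_at_right_real)
  next
    case 2
    have "\<forall>\<^sub>F h in at_right 0. f h = h ^ m * g h"
      using 2(3) by (simp add: eventually_at_filter eventually_mono)
    moreover have right: "\<forall>\<^sub>F h in at_right 0. (0::real) < h"
      by (rule eventually_at_right_less)
    ultimately have eq: "\<forall>\<^sub>F h in at_right 0. f h / h ^ m = g h"
      by eventually_elim simp
    have "(g \<longlongrightarrow> g 0) (at_right 0)"
      using real_analytic_at_isCont[OF 2(1)] by (simp add: isCont_def filterlim_at_split)
    then have lim: "((\<lambda>h. f h / h ^ m) \<longlongrightarrow> g 0) (at_right 0)"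
      using tendsto_cong[OF eq] by simp
    have "\<forall>\<^sub>F h in at_right 0. 0 \<le> f h / h ^ m"
      using pos right by eventually_elim simp
    then have "0 \<le> g 0"
      by (rule tendsto_lowerbound[OF lim]) (rule trivial_limit_at_right_real)
    then show ?thesis using lim 2(2) by (intro exI[of _ m] exI[of _ "g 0"]) simp
  qed
qed

text \<open>The exponents decide unless they are equal; then the constants do. A tie
  \<open>c = \<mu>\<close> is excluded because the leading term alone would not settle it.\<close>

lemma eventually_less_power_iff:
  fixes f :: "real \<Rightarrow> real"
  assumes lim: "((\<lambda>h. f h / h ^ m) \<longlongrightarrow> c) (at_right 0)" and c: "c > 0"
    and ne: "m = p \<Longrightarrow> c \<noteq> \<mu>" and \<mu>: "\<mu> > 0"
  shows "\<forall>\<^sub>F h in at_right 0. f h < \<mu> * h ^ p \<longleftrightarrow> p < m \<or> (m = p \<and> c < \<mu>)"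
proof -
  have right: "\<forall>\<^sub>F h in at_right 0. (0::real) < h"
    by (rule eventually_at_right_less)
  consider "p < m" | "m = p" "c < \<mu>" | "m = p" "\<mu> < c" | "m < p"
    using ne by linarith
  then show ?thesis
  proof cases
    case 1
    have "((\<lambda>h. (f h / h ^ m) * h ^ (m - p)) \<longlongrightarrow> c * 0 ^ (m - p)) (at_right 0)"
      by (intro tendsto_intros lim)
    then have "\<forall>\<^sub>F h in at_right 0. (f h / h ^ m) * h ^ (m - p) < \<mu>"
      by (rule order_tendstoD(2)) (use 1 \<mu> in \<open>simp add: power_0_left\<close>)
    then show ?thesis using right
    proof eventually_elim
      case (elim h)
      have "h ^ m = h ^ p * h ^ (m - p)" using 1 by (simp flip: power_add)
      then have "f h / h ^ p < \<mu>" using elim by simp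
      then show ?case using elim(2) 1 by (simp add: field_simps)
    qed
  next
    case 2
    have "\<forall>\<^sub>F h in at_right 0. f h / h ^ m < \<mu>"
      using order_tendstoD(2)[OF lim] 2 by simp
    then show ?thesis using right
      by eventually_elim (use 2 in \<open>simp add: field_simps\<close>)
  next
    case 3
    have "\<forall>\<^sub>F h in at_right 0. \<mu> < f h / h ^ m"
      using order_tendstoD(1)[OF lim] 3 by simp
    then show ?thesis using right
      by eventually_elim (use 3 in \<open>simp add: field_simps\<close>)
  next
    case 4
    have "((\<lambda>h. f h / h ^ m - \<mu> * h ^ (p - m)) \<longlongrightarrow> c - \<mu> * 0 ^ (p - m)) (at_right 0)"
      by (intro tendsto_intros lim)
    then have "\<forall>\<^sub>F h in at_right 0. 0 < f h / h ^ m - \<mu> * h ^ (p - m)"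
      by (rule order_tendstoD(1)) (use 4 c in \<open>simp add: power_0_left\<close>)
    then show ?thesis using right
    proof eventually_elim
      case (elim h)
      have p: "h ^ p = h ^ m * h ^ (p - m)" using 4 by (simp flip: power_add)
      have "\<mu> * h ^ (p - m) * h ^ m < f h"
        using elim by (simp add: field_simps)
      then show ?case using 4 by (simp add: p mult_ac)
    qed
  qed
qed

text \<open>The counts at a threshold that is itself a value are read off at nearby thresholds
  that are not.\<close>

lemma matching_counts:
  fixes c :: "'i \<Rightarrow> real" and e :: "'b \<Rightarrow> real" and m :: "'i \<Rightarrow> nat"
  assumes fin: "finite I" "finite B" and c: "\<And>i. i \<in> I \<Longrightarrow> c i > 0" and e: "\<And>b. b \<in> B \<Longrightarrow> e b \<ge> 0"
    and gen: "\<And>\<mu>. \<mu> > 0 \<Longrightarrow> (\<And>i. i \<in> I \<Longrightarrow> c i \<noteq> \<mu>) \<Longrightarrow> (\<And>b. b \<in> B \<Longrightarrow> e b \<noteq> \<mu>) \<Longrightarrow>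
      card {i \<in> I. p < m i \<or> (m i = p \<and> c i < \<mu>)} = card {b \<in> B. e b < \<mu>}"
  shows "card {i \<in> I. p \<le> m i} = card B"
    and "card {i \<in> I. p < m i} = card {b \<in> B. e b = 0}"
    and "\<mu> \<noteq> 0 \<Longrightarrow> card {i \<in> I. m i = p \<and> c i = \<mu>} = card {b \<in> B. e b = \<mu>}"
proof -
  define S where "S = c ` I \<union> e ` B"
  have finS: "finite S" using fin by (simp add: S_def)
  have SI: "i \<in> I \<Longrightarrow> c i \<in> S" and SB: "b \<in> B \<Longrightarrow> e b \<in> S" for i b by (auto simp: S_def)
  have lt: "card {i \<in> I. p < m i \<or> (m i = p \<and> c i < \<nu>)} = card {b \<in> B. e b < \<nu>}" if \<nu>: "\<nu> > 0" for \<nu>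
  proof -
    obtain d where d: "d > 0" "\<And>s. s \<in> S \<Longrightarrow> s \<noteq> \<nu> \<Longrightarrow> d \<le> dist \<nu> s"
      using finite_set_avoid[OF finS] by metis
    \<comment> \<open>No value other than \<open>\<nu>\<close> is within distance \<open>d\<close>
      of \<open>\<nu>\<close>, so nothing in \<open>S\<close> lies in \<open>[\<mu>, \<nu>)\<close>;
      the term \<open>\<nu> / 2\<close> keeps the threshold positive.\<close>
    define \<mu> where "\<mu> = max (\<nu> / 2) (\<nu> - d / 2)"
    have \<mu>: "\<mu> > 0" "\<mu> < \<nu>" using \<nu> d(1) by (auto simp: \<mu>_def)
    have S: "s \<noteq> \<mu> \<and> (s < \<mu> \<longleftrightarrow> s < \<nu>)" if "s \<in> S" for s
      using d(2)[OF that] d(1) \<mu> by (cases "s = \<nu>") (auto simp: \<mu>_def dist_real_def)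
    have "{i \<in> I. p < m i \<or> (m i = p \<and> c i < \<mu>)} = {i \<in> I. p < m i \<or> (m i = p \<and> c i < \<nu>)}"
      "{b \<in> B. e b < \<mu>} = {b \<in> B. e b < \<nu>}"
      using S SI SB by blast+
    then show ?thesis using gen[OF \<mu>(1)] S SI SB by metis
  qed
  have le: "card {i \<in> I. p < m i \<or> (m i = p \<and> c i \<le> \<nu>)} = card {b \<in> B. e b \<le> \<nu>}" if \<nu>: "\<nu> > 0" for \<nu>
  proof -
    obtain d where d: "d > 0" "\<And>s. s \<in> S \<Longrightarrow> s \<noteq> \<nu> \<Longrightarrow> d \<le> dist \<nu> s"
      using finite_set_avoid[OF finS] by metis
    define \<mu> where "\<mu> = \<nu> + d / 2"
    have \<mu>: "\<mu> > 0" using \<nu> d(1) by (auto simp: \<mu>_def)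
    have S: "s \<noteq> \<mu> \<and> (s < \<mu> \<longleftrightarrow> s \<le> \<nu>)" if "s \<in> S" for s
      using d(2)[OF that] d(1) by (cases "s = \<nu>") (auto simp: \<mu>_def dist_real_def)
    have "{i \<in> I. p < m i \<or> (m i = p \<and> c i < \<mu>)} = {i \<in> I. p < m i \<or> (m i = p \<and> c i \<le> \<nu>)}"
      "{b \<in> B. e b < \<mu>} = {b \<in> B. e b \<le> \<nu>}"
      using S SI SB by blast+
    then show ?thesis using gen[OF \<mu>] S SI SB by metis
  qed
  show "card {i \<in> I. p \<le> m i} = card B"
  proof -
    \<comment> \<open>Above all values the constants impose no condition, and only the exponents are
      counted.\<close>
    define \<nu> where "\<nu> = Max (insert 1 S)"
    have "1 \<le> \<nu>" "\<And>s. s \<in> S \<Longrightarrow> s \<le> \<nu>"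
      unfolding \<nu>_def using finS by (auto intro!: Max_ge simp del: Max_insert)
    then have \<nu>: "\<nu> > 0" "\<And>s. s \<in> S \<Longrightarrow> s \<le> \<nu>" by auto
    have "{i \<in> I. p < m i \<or> (m i = p \<and> c i \<le> \<nu>)} = {i \<in> I. p \<le> m i}" "{b \<in> B. e b \<le> \<nu>} = B"
      using \<nu>(2) SI SB by (auto simp: le_less)
    then show ?thesis using le[OF \<nu>(1)] by simp
  qed
  show "card {i \<in> I. p < m i} = card {b \<in> B. e b = 0}"
  proof -
    \<comment> \<open>\<open>d\<close> is at most every nonzero value: no \<open>c i\<close> lies
      below it, and \<open>e b < d\<close> means \<open>e b = 0\<close>.\<close>
    obtain d where d: "d > 0" "\<And>s. s \<in> S \<Longrightarrow> s \<noteq> 0 \<Longrightarrow> d \<le> dist 0 s"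
      using finite_set_avoid[OF finS] by metis
    have "\<not> c i < d" if "i \<in> I" for i
      using d(2)[OF SI[OF that]] c[OF that] by (auto simp: dist_real_def)
    moreover have "e b < d \<longleftrightarrow> e b = 0" if "b \<in> B" for b
      using d(1) d(2)[OF SB[OF that]] e[OF that] by (cases "e b = 0") (auto simp: dist_real_def)
    ultimately have "{i \<in> I. p < m i \<or> (m i = p \<and> c i < d)} = {i \<in> I. p < m i}"
      "{b \<in> B. e b < d} = {b \<in> B. e b = 0}"
      by blast+
    then show ?thesis using lt[OF d(1)] by simp
  qed
  show "card {i \<in> I. m i = p \<and> c i = \<mu>} = card {b \<in> B. e b = \<mu>}" if "\<mu> \<noteq> 0"
  proof (cases "\<mu> > 0")
    case True
    have "card {i \<in> I. p < m i \<or> (m i = p \<and> c i \<le> \<mu>)}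
        = card {i \<in> I. p < m i \<or> (m i = p \<and> c i < \<mu>)} + card {i \<in> I. m i = p \<and> c i = \<mu>}"
      by (subst card_Un_disjoint[symmetric]) (use fin in \<open>auto intro!: arg_cong[of _ _ card]\<close>)
    moreover have "card {b \<in> B. e b \<le> \<mu>} = card {b \<in> B. e b < \<mu>} + card {b \<in> B. e b = \<mu>}"
      by (subst card_Un_disjoint[symmetric]) (use fin in \<open>auto intro!: arg_cong[of _ _ card]\<close>)
    ultimately show ?thesis using le[OF True] lt[OF True] by simp
  next
    case False
    then have "{i \<in> I. m i = p \<and> c i = \<mu>} = {}" "{b \<in> B. e b = \<mu>} = {}"
      using c e that by force+
    then show ?thesis by (simp only: card.empty)
  qed
qed

text \<open>Any eigenbasis will do: only the multiset of its eigenvalues is used, and no regularity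
  in \<open>h\<close> is asked of the vectors.\<close>

definition calA_basis :: "nat \<Rightarrow> (nat \<Rightarrow> nat) \<Rightarrow> (nat \<Rightarrow> nat \<Rightarrow> real^'d) \<Rightarrow> real \<Rightarrow> (real^'d) set" where
  "calA_basis r N A h = (SOME E. orthonormal_eigenbasis ((*v) (calA r N A h)) UNIV E)"

definition calA_spectrum :: "nat \<Rightarrow> (nat \<Rightarrow> nat) \<Rightarrow> (nat \<Rightarrow> nat \<Rightarrow> real^'d) \<Rightarrow> real \<Rightarrow> real multiset" where
  "calA_spectrum r N A h = image_mset (\<lambda>b. b \<bullet> (calA r N A h *v b)) (mset_set (calA_basis r N A h))"

lemma calA_basis: "orthonormal_eigenbasis ((*v) (calA r N A h)) UNIV (calA_basis r N A h)"
  unfolding calA_basis_def by (rule someI_ex[OF calA_eigenbasis])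

lemma calA_basis_finite: "finite (calA_basis r N A h)"
  using calA_basis orthonormal_finite unfolding orthonormal_eigenbasis_def by blast

lemma size_calA_spectrum:
  fixes A :: "nat \<Rightarrow> nat \<Rightarrow> real^'d"
  shows "size (calA_spectrum r N A h) = CARD('d)"
proof -
  have "card (calA_basis r N A h) = dim (UNIV :: (real^'d) set)"
    using calA_basis[of r N A h] dim_span_orthonormal unfolding orthonormal_eigenbasis_def by metis
  then show ?thesis by (simp add: calA_spectrum_def)
qed

lemma calA_spectrum_branches:
  fixes A :: "nat \<Rightarrow> nat \<Rightarrow> real^'d"
  shows "\<exists>a<0. \<exists>f. branches_on (calA_spectrum r N A) CARD('d) {a<..} f"
proof (rule global_branches[OF has_branches_if_psum_analytic])
  fix k x
  have "psum k (calA_spectrum r N A h) = (\<Sum>i\<in>Basis. \<Sum>a\<in>UNIV. i $ a * (((*v) (calA r N A h)) ^^ k) i $ a)" for h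
  proof -
    have "psum k (calA_spectrum r N A h) = (\<Sum>b\<in>calA_basis r N A h. (b \<bullet> (calA r N A h *v b)) ^ k)"
      by (simp add: psum_def calA_spectrum_def image_mset.compositionality o_def sum_unfold_sum_mset)
    also have "\<dots> = (\<Sum>i\<in>Basis. i \<bullet> (((*v) (calA r N A h)) ^^ k) i)"
      by (rule eigenbasis_trace_funpow[OF matrix_vector_mul_linear calA_basis])
    finally show ?thesis by (simp add: inner_vec_def)
  qed
  then show "real_analytic_at (\<lambda>h. psum k (calA_spectrum r N A h)) x"
    by (simp only:) (intro real_analytic_at_sum real_analytic_at_mult real_analytic_at_const
        real_analytic_calA_funpow)
qed (simp_all add: size_calA_spectrum)

text \<open>Some form is positive at \<open>b\<close>, the others are nonnegative and all weights
  are positive. This excludes branches vanishing near 0, so that each has a finite order.\<close>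

lemma calA_eigenvalue_pos:
  assumes ker: "(\<Inter>i\<in>{0..r}. mat_ker (N i) (A i)) = {0}" and h: "h > 0" and b: "b \<noteq> 0"
  shows "b \<bullet> (calA r N A h *v b) > 0"
proof -
  have "b \<notin> (\<Inter>i\<in>{0..r}. mat_ker (N i) (A i))" unfolding ker using b by simp
  then obtain i where i: "i \<le> r" "b \<notin> mat_ker (N i) (A i)" by auto
  then have "b \<bullet> (gram (N i) (A i) *v b) > 0"
    using inner_gram_nonneg[of b "N i" "A i"] by (simp add: less_le inner_gram_eq_0_iff eq_commute[of 0])
  then show ?thesis
    unfolding inner_calA using i(1) h
    by (intro sum_pos2[of _ i]) (auto intro!: mult_nonneg_nonneg inner_gram_nonneg)
qed

theorem theorem3p2:
  fixes r :: nat and N :: "nat \<Rightarrow> nat" and A :: "nat \<Rightarrow> nat \<Rightarrow> real^'d"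
  assumes ker: "(\<Inter>i\<in>{0..r}. mat_ker (N i) (A i)) = {0}"
  shows "ndim N A r = CARD('d) \<and>
    (\<exists>(lam :: nat \<Rightarrow> nat \<Rightarrow> real \<Rightarrow> real) (eta :: nat \<Rightarrow> nat \<Rightarrow> real \<Rightarrow> real).
       (\<forall>j\<le>r. \<forall>i\<in>{1..nincr N A j}.
          (\<exists>S. open S \<and> {0..} \<subseteq> S \<and> real_analytic_on (lam j i) S)
        \<and> real_analytic_on (eta j i) {0<..}
        \<and> (\<forall>h>0. lam j i h = h ^ (2 * j) * eta j i h)
        \<and> (\<exists>\<mu>. \<mu> \<noteq> 0 \<and> (eta j i \<longlongrightarrow> \<mu>) (at_right 0)))
     \<and> (\<forall>h\<ge>0. \<forall>\<mu>. card {(j, i). j \<le> r \<and> i \<in> {1..nincr N A j} \<and> lam j i h = \<mu>}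
                    = alg_mult (\<lambda>x. calA r N A h *v x) UNIV \<mu>)
     \<and> (\<forall>j\<le>r. \<forall>\<mu>. \<mu> \<noteq> 0 \<longrightarrow>
          card {i \<in> {1..nincr N A j}. (eta j i \<longlongrightarrow> \<mu>) (at_right 0)}
            = alg_mult (Ahat N A j) (Wdom N A j) \<mu>))"
proof -
  let ?d = "CARD('d)" and ?E = "calA_basis r N A"
  let ?I = "{..<?d}"
  have "Wdom N A (Suc r) = {0}"
    using ker by (simp add: Wdom_eq lessThan_Suc_atMost atLeast0AtMost)
  then have Wr: "dim (Wdom N A (Suc r)) = 0" by simp
  have ndim: "ndim N A r = ?d"
    using ndim_add_dim_Wdom[of N A r] Wr by simp
  obtain a f where a: "a < 0" and f: "branches_on (calA_spectrum r N A) ?d {a<..} f"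
    using calA_spectrum_branches[of r N A] by blast
  have f_an: "real_analytic_at (f i) x" if "i \<in> ?I" "x > a" for i x
    using f that by (simp add: branches_on_def)
  have count: "card {i \<in> ?I. P (f i h)} = card {b \<in> ?E h. P (b \<bullet> (calA r N A h *v b))}" if "h > a" for h P
  proof (rule card_eq_if_image_mset_eq[where f = "\<lambda>i. f i h" and g = "\<lambda>b. b \<bullet> (calA r N A h *v b)"])
    show "image_mset (\<lambda>i. f i h) (mset_set ?I) = image_mset (\<lambda>b. b \<bullet> (calA r N A h *v b)) (mset_set (?E h))"
      using f that by (simp add: branches_on_def calA_spectrum_def)
  qed (simp_all add: calA_basis_finite)
  have f_pos: "f i h > 0" if "i \<in> ?I" "h > 0" for i h
  proof -
    have "b \<noteq> 0" if "b \<in> ?E h" for b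
      using calA_basis[of r N A h] that by (auto simp: orthonormal_eigenbasis_def orthonormal_def)
    then have none: "{b \<in> ?E h. \<not> 0 < b \<bullet> (calA r N A h *v b)} = {}"
      using calA_eigenvalue_pos[OF ker that(2)] by blast
    have "card {i \<in> ?I. \<not> 0 < f i h} = 0"
      using count[of h "\<lambda>x. \<not> 0 < x"] a that(2) unfolding none by simp
    then show ?thesis using that(1) by auto
  qed
  have "\<exists>m c. c > 0 \<and> ((\<lambda>h. f i h / h ^ m) \<longlongrightarrow> c) (at_right 0)" if "i \<in> ?I" for i
    using f_an[OF that a] f_pos[OF that]
    by (intro positive_branch_order) (auto intro: eventually_mono[OF eventually_at_right_less])
  then obtain m c where c: "\<And>i. i \<in> ?I \<Longrightarrow> c i > 0"
    and lim: "\<And>i. i \<in> ?I \<Longrightarrow> ((\<lambda>h. f i h / h ^ m i) \<longlongrightarrow> c i) (at_right 0)"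
    by metis
  obtain B where B: "\<And>k. orthonormal_eigenbasis (Ahat N A k) (Wdom N A k) (B k)"
    using Ahat_eigenbasis[of N A] by metis
  have finB: "finite (B k)" for k
    using B[of k] orthonormal_finite by (auto simp: orthonormal_eigenbasis_def)
  have gen: "card {i \<in> ?I. 2 * k < m i \<or> (m i = 2 * k \<and> c i < \<mu>)} = card {b \<in> B k. b \<bullet> Ahat N A k b < \<mu>}"
    if k: "k \<le> r" and \<mu>: "\<mu> > 0" "\<And>i. i \<in> ?I \<Longrightarrow> c i \<noteq> \<mu>" "\<And>b. b \<in> B k \<Longrightarrow> b \<bullet> Ahat N A k b \<noteq> \<mu>" for k \<mu>
  proof -
    have "\<forall>\<^sub>F h in at_right 0. \<forall>i\<in>?I. f i h < \<mu> * h ^ (2 * k) \<longleftrightarrow> 2 * k < m i \<or> (m i = 2 * k \<and> c i < \<mu>)"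
      using lim c \<mu> by (intro eventually_ball_finite ballI eventually_less_power_iff) auto
    moreover have "\<forall>\<^sub>F h in at_right (0::real). 0 < h"
      by (rule eventually_at_right_less)
    moreover have "\<forall>\<^sub>F h in at_right 0. \<forall>E. orthonormal_eigenbasis ((*v) (calA r N A h)) UNIV E \<longrightarrow>
        card {b \<in> E. b \<bullet> (calA r N A h *v b) < \<mu> * h ^ (2 * k)} = card {b \<in> B k. b \<bullet> Ahat N A k b < \<mu>}"
      by (rule eventually_eigenvalue_count[OF k B \<mu>(1)]) (rule \<mu>(3))
    ultimately have "\<forall>\<^sub>F h in at_right (0::real).
        card {i \<in> ?I. 2 * k < m i \<or> (m i = 2 * k \<and> c i < \<mu>)} = card {b \<in> B k. b \<bullet> Ahat N A k b < \<mu>}"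
    proof eventually_elim
      case (elim h)
      have "{i \<in> ?I. 2 * k < m i \<or> (m i = 2 * k \<and> c i < \<mu>)} = {i \<in> ?I. f i h < \<mu> * h ^ (2 * k)}"
        using elim(1) by blast
      also have "card \<dots> = card {b \<in> ?E h. b \<bullet> (calA r N A h *v b) < \<mu> * h ^ (2 * k)}"
        using elim(2) a by (intro count) simp
      also have "\<dots> = card {b \<in> B k. b \<bullet> Ahat N A k b < \<mu>}"
        using elim(3) calA_basis by blast
      finally show ?case .
    qed
    \<comment> \<open>Neither side depends on \<open>h\<close>, and \<open>at_right 0\<close> is a
      proper filter, so the eventual equality holds outright.\<close>
    then show ?thesis by (simp add: eventually_const_iff)
  qed
  have ge: "card {i \<in> ?I. 2 * k \<le> m i} = dim (Wdom N A k)"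
    and gt: "card {i \<in> ?I. 2 * k < m i} = dim (Wdom N A (Suc k))"
    and eq: "\<And>\<mu>. \<mu> \<noteq> 0 \<Longrightarrow> card {i \<in> ?I. m i = 2 * k \<and> c i = \<mu>} = alg_mult (Ahat N A k) (Wdom N A k) \<mu>"
    if k: "k \<le> r" for k
  proof -
    note counts = matching_counts[where I = ?I and B = "B k" and c = c and e = "\<lambda>b. b \<bullet> Ahat N A k b"
        and m = m and p = "2 * k"]
    show "card {i \<in> ?I. 2 * k \<le> m i} = dim (Wdom N A k)"
      unfolding card_Ahat_eigenbasis(1)[OF B, symmetric]
      by (rule counts(1)) (use finB c Ahat_eigenvalue_nonneg[OF B] gen[OF k] in auto)
    show "card {i \<in> ?I. 2 * k < m i} = dim (Wdom N A (Suc k))"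
      unfolding card_Ahat_eigenbasis(2)[OF B, symmetric]
      by (rule counts(2)) (use finB c Ahat_eigenvalue_nonneg[OF B] gen[OF k] in auto)
    show "card {i \<in> ?I. m i = 2 * k \<and> c i = \<mu>} = alg_mult (Ahat N A k) (Wdom N A k) \<mu>" if "\<mu> \<noteq> 0" for \<mu>
      unfolding alg_mult_eigenbasis[OF linear_Ahat B]
      by (rule counts(3)) (use finB c Ahat_eigenvalue_nonneg[OF B] gen[OF k] that in auto)
  qed
  have nincr: "card {i \<in> ?I. m i = 2 * j} = nincr N A j" if "j \<le> r" for j
  proof -
    have "card {i \<in> ?I. 2 * j \<le> m i} = card {i \<in> ?I. 2 * j < m i} + card {i \<in> ?I. m i = 2 * j}"
      by (subst card_Un_disjoint[symmetric]) (auto intro!: arg_cong[of _ _ card])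
    then show ?thesis using ge[OF that] gt[OF that] by (simp add: nincr_eq)
  qed
  have m_even: "\<exists>j\<le>r. m i = 2 * j" if i: "i \<in> ?I" for i
  proof -
    have "{i \<in> ?I. 2 * r < m i} = {}" using gt[of r] Wr by simp
    then have "m i \<le> 2 * r" using i by fastforce
    moreover have "even (m i)"
    proof (rule ccontr)
      assume "odd (m i)"
      then obtain k where k: "m i = 2 * k + 1" by (elim oddE)
      then have "k < r" using \<open>m i \<le> 2 * r\<close> by simp
      \<comment> \<open>Both counts equal \<open>dim (Wdom N A (Suc k))\<close>. A branch of order
        \<open>2k+1\<close> would lie in the larger set only.\<close>
      then have "card {i \<in> ?I. 2 * Suc k \<le> m i} = card {i \<in> ?I. 2 * k < m i}"
        using ge[of "Suc k"] gt[of k] by simp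
      then have "{i \<in> ?I. 2 * Suc k \<le> m i} = {i \<in> ?I. 2 * k < m i}"
        by (intro card_subset_eq) auto
      moreover have "i \<in> {i \<in> ?I. 2 * k < m i}" using i k by simp
      ultimately have "i \<in> {i \<in> ?I. 2 * Suc k \<le> m i}" by (simp only:)
      then show False using k by simp
    qed
    ultimately show ?thesis by (auto elim!: evenE)
  qed
  \<comment> \<open>Group \<open>j\<close> consists of the branches of order exactly
    \<open>2j\<close>, renumbered from 1.\<close>
  have "\<exists>g. bij_betw g {1..nincr N A j} {i \<in> ?I. m i = 2 * j}" if "j \<le> r" for j
    using nincr[OF that] by (intro finite_same_card_bij) auto
  then obtain g where g: "\<And>j. j \<le> r \<Longrightarrow> bij_betw (g j) {1..nincr N A j} {i \<in> ?I. m i = 2 * j}"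
    by metis
  have gI: "g j i \<in> ?I" "m (g j i) = 2 * j" if "j \<le> r" "i \<in> {1..nincr N A j}" for j i
    using bij_betwE[OF g[OF that(1)]] that(2) by auto
  define lam where "lam j i = f (g j i)" for j i
  \<comment> \<open>At \<open>h = 0\<close> and \<open>j > 0\<close> the quotient is the default 0;
    the claims about \<open>eta\<close> concern only \<open>h > 0\<close> and the limit from the
    right.\<close>
  define eta where "eta j i h = f (g j i) h / h ^ (2 * j)" for j i h
  have eta_lim: "(eta j i \<longlongrightarrow> c (g j i)) (at_right 0)" if "j \<le> r" "i \<in> {1..nincr N A j}" for j i
    using lim[OF gI(1)[OF that]] gI(2)[OF that] by (simp add: eta_def[abs_def])
  have branch: "(\<exists>S. open S \<and> {0..} \<subseteq> S \<and> real_analytic_on (lam j i) S)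
        \<and> real_analytic_on (eta j i) {0<..}
        \<and> (\<forall>h>0. lam j i h = h ^ (2 * j) * eta j i h)
        \<and> (\<exists>\<mu>. \<mu> \<noteq> 0 \<and> (eta j i \<longlongrightarrow> \<mu>) (at_right 0))" if ji: "j \<le> r" "i \<in> {1..nincr N A j}" for j i
  proof (intro conjI)
    have "real_analytic_on (lam j i) {a<..}"
      unfolding lam_def using gI[OF ji] by (intro real_analytic_on_if_at f_an) auto
    then show "\<exists>S. open S \<and> {0..} \<subseteq> S \<and> real_analytic_on (lam j i) S"
      using a by (intro exI[of _ "{a<..}"]) auto
    show "real_analytic_on (eta j i) {0<..}"
      unfolding eta_def[abs_def] using gI[OF ji] a
      by (intro real_analytic_on_if_at real_analytic_at_divide f_an real_analytic_at_power
          real_analytic_at_ident) auto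
    show "\<forall>h>0. lam j i h = h ^ (2 * j) * eta j i h"
      by (simp add: lam_def eta_def)
    show "\<exists>\<mu>. \<mu> \<noteq> 0 \<and> (eta j i \<longlongrightarrow> \<mu>) (at_right 0)"
      using eta_lim[OF ji] c[OF gI(1)[OF ji]] by (intro exI[of _ "c (g j i)"]) auto
  qed
  have spectrum: "card {(j, i). j \<le> r \<and> i \<in> {1..nincr N A j} \<and> lam j i h = \<mu>}
      = alg_mult (\<lambda>x. calA r N A h *v x) UNIV \<mu>" if h: "h \<ge> 0" for h \<mu>
  proof -
    have "bij_betw (\<lambda>(j, i). g j i) {(j, i). j \<le> r \<and> i \<in> {1..nincr N A j} \<and> lam j i h = \<mu>}
        {i \<in> ?I. f i h = \<mu>}"
    proof (rule bij_betw_imageI)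
      show "inj_on (\<lambda>(j, i). g j i) {(j, i). j \<le> r \<and> i \<in> {1..nincr N A j} \<and> lam j i h = \<mu>}"
      proof (rule inj_onI, clarify)
        fix j i j' i'
        assume j: "j \<le> r" "i \<in> {1..nincr N A j}" "j' \<le> r" "i' \<in> {1..nincr N A j'}" "g j i = g j' i'"
        \<comment> \<open>The group is recovered from the order of the branch, so different groups
          share no branch.\<close>
        then have "j = j'" using gI(2)[of j i] gI(2)[of j' i'] by simp
        then show "j = j' \<and> i = i'"
          using j bij_betw_imp_inj_on[OF g[OF j(1)]] by (auto dest: inj_onD)
      qed
      show "(\<lambda>(j, i). g j i) ` {(j, i). j \<le> r \<and> i \<in> {1..nincr N A j} \<and> lam j i h = \<mu>} = {i \<in> ?I. f i h = \<mu>}"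
      proof (intro equalityI subsetI)
        fix l assume "l \<in> {i \<in> ?I. f i h = \<mu>}"
        then have l: "l \<in> ?I" "f l h = \<mu>" by auto
        obtain j where j: "j \<le> r" "m l = 2 * j" using m_even[OF l(1)] by blast
        then have "l \<in> g j ` {1..nincr N A j}"
          using l(1) bij_betw_imp_surj_on[OF g[OF j(1)]] by simp
        then obtain i where "i \<in> {1..nincr N A j}" "l = g j i" by blast
        then show "l \<in> (\<lambda>(j, i). g j i) ` {(j, i). j \<le> r \<and> i \<in> {1..nincr N A j} \<and> lam j i h = \<mu>}"
          using j l(2) by (force simp: lam_def)
      next
        fix l assume "l \<in> (\<lambda>(j, i). g j i) ` {(j, i). j \<le> r \<and> i \<in> {1..nincr N A j} \<and> lam j i h = \<mu>}"
        then obtain j i where "j \<le> r" "i \<in> {1..nincr N A j}" "lam j i h = \<mu>" "l = g j i" by auto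
        then show "l \<in> {i \<in> ?I. f i h = \<mu>}" using gI(1) by (auto simp: lam_def)
      qed
    qed
    then have "card {(j, i). j \<le> r \<and> i \<in> {1..nincr N A j} \<and> lam j i h = \<mu>} = card {i \<in> ?I. f i h = \<mu>}"
      by (rule bij_betw_same_card)
    \<comment> \<open>\<open>count\<close> holds for every \<open>h > a\<close> with
      \<open>a < 0\<close>, hence also at \<open>h = 0\<close>.\<close>
    also have "\<dots> = card {b \<in> ?E h. b \<bullet> (calA r N A h *v b) = \<mu>}"
      using a h by (intro count) simp
    also have "\<dots> = alg_mult (\<lambda>x. calA r N A h *v x) UNIV \<mu>"
      by (rule alg_mult_eigenbasis[OF matrix_vector_mul_linear calA_basis, symmetric])
    finally show ?thesis .
  qed
  have limits: "card {i \<in> {1..nincr N A j}. (eta j i \<longlongrightarrow> \<mu>) (at_right 0)}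
            = alg_mult (Ahat N A j) (Wdom N A j) \<mu>" if j: "j \<le> r" and \<mu>: "\<mu> \<noteq> 0" for j \<mu>
  proof -
    have iff: "(eta j i \<longlongrightarrow> \<mu>) (at_right 0) \<longleftrightarrow> c (g j i) = \<mu>" if "i \<in> {1..nincr N A j}" for i
      using eta_lim[OF j that] tendsto_unique[OF trivial_limit_at_right_real] by blast
    have "g j ` {i \<in> {1..nincr N A j}. (eta j i \<longlongrightarrow> \<mu>) (at_right 0)}
        = {l \<in> g j ` {1..nincr N A j}. c l = \<mu>}"
      using iff by blast
    also have "\<dots> = {l \<in> ?I. m l = 2 * j \<and> c l = \<mu>}"
      unfolding bij_betw_imp_surj_on[OF g[OF j]] by blast
    finally have im: "g j ` {i \<in> {1..nincr N A j}. (eta j i \<longlongrightarrow> \<mu>) (at_right 0)}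
        = {l \<in> ?I. m l = 2 * j \<and> c l = \<mu>}" .
    have "inj_on (g j) {i \<in> {1..nincr N A j}. (eta j i \<longlongrightarrow> \<mu>) (at_right 0)}"
      by (rule inj_on_subset[OF bij_betw_imp_inj_on[OF g[OF j]]]) blast
    from card_image[OF this] show ?thesis
      unfolding im using eq[OF j \<mu>] by simp
  qed
  show ?thesis
    by (intro conjI ndim exI[of _ lam] exI[of _ eta]; intro allI ballI impI)
      (fact branch spectrum limits)+
qed

end
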